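(* Let $k$ be a field of characteristic zero, let $x,y,z$ be indeterminates over $k$, let $R^*=k[y,z]_{(y,z)}[[x]]$, and let $\alpha,\beta\in xk[[x]]$ be algebraically independent over $k(x)$. Set $f=(y-\alpha)^2$, $g=(z-\beta)^2$, $A=k(x,y,z,f,g)\cap R^*$ (intersection taken inside the fraction field of $R^*$), and $P=(f,g)A$. Let $\widehat A$ be the completion of $A$ with respect to the powers of its maximal ideal. Then $P$ is a normal ideal of $A$, i.e. $P^n$ is integrally closed for every $n\ge1$. Thus the Rees algebra $A[Pt]=A[ft,gt]$ is a normal domain, while the Rees algebra $\widehat A[ft,gt]$ is not integrally closed.
   Context: Known facts about this setting: $A$ is a three-dimensional regular local domain, $P=(f,g)A$ is a prime ideal of $A$ of height two, and $\widehat A=k[[x,y,z]]$ via the inclusions $A\subseteq R^*\subseteq k[[x,y,z]]$. An element $r$ of a commutative ring $R$ is integral over an ideal $I$ if there are $n\ge 1$ and $a_i\in I^i$ ($1\le i\le n$) with $r^n+\sum_{i=1}^n a_ir^{n-i}=0$; $I$ is integrally closed if it contains every element of $R$ integral over it. An ideal is normal if all of its powers are integrally closed. Here $t$ is an indeterminate, $A[Pt]=A[ft,gt]\subseteq A[t]$ and $\widehat A[ft,gt]\subseteq\widehat A[t]$ are the Rees algebras of $P$ and $P\widehat A$. A domain is normal (integrally closed) if it is integrally closed in its field of fractions. *)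

theory Defs
  imports
    "HOL-Algebra.Algebra"
    "HOL-Algebra.Algebraic_Closure_Type"
    "HOL-Computational_Algebra.Computational_Algebra"
begin

section \<open>Integral closure of ideals and of domains\<close>

abbreviation ideal_pow :: "('a, 'm) ring_scheme \<Rightarrow> 'a set \<Rightarrow> nat \<Rightarrow> 'a set" where
  "ideal_pow R I n \<equiv> I [^]\<^bsub>ideals_set R\<^esub> n"

definition integral_over_ideal :: "('a, 'm) ring_scheme \<Rightarrow> 'a set \<Rightarrow> 'a \<Rightarrow> bool" where
  "integral_over_ideal R I r \<longleftrightarrow>
     (\<exists>n\<ge>1. \<exists>a. (\<forall>i\<in>{1..n}. a i \<in> ideal_pow R I i) \<and>
        r [^]\<^bsub>R\<^esub> n \<oplus>\<^bsub>R\<^esub> (\<Oplus>\<^bsub>R\<^esub>i\<in>{1..n}. a i \<otimes>\<^bsub>R\<^esub> r [^]\<^bsub>R\<^esub> (n - i)) = \<zero>\<^bsub>R\<^esub>)"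

definition integrally_closed_ideal :: "('a, 'm) ring_scheme \<Rightarrow> 'a set \<Rightarrow> bool" where
  "integrally_closed_ideal R I \<longleftrightarrow> (\<forall>r\<in>carrier R. integral_over_ideal R I r \<longrightarrow> r \<in> I)"

definition normal_ideal :: "('a, 'm) ring_scheme \<Rightarrow> 'a set \<Rightarrow> bool" where
  "normal_ideal R I \<longleftrightarrow> (\<forall>n\<ge>1. integrally_closed_ideal R (ideal_pow R I n))"

definition frac_rel :: "('a, 'm) ring_scheme \<Rightarrow> (('a \<times> 'a) \<times> ('a \<times> 'a)) set" where
  "frac_rel R = {((a, b), (c, d)).
     a \<in> carrier R \<and> b \<in> carrier R - {\<zero>\<^bsub>R\<^esub>} \<and> c \<in> carrier R \<and> d \<in> carrier R - {\<zero>\<^bsub>R\<^esub>} \<and>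
     a \<otimes>\<^bsub>R\<^esub> d = c \<otimes>\<^bsub>R\<^esub> b}"

definition frac_class :: "('a, 'm) ring_scheme \<Rightarrow> 'a \<Rightarrow> 'a \<Rightarrow> ('a \<times> 'a) set" where
  "frac_class R a b = frac_rel R `` {(a, b)}"

text \<open>The field of fractions; meaningful when \<open>R\<close> is a domain.\<close>

definition frac_field :: "('a, 'm) ring_scheme \<Rightarrow> ('a \<times> 'a) set ring" where
  "frac_field R =
    \<lparr>carrier = (carrier R \<times> (carrier R - {\<zero>\<^bsub>R\<^esub>})) // frac_rel R,
     monoid.mult = (\<lambda>u v. \<Union>(a, b)\<in>u. \<Union>(c, d)\<in>v. frac_class R (a \<otimes>\<^bsub>R\<^esub> c) (b \<otimes>\<^bsub>R\<^esub> d)),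
     monoid.one = frac_class R \<one>\<^bsub>R\<^esub> \<one>\<^bsub>R\<^esub>,
     ring.zero = frac_class R \<zero>\<^bsub>R\<^esub> \<one>\<^bsub>R\<^esub>,
     ring.add = (\<lambda>u v. \<Union>(a, b)\<in>u. \<Union>(c, d)\<in>v.
              frac_class R (a \<otimes>\<^bsub>R\<^esub> d \<oplus>\<^bsub>R\<^esub> c \<otimes>\<^bsub>R\<^esub> b) (b \<otimes>\<^bsub>R\<^esub> d))\<rparr>"

definition frac_image :: "('a, 'm) ring_scheme \<Rightarrow> ('a \<times> 'a) set set" where
  "frac_image R = (\<lambda>a. frac_class R a \<one>\<^bsub>R\<^esub>) ` carrier R"

definition integral_over_subring :: "('a, 'm) ring_scheme \<Rightarrow> 'a set \<Rightarrow> 'a \<Rightarrow> bool" where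
  "integral_over_subring L B q \<longleftrightarrow>
     (\<exists>n\<ge>(1::nat). \<exists>a. (\<forall>i\<in>{1..n}. a i \<in> B) \<and>
        q [^]\<^bsub>L\<^esub> n \<oplus>\<^bsub>L\<^esub> (\<Oplus>\<^bsub>L\<^esub>i\<in>{1..n}. a i \<otimes>\<^bsub>L\<^esub> q [^]\<^bsub>L\<^esub> (n - i)) = \<zero>\<^bsub>L\<^esub>)"

text \<open>To be used for domains only; \<open>domain R\<close> is always asserted separately.\<close>

definition integrally_closed :: "('a, 'm) ring_scheme \<Rightarrow> bool" where
  "integrally_closed R \<longleftrightarrow>
     (\<forall>q\<in>carrier (frac_field R).
        integral_over_subring (frac_field R) (frac_image R) q \<longrightarrow> q \<in> frac_image R)"


section \<open>Rees algebras and completions\<close>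

text \<open>\<open>adjoin_t R F\<close> is the subring \<open>R[st : s \<in> F]\<close> of \<open>R[t]\<close>. For an ideal \<open>F = I\<close> this is the
  Rees algebra \<open>R[It]\<close>; for \<open>F = {f, g}\<close> it is \<open>R[ft, gt]\<close>.\<close>

definition adjoin_t :: "('a, 'm) ring_scheme \<Rightarrow> 'a set \<Rightarrow> ('a, nat \<Rightarrow> 'a) up_ring" where
  "adjoin_t R F = (UP R)\<lparr>carrier := generate_ring (UP R)
     ((\<lambda>a. up_ring.monom (UP R) a 0) ` carrier R \<union> (\<lambda>s. up_ring.monom (UP R) s 1) ` F)\<rparr>"

text \<open>The inverse limit of the rings \<open>R/I\<^sup>n\<close>. The inclusion \<open>s (Suc n) \<subseteq> s n\<close> of cosets says that
  \<open>s (Suc n)\<close> is mapped to \<open>s n\<close> by the projection \<open>R/I\<^sup>n\<^sup>+\<^sup>1 \<rightarrow> R/I\<^sup>n\<close>.\<close>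

definition adic_completion :: "('a, 'm) ring_scheme \<Rightarrow> 'a set \<Rightarrow> (nat \<Rightarrow> 'a set) ring" where
  "adic_completion R I =
    \<lparr>carrier = {s. (\<forall>n. s n \<in> carrier (R Quot ideal_pow R I n)) \<and> (\<forall>n. s (Suc n) \<subseteq> s n)},
     monoid.mult = (\<lambda>s t n. s n \<otimes>\<^bsub>R Quot ideal_pow R I n\<^esub> t n),
     monoid.one = (\<lambda>n. \<one>\<^bsub>R Quot ideal_pow R I n\<^esub>),
     ring.zero = (\<lambda>n. \<zero>\<^bsub>R Quot ideal_pow R I n\<^esub>),
     ring.add = (\<lambda>s t n. s n \<oplus>\<^bsub>R Quot ideal_pow R I n\<^esub> t n)\<rparr>"

definition to_completion :: "('a, 'm) ring_scheme \<Rightarrow> 'a set \<Rightarrow> 'a \<Rightarrow> nat \<Rightarrow> 'a set" where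
  "to_completion R I a = (\<lambda>n. ideal_pow R I n +>\<^bsub>R\<^esub> a)"

definition the_max_ideal :: "('a, 'm) ring_scheme \<Rightarrow> 'a set" where
  "the_max_ideal R = (THE m. maximalideal m R)"


section \<open>The ring \<open>A\<close>\<close>

text \<open>The field \<open>k(y,z)((x))\<close>, which contains \<open>R\<^sup>* = k[y,z]\<^sub>(\<^sub>y\<^sub>,\<^sub>z\<^sub>)[[x]]\<close> and hence the fraction field
  of \<open>R\<^sup>*\<close>. In \<open>'k poly poly\<close> the inner variable is \<open>y\<close> and the outer one is \<open>z\<close>.\<close>

type_synonym 'k kyzx = "'k poly poly fract fls"

definition const_yz :: "'k::field \<Rightarrow> 'k poly poly fract" where
  "const_yz c = to_fract [:[:c:]:]"

definition x_el :: "'k::field kyzx" where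
  "x_el = fls_X"

definition y_el :: "'k::field kyzx" where
  "y_el = fls_const (to_fract [:[:0, 1:]:])"

definition z_el :: "'k::field kyzx" where
  "z_el = fls_const (to_fract [:0, 1:])"

text \<open>\<open>k[y,z]\<^sub>(\<^sub>y\<^sub>,\<^sub>z\<^sub>)\<close>: a polynomial lies outside \<open>(y,z)\<close> iff its constant term is nonzero.\<close>

definition loc_yz :: "'k::field poly poly fract set" where
  "loc_yz = {Fract p q | p q. poly (poly q 0) 0 \<noteq> 0}"

definition R_star :: "'k::field kyzx set" where
  "R_star = {fps_to_fls F | F. \<forall>n. fps_nth F n \<in> loc_yz}"

definition series_el :: "'k::field fps \<Rightarrow> 'k kyzx" where
  "series_el a = fps_to_fls (Abs_fps (\<lambda>n. const_yz (fps_nth a n)))"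

definition f_el :: "'k::field fps \<Rightarrow> 'k kyzx" where
  "f_el \<alpha> = (y_el - series_el \<alpha>)\<^sup>2"

definition g_el :: "'k::field fps \<Rightarrow> 'k kyzx" where
  "g_el \<beta> = (z_el - series_el \<beta>)\<^sup>2"

definition field_kxyzfg :: "'k::field fps \<Rightarrow> 'k fps \<Rightarrow> 'k kyzx set" where
  "field_kxyzfg \<alpha> \<beta> = generate_field ring_of_type_algebra
     (range (\<lambda>c. fls_const (const_yz c)) \<union> {x_el, y_el, z_el, f_el \<alpha>, g_el \<beta>})"

definition A_ring :: "'k::field fps \<Rightarrow> 'k fps \<Rightarrow> 'k kyzx ring" where
  "A_ring \<alpha> \<beta> = ring_of_type_algebra\<lparr>carrier := field_kxyzfg \<alpha> \<beta> \<inter> R_star\<rparr>"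

text \<open>The field \<open>k(x)\<close> inside \<open>k((x))\<close>.\<close>

definition field_kx :: "'k::field fls set" where
  "field_kx = generate_field ring_of_type_algebra (range fls_const \<union> {fls_X})"

text \<open>Algebraic independence of \<open>a\<close>, \<open>b\<close> over the subfield \<open>F\<close>. Polynomials in two variables over \<open>F\<close>
  are iterated polynomials with all coefficients in \<open>F\<close>; the inner variable is evaluated at \<open>a\<close>,
  the outer one at \<open>b\<close>.\<close>

definition alg_independent2 :: "'a::field set \<Rightarrow> 'a \<Rightarrow> 'a \<Rightarrow> bool" where
  "alg_independent2 F a b \<longleftrightarrow>
     (\<forall>p :: 'a poly poly. (\<forall>i j. poly.coeff (poly.coeff p i) j \<in> F) \<longrightarrow>
        poly (poly p [:b:]) a = 0 \<longrightarrow> p = 0)"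

end

theory Submission
  imports Defs
begin

text \<open>
  Put \<open>u = y - \<alpha>\<close> and \<open>v = z - \<beta>\<close>, so that \<open>f = u\<^sup>2\<close> and \<open>g = v\<^sup>2\<close>, and let \<open>K = k(x,y,z,f,g)\<close>, \<open>A = K \<inter> R\<^sup>*\<close>.
  The ring \<open>A\<close> sees only the even powers of \<open>u\<close> and \<open>v\<close>, while its completion contains \<open>u\<close> and \<open>v\<close>.

  On \<open>U\<^sub>0 = k[x,y,z,f,g]\<close> the \<open>(u,v)\<close>-adic order is additive, and an element has order at least \<open>2n\<close> iff it lies
  in \<open>(f,g)\<^sup>nU\<^sub>0\<close>, because its leading form has coefficients in \<open>k[x,y,z]\<close> and these do not vanish at
  \<open>y = \<alpha>\<close>, \<open>z = \<beta>\<close> by algebraic independence (\<open>ordr_J\<close>). The order extends to \<open>K\<close>, and \<open>P\<^sup>n\<close> consists of the elements of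
  \<open>A\<close> of order at least \<open>2n\<close> (\<open>order_P\<close>, \<open>P_order\<close>). This is the main point, and it has two ingredients. First,
  every \<open>a \<in> A\<close> has denominators in \<open>U\<^sub>0\<close> that generate an ideal of \<open>A\<close> containing a power of \<open>x\<close>
  (\<open>A_denominators\<close>): \<open>A\<close> is contained in the localization \<open>N\<close> of \<open>V[y,z]\<close> at \<open>(x,y,z)\<close>, where \<open>V = k(x,\<alpha>,\<beta>) \<inter> k[[x]]\<close>
  (\<open>fraction_in_N\<close>, a flatness argument that uses the Hilbert basis theorem), and \<open>k[x,\<alpha>,\<beta>,y,z] = k[x,y,z,u,v]\<close> is free
  over \<open>U\<^sub>0\<close> with basis \<open>1, u, v, uv\<close>. Second, \<open>x\<close> is a nonzerodivisor modulo \<open>P\<^sup>n\<close> (\<open>x_regular\<close>), because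
  \<open>A/xA = k[y,z]\<^sub>(\<^sub>y\<^sub>,\<^sub>z\<^sub>)\<close> and \<open>f\<close>, \<open>g\<close> become \<open>y\<^sup>2\<close>, \<open>z\<^sup>2\<close>.

  Orders are additive, and \<open>N\<close> is completely integrally closed. Hence \<open>e c\<^sup>j \<in> P\<^sup>n\<^sup>+\<^sup>j\<^sup>d\<close> for some \<open>e \<noteq> 0\<close> and all \<open>j\<close> implies
  \<open>c \<in> P\<^sup>d\<close> (\<open>P_cic\<close>). With an equation of integral dependence this shows that \<open>P\<^sup>n\<close> is integrally closed
  (\<open>normal_PI\<close>), and applied to leading coefficients it shows that the Rees algebra of \<open>P\<close> is completely integrally
  closed (\<open>rees_integrally_closed\<close>).

  The powers of the maximal ideal of \<open>A\<close> are cut out by the order of power series under \<open>A \<rightarrow> k[[x,y,z]]\<close>, so the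
  completion is the closure of the image (\<open>embedded_completion\<close>). It contains \<open>u\<close> and \<open>v\<close>, and \<open>uv \<notin> (f,g)\<close>
  there. The element \<open>uvt\<close> of the fraction field of the completed Rees algebra satisfies \<open>(uvt)\<^sup>2 = ft \<cdot> gt\<close> but does not
  lie in that algebra (\<open>rees_not_integrally_closed\<close>, \<open>completed_rees\<close>).
\<close>

section \<open>Subrings, polynomials with restricted coefficients, and Noetherian subrings\<close>

text \<open>Homomorphisms of commutative rings, as functions between types.\<close>

definition rhom :: "('a::comm_ring_1 \<Rightarrow> 'b::comm_ring_1) \<Rightarrow> bool" where
  "rhom h \<longleftrightarrow> h 1 = 1 \<and> (\<forall>x y. h (x + y) = h x + h y) \<and> (\<forall>x y. h (x * y) = h x * h y)"

lemma rhom_1: "rhom h \<Longrightarrow> h 1 = 1"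
  and rhom_add: "rhom h \<Longrightarrow> h (x + y) = h x + h y"
  and rhom_mult: "rhom h \<Longrightarrow> h (x * y) = h x * h y"
  by (auto simp: rhom_def)

lemma rhom_0: assumes "rhom h" shows "h 0 = 0"
proof -
  have "h 0 + h 0 = h 0" using rhom_add[OF assms, of 0 0] by simp
  thus ?thesis by simp
qed

lemma rhom_minus: assumes "rhom h" shows "h (- x) = - h x"
proof -
  have "h (- x) + h x = 0" using rhom_add[OF assms, of "- x" x] rhom_0[OF assms] by simp
  thus ?thesis by (simp add: eq_neg_iff_add_eq_0)
qed

lemma rhom_diff: "rhom h \<Longrightarrow> h (x - y) = h x - h y"
  using rhom_add[of h x "- y"] rhom_minus[of h y] by simp

lemma rhom_power: "rhom h \<Longrightarrow> h (x ^ n) = h x ^ n"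
  by (induction n) (simp_all add: rhom_1 rhom_mult)

lemma rhom_sum: "rhom h \<Longrightarrow> h (\<Sum>i\<in>I. F i) = (\<Sum>i\<in>I. h (F i))"
  by (induction I rule: infinite_finite_induct) (simp_all add: rhom_0 rhom_add)

lemmas rhom_simps = rhom_1 rhom_add rhom_mult rhom_0 rhom_minus rhom_diff rhom_power rhom_sum

lemma rhom_inj: "rhom h \<Longrightarrow> (\<And>x. h x = 0 \<Longrightarrow> x = 0) \<Longrightarrow> h x = h y \<Longrightarrow> x = y"
  by (metis eq_iff_diff_eq_0 rhom_diff)

lemma rhom_comp: "rhom h \<Longrightarrow> rhom h' \<Longrightarrow> rhom (\<lambda>x. h' (h x))"
  by (simp add: rhom_def)

lemma map_poly_pCons_0: "h 0 = 0 \<Longrightarrow> map_poly h (pCons c p) = pCons (h c) (map_poly h p)"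
  by (rule map_poly_pCons) 

lemma rhom_map_poly: assumes h: "rhom h" shows "rhom (map_poly h)"
proof -
  note h0 = rhom_0[OF h]
  have add: "map_poly h (p + q) = map_poly h p + map_poly h q" for p q
    by (rule poly_eqI) (simp add: coeff_map_poly h0 rhom_add[OF h])
  have mult: "map_poly h (p * q) = map_poly h p * map_poly h q" for p q
    by (rule poly_eqI) (simp add: coeff_map_poly h0 coeff_mult rhom_simps[OF h])
  have one: "map_poly h 1 = 1"
    by (rule poly_eqI) (simp add: coeff_map_poly h0 rhom_1[OF h] coeff_1)
  show ?thesis using add mult one by (simp add: rhom_def)
qed

lemma rhom_poly: "rhom (\<lambda>p. poly p a)"
  by (simp add: rhom_def)

lemma rhom_const_poly: "rhom (\<lambda>c. [:c:])"
  by (simp add: rhom_def one_pCons)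

text \<open>Extension of a ring homomorphism \<open>h\<close> to polynomials, sending the variable to \<open>a\<close>.\<close>

definition evh :: "('a::comm_ring_1 \<Rightarrow> 'b::comm_ring_1) \<Rightarrow> 'b \<Rightarrow> 'a poly \<Rightarrow> 'b" where
  "evh h a p = poly (map_poly h p) a"

lemma rhom_evh: "rhom h \<Longrightarrow> rhom (evh h a)"
  unfolding evh_def[abs_def] by (rule rhom_comp[OF rhom_map_poly rhom_poly])

lemma evh_pCons: "rhom h \<Longrightarrow> evh h a (pCons c p) = h c + a * evh h a p"
  by (simp add: evh_def map_poly_pCons_0 rhom_0)

lemma evh_0: "rhom h \<Longrightarrow> evh h a 0 = 0"
  by (simp add: evh_def)

lemma evh_const: "rhom h \<Longrightarrow> evh h a [:c:] = h c"
  by (simp add: evh_pCons evh_0)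

text \<open>Subrings with the same unit, as subsets of a type.\<close>

definition subrng :: "'a::comm_ring_1 set \<Rightarrow> bool" where
  "subrng S \<longleftrightarrow> 1 \<in> S \<and> (\<forall>x\<in>S. \<forall>y\<in>S. x - y \<in> S \<and> x * y \<in> S)"

lemma subrng_1: "subrng S \<Longrightarrow> 1 \<in> S"
  and subrng_diff: "subrng S \<Longrightarrow> x \<in> S \<Longrightarrow> y \<in> S \<Longrightarrow> x - y \<in> S"
  and subrng_mult: "subrng S \<Longrightarrow> x \<in> S \<Longrightarrow> y \<in> S \<Longrightarrow> x * y \<in> S"
  by (auto simp: subrng_def)

lemma subrng_0: "subrng S \<Longrightarrow> 0 \<in> S"
  using subrng_diff[of S 1 1] subrng_1[of S] by simp

lemma subrng_minus: "subrng S \<Longrightarrow> x \<in> S \<Longrightarrow> - x \<in> S"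
  using subrng_diff[of S 0 x] subrng_0[of S] by simp

lemma subrng_add: "subrng S \<Longrightarrow> x \<in> S \<Longrightarrow> y \<in> S \<Longrightarrow> x + y \<in> S"
  using subrng_diff[of S x "- y"] subrng_minus[of S y] by simp

lemma subrng_power: "subrng S \<Longrightarrow> x \<in> S \<Longrightarrow> x ^ n \<in> S"
  by (induction n) (simp_all add: subrng_1 subrng_mult)

lemma subrng_sum: "subrng S \<Longrightarrow> (\<And>i. i \<in> I \<Longrightarrow> F i \<in> S) \<Longrightarrow> (\<Sum>i\<in>I. F i) \<in> S"
  by (induction I rule: infinite_finite_induct) (simp_all add: subrng_0 subrng_add)

lemma subrng_of_nat: "subrng S \<Longrightarrow> of_nat n \<in> S"
  by (induction n) (simp_all add: subrng_0 subrng_1 subrng_add)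

lemmas subrng_closed = subrng_1 subrng_0 subrng_diff subrng_mult subrng_minus subrng_add
  subrng_power subrng_of_nat

lemma subrng_image: assumes S: "subrng S" and h: "rhom h" shows "subrng (h ` S)"
proof -
  have "1 \<in> h ` S" using subrng_1[OF S] rhom_1[OF h] by (metis imageI)
  moreover have "h x - h y \<in> h ` S" "h x * h y \<in> h ` S" if "x \<in> S" "y \<in> S" for x y
    using that S h by (metis imageI rhom_diff subrng_diff, metis imageI rhom_mult subrng_mult)
  ultimately show ?thesis by (auto simp: subrng_def)
qed

text \<open>\<open>Polys S\<close> is the ring \<open>S[X]\<close> of polynomials with coefficients in \<open>S\<close>; \<open>Polys (Polys S)\<close> is a polynomial
  ring in two variables, the inner and the outer one.\<close>

definition Polys :: "'a::comm_ring_1 set \<Rightarrow> 'a poly set" where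
  "Polys S = {p. \<forall>i. coeff p i \<in> S}"

lemma Polys_coeff: "p \<in> Polys S \<Longrightarrow> coeff p i \<in> S"
  by (simp add: Polys_def)

lemma Polys_mono: "S \<subseteq> S' \<Longrightarrow> Polys S \<subseteq> Polys S'"
  by (auto simp: Polys_def)

lemma Polys_0: "subrng S \<Longrightarrow> 0 \<in> Polys S"
  by (simp add: Polys_def subrng_0)

lemma Polys_pCons: "pCons c p \<in> Polys S \<longleftrightarrow> c \<in> S \<and> p \<in> Polys S"
proof
  assume *: "pCons c p \<in> Polys S"
  have "coeff (pCons c p) 0 \<in> S" and "\<And>i. coeff (pCons c p) (Suc i) \<in> S"
    using * by (simp_all only: Polys_def mem_Collect_eq)
  thus "c \<in> S \<and> p \<in> Polys S" by (simp add: Polys_def)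
qed (auto simp: Polys_def coeff_pCons split: nat.splits)

lemma Polys_monom: "subrng S \<Longrightarrow> c \<in> S \<Longrightarrow> monom c n \<in> Polys S"
  by (simp add: Polys_def subrng_0)

lemma subrng_Polys: assumes S: "subrng S" shows "subrng (Polys S)"
proof -
  have "1 \<in> Polys S" using S by (simp add: Polys_def subrng_0 subrng_1 coeff_1)
  moreover have "p - q \<in> Polys S" "p * q \<in> Polys S" if "p \<in> Polys S" "q \<in> Polys S" for p q
    using that S by (auto simp: Polys_def subrng_diff coeff_mult intro!: subrng_sum subrng_mult)
  ultimately show ?thesis by (simp add: subrng_def)
qed

lemma Polys_induct [consumes 1, case_names 0 pCons]:
  assumes "p \<in> Polys S" and "P 0"
    and "\<And>c p. c \<in> S \<Longrightarrow> p \<in> Polys S \<Longrightarrow> P p \<Longrightarrow> P (pCons c p)"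
  shows "P p"
  using assms(1)
proof (induction p)
  case 0 show ?case by (rule assms(2))
next
  case (pCons c p)
  thus ?case using assms(3) by (simp add: Polys_pCons)
qed

text \<open>The ring \<open>S[a]\<close> generated by a subring and one element.\<close>

definition adj :: "'a::comm_ring_1 set \<Rightarrow> 'a \<Rightarrow> 'a set" where
  "adj S a = (\<lambda>p. poly p a) ` Polys S"

lemma subrng_adj: "subrng S \<Longrightarrow> subrng (adj S a)"
  unfolding adj_def by (rule subrng_image[OF subrng_Polys rhom_poly])

lemma adj_incl: assumes "subrng S" "c \<in> S" shows "c \<in> adj S a"
proof -
  have "[:c:] \<in> Polys S" using assms by (simp add: Polys_pCons Polys_0)
  moreover have "poly [:c:] a = c" by simp
  ultimately show ?thesis unfolding adj_def by (metis imageI)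
qed

lemma adj_gen: assumes "subrng S" shows "a \<in> adj S a"
proof -
  have "[:0, 1:] \<in> Polys S" using assms by (simp add: Polys_pCons Polys_0 subrng_0 subrng_1)
  moreover have "poly [:0, 1:] a = a" by simp
  ultimately show ?thesis unfolding adj_def by (metis imageI)
qed

lemma poly_in_subrng: assumes R: "subrng R" and "S \<subseteq> R" "a \<in> R" "p \<in> Polys S" shows "poly p a \<in> R"
  using assms(4) by (induction p rule: Polys_induct) (use assms in \<open>auto intro!: subrng_closed\<close>)

lemma adj_minimal: "subrng R \<Longrightarrow> S \<subseteq> R \<Longrightarrow> a \<in> R \<Longrightarrow> adj S a \<subseteq> R"
  by (auto simp: adj_def poly_in_subrng)

lemma Polys_minimal:
  assumes R: "subrng R" and "\<And>c. c \<in> S \<Longrightarrow> [:c:] \<in> R" "[:0, 1:] \<in> R"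
  shows "Polys S \<subseteq> R"
proof
  fix p assume "p \<in> Polys S"
  thus "p \<in> R"
  proof (induction p rule: Polys_induct)
    case (pCons c p)
    have "pCons c p = [:c:] + [:0, 1:] * p" by simp
    moreover have "[:c:] + [:0, 1:] * p \<in> R" using assms pCons by (blast intro: subrng_closed)
    ultimately show ?case by (metis )
  qed (simp add: R subrng_0)
qed

text \<open>\<open>idl S B\<close> is the ideal of the subring \<open>S\<close> (or the \<open>S\<close>-submodule) generated by \<open>B\<close>.\<close>

inductive_set idl :: "'a::comm_ring_1 set \<Rightarrow> 'a set \<Rightarrow> 'a set" for S B where
  zero: "0 \<in> idl S B"
| step: "s \<in> S \<Longrightarrow> b \<in> B \<Longrightarrow> r \<in> idl S B \<Longrightarrow> s * b + r \<in> idl S B"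

lemma idl_add: "r \<in> idl S B \<Longrightarrow> r' \<in> idl S B \<Longrightarrow> r + r' \<in> idl S B"
  by (induction rule: idl.induct) (simp_all add: idl.step add.assoc)

lemma idl_mult: assumes "subrng S" "s \<in> S" shows "r \<in> idl S B \<Longrightarrow> s * r \<in> idl S B"
  by (induction rule: idl.induct)
    (use assms in \<open>simp_all add: idl.zero idl.step subrng_mult distrib_left mult.assoc[symmetric]\<close>)

lemma idl_incl: "subrng S \<Longrightarrow> b \<in> B \<Longrightarrow> b \<in> idl S B"
  using idl.step[of 1 S b B 0] by (simp add: idl.zero subrng_1)

lemma idl_diff: assumes "subrng S" "r \<in> idl S B" "r' \<in> idl S B" shows "r - r' \<in> idl S B"
proof -
  have "(- 1) * r' \<in> idl S B" by (rule idl_mult) (use assms in \<open>auto intro!: subrng_minus subrng_1\<close>)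
  hence "r + (- 1) * r' \<in> idl S B" by (rule idl_add[OF assms(2)])
  thus ?thesis by simp
qed

lemma idl_subset: "subrng S \<Longrightarrow> B \<subseteq> idl S C \<Longrightarrow> idl S B \<subseteq> idl S C"
proof
  fix r assume *: "subrng S" "B \<subseteq> idl S C" "r \<in> idl S B"
  from *(3) show "r \<in> idl S C"
    by (induction rule: idl.induct) (use * in \<open>auto intro: idl.zero idl_add idl_mult\<close>)
qed

lemma idl_mono: "B \<subseteq> C \<Longrightarrow> idl S B \<subseteq> idl S C"
proof
  fix r assume *: "B \<subseteq> C" "r \<in> idl S B"
  from *(2) show "r \<in> idl S C"
    by (induction rule: idl.induct) (use * in \<open>auto intro: idl.zero idl.step\<close>)
qed

lemma idl_in: "subrng S \<Longrightarrow> B \<subseteq> S \<Longrightarrow> idl S B \<subseteq> S"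
proof
  fix r assume *: "subrng S" "B \<subseteq> S" "r \<in> idl S B"
  from *(3) show "r \<in> S"
    by (induction rule: idl.induct) (use * in \<open>auto intro!: subrng_closed\<close>)
qed

lemma idl_compact: fixes b :: "nat \<Rightarrow> 'a::comm_ring_1"
  shows "r \<in> idl S (range b) \<Longrightarrow> \<exists>N. r \<in> idl S (b ` {..<N})"
proof (induction rule: idl.induct)
  case zero show ?case by (auto intro: idl.zero)
next
  case (step s c r)
  then obtain N i where N: "r \<in> idl S (b ` {..<N})" and i: "c = b i" by auto
  let ?M = "max N (Suc i)"
  have "b ` {..<N} \<subseteq> b ` {..<?M}" by auto
  hence "r \<in> idl S (b ` {..<?M})" using idl_mono[of "b ` {..<N}" "b ` {..<?M}" S] N by blast
  moreover have "c \<in> b ` {..<?M}" using i by auto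
  ultimately show ?case using step(1) by (meson idl.step)
qed

text \<open>A subring is Noetherian iff in every sequence some term lies in the ideal generated by its
  predecessors.\<close>

definition noeth :: "'a::comm_ring_1 set \<Rightarrow> bool" where
  "noeth S \<longleftrightarrow> (\<forall>b::nat \<Rightarrow> 'a. (\<forall>n. b n \<in> S) \<longrightarrow> (\<exists>n. b n \<in> idl S (b ` {..<n})))"

text \<open>Otherwise the ideal \<open>I\<close> generated by the sequence contains polynomials \<open>f\<^sub>0, f\<^sub>1, \<dots>\<close>, each of least degree
  outside the ideal generated by the previous ones. Some leading coefficient is a combination of the
  earlier ones, and subtracting the corresponding combination of the \<open>f\<^sub>i\<close> lowers the degree.\<close>

theorem hilbert_basis:
  fixes S :: "'a::comm_ring_1 set"
  assumes S: "subrng S" and "noeth S"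
  shows "noeth (Polys S)"
  unfolding noeth_def
proof (intro allI impI)
  fix b :: "nat \<Rightarrow> 'a poly" assume b: "\<forall>n. b n \<in> Polys S"
  let ?R = "Polys S"
  note R = subrng_Polys[OF S]
  show "\<exists>n. b n \<in> idl ?R (b ` {..<n})"
  proof (rule ccontr)
    assume bad: "\<nexists>n. b n \<in> idl ?R (b ` {..<n})"
    define I where "I = idl ?R (range b)"
    have IR: "I \<subseteq> ?R" unfolding I_def by (rule idl_in[OF R]) (use b in auto)
    have new: "\<exists>p\<in>I. p \<notin> idl ?R F" if F: "finite F" "F \<subseteq> I" for F
    proof -
      have "\<exists>N. F \<subseteq> idl ?R (b ` {..<N})" using F
      proof (induction F rule: finite_induct)
        case (insert p F)
        then obtain N N' where N: "F \<subseteq> idl ?R (b ` {..<N})" "p \<in> idl ?R (b ` {..<N'})"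
          using idl_compact unfolding I_def by blast
        have "idl ?R (b ` {..<N}) \<subseteq> idl ?R (b ` {..<max N N'})"
          "idl ?R (b ` {..<N'}) \<subseteq> idl ?R (b ` {..<max N N'})"
          by (rule idl_mono; auto)+
        with N show ?case by blast
      qed simp
      then obtain N where "F \<subseteq> idl ?R (b ` {..<N})" ..
      hence "idl ?R F \<subseteq> idl ?R (b ` {..<N})" by (rule idl_subset[OF R])
      with bad have "b N \<notin> idl ?R F" by blast
      moreover have "b N \<in> I" unfolding I_def by (rule idl_incl[OF R]) simp
      ultimately show ?thesis by blast
    qed
    define pick where "pick F = arg_min degree (\<lambda>p. p \<in> I \<and> p \<notin> idl ?R F)" for F
    have pick: "pick F \<in> I" "pick F \<notin> idl ?R F"
      "\<And>q. q \<in> I \<Longrightarrow> q \<notin> idl ?R F \<Longrightarrow> degree (pick F) \<le> degree q" if F: "finite F" "F \<subseteq> I" for F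
    proof -
      obtain p where "p \<in> I \<and> p \<notin> idl ?R F" using new[OF F] by blast
      note * = arg_min_nat_lemma[where P = "\<lambda>p. p \<in> I \<and> p \<notin> idl ?R F" and m = degree, OF this]
      show "pick F \<in> I" "pick F \<notin> idl ?R F" using * unfolding pick_def by auto
      show "\<And>q. q \<in> I \<Longrightarrow> q \<notin> idl ?R F \<Longrightarrow> degree (pick F) \<le> degree q"
        using * unfolding pick_def by auto
    qed
    define G where "G = rec_nat {} (\<lambda>n F. insert (pick F) F)"
    have G0: "G 0 = {}" and GS: "\<And>n. G (Suc n) = insert (pick (G n)) (G n)"
      by (simp_all add: G_def)
    define f where "f n = pick (G n)" for n
    have Gf: "G n = f ` {..<n}" for n
      by (induction n) (auto simp: G0 GS f_def lessThan_Suc)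
    have Gfin: "finite (G n) \<and> G n \<subseteq> I" for n
      by (induction n) (auto simp: G0 GS pick)
    have f: "f n \<in> I" "f n \<notin> idl ?R (G n)"
      "\<And>q. q \<in> I \<Longrightarrow> q \<notin> idl ?R (G n) \<Longrightarrow> degree (f n) \<le> degree q" for n
      unfolding f_def using pick[of "G n"] Gfin[of n] by simp_all
    have deg: "degree (f i) \<le> degree (f n)" if "i \<le> n" for i n
    proof (rule f(3))
      have "G i \<subseteq> G n" unfolding Gf using that by auto
      thus "f n \<notin> idl ?R (G i)" using f(2)[of n] idl_mono by blast
    qed (rule f(1))
    define a where "a n = lead_coeff (f n)" for n
    have "a n \<in> S" for n using f(1) IR unfolding a_def Polys_def by blast
    then obtain n where n: "a n \<in> idl S (a ` {..<n})" using assms(2) unfolding noeth_def by blast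
    have "\<exists>g\<in>idl ?R (G n). degree g \<le> degree (f n) \<and> coeff g (degree (f n)) = c"
      if "c \<in> idl S (a ` {..<n})" for c
      using that
    proof (induction rule: idl.induct)
      case zero
      show ?case by (rule bexI[of _ 0]) (auto simp: idl.zero)
    next
      case (step s c r)
      then obtain g where g: "g \<in> idl ?R (G n)" "degree g \<le> degree (f n)" "coeff g (degree (f n)) = r"
        by blast
      obtain i where i: "i < n" "c = a i" using step(2) by blast
      let ?k = "degree (f n) - degree (f i)"
      have le: "degree (f i) \<le> degree (f n)" using deg i by simp
      let ?h = "monom s ?k * f i + g"
      have "monom s ?k \<in> ?R" using step(1) by (simp add: Polys_monom S)
      moreover have "f i \<in> G n" unfolding Gf using i by auto
      ultimately have "?h \<in> idl ?R (G n)" using g(1) by (meson idl.step)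
      moreover have "degree (monom s ?k * f i) \<le> degree (f n)"
        using degree_mult_le[of "monom s ?k" "f i"] degree_monom_le[of s ?k] le by linarith
      hence "degree ?h \<le> degree (f n)" using g(2) by (rule degree_add_le)
      moreover have "coeff ?h (degree (f n)) = s * c + r"
        using le by (simp add: coeff_monom_mult g(3) i(2) a_def)
      ultimately show ?case by blast
    qed
    from this[OF n] obtain g where g: "g \<in> idl ?R (G n)" "degree g \<le> degree (f n)"
      "coeff g (degree (f n)) = a n" by blast
    let ?h = "f n - g"
    have "g \<in> I" using g(1) idl_subset[OF R, of "G n" "range b"] Gfin unfolding I_def by blast
    hence "?h \<in> I" using f(1)[of n] idl_diff[OF R] unfolding I_def by blast
    moreover have hn: "?h \<notin> idl ?R (G n)"
    proof
      assume "?h \<in> idl ?R (G n)"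
      from idl_add[OF this g(1)] f(2)[of n] show False by simp
    qed
    ultimately have "degree (f n) \<le> degree ?h" by (rule f(3))
    moreover have "degree ?h \<le> degree (f n)" using g(2) by (simp add: degree_diff_le)
    ultimately have "degree ?h = degree (f n)" by simp
    moreover have "coeff ?h (degree (f n)) = 0" using g(3) by (simp add: a_def)
    ultimately have "?h = 0" by (metis leading_coeff_0_iff)
    with hn show False by (simp add: idl.zero)
  qed
qed

section \<open>Completely integrally closed subrings\<close>

text \<open>\<open>almost R d a b\<close>: the fraction \<open>a/b\<close> is almost integral over \<open>R\<close>, because \<open>d (a/b)\<^sup>j \<in> R\<close> for all
  \<open>j\<close>. A domain \<open>R\<close> is completely integrally closed if its almost integral fractions lie in \<open>R\<close>; this
  implies that it is integrally closed.\<close>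

definition almost :: "'a::comm_ring_1 set \<Rightarrow> 'a \<Rightarrow> 'a \<Rightarrow> 'a \<Rightarrow> bool" where
  "almost R d a b \<longleftrightarrow> (\<forall>j. \<exists>s\<in>R. d * a ^ j = s * b ^ j)"

definition cic :: "'a::idom set \<Rightarrow> bool" where
  "cic R \<longleftrightarrow> (\<forall>a\<in>R. \<forall>b\<in>R. \<forall>d\<in>R. b \<noteq> 0 \<longrightarrow> d \<noteq> 0 \<longrightarrow> almost R d a b \<longrightarrow> (\<exists>s\<in>R. a = s * b))"

text \<open>The binomial theorem shows that \<open>c a/b + q\<close> is almost integral if \<open>a/b\<close> is.\<close>

lemma almost_lin:
  assumes R: "subrng R" and al: "almost R d a b" and c: "c \<in> R" and q: "q \<in> R"
  shows "almost R d (c * a + q * b) b"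
  unfolding almost_def
proof
  fix j
  from al obtain s where s: "\<And>i. s i \<in> R" "\<And>i. d * a ^ i = s i * b ^ i" unfolding almost_def by metis
  let ?t = "\<Sum>i\<le>j. of_nat (j choose i) * c ^ i * q ^ (j - i) * s i"
  have "d * (c * a + q * b) ^ j = (\<Sum>i\<le>j. of_nat (j choose i) * c ^ i * q ^ (j - i) * (d * a ^ i) * b ^ (j - i))"
    by (simp add: binomial_ring sum_distrib_left power_mult_distrib algebra_simps)
  also have "\<dots> = (\<Sum>i\<le>j. of_nat (j choose i) * c ^ i * q ^ (j - i) * s i * b ^ j)"
  proof (rule sum.cong)
    fix i assume "i \<in> {..j}"
    hence "b ^ j = b ^ i * b ^ (j - i)" by (simp flip: power_add)
    thus "of_nat (j choose i) * c ^ i * q ^ (j - i) * (d * a ^ i) * b ^ (j - i) =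
      of_nat (j choose i) * c ^ i * q ^ (j - i) * s i * b ^ j" by (simp add: s(2) algebra_simps)
  qed simp
  also have "\<dots> = ?t * b ^ j" by (simp add: sum_distrib_right)
  finally have "d * (c * a + q * b) ^ j = ?t * b ^ j" .
  moreover have "?t \<in> R" by (intro subrng_sum subrng_closed R c q s(1))
  ultimately show "\<exists>s\<in>R. d * (c * a + q * b) ^ j = s * b ^ j" by blast
qed

text \<open>A proper fraction of polynomials is not almost integral, because the degree of \<open>d r\<^sup>j/b\<^sup>j\<close> is negative
  for large \<open>j\<close>.\<close>

lemma almost_deg_less:
  fixes d r b :: "'a::idom poly"
  assumes al: "almost R d r b" and d: "d \<noteq> 0" and b: "b \<noteq> 0" and r: "r = 0 \<or> degree r < degree b"
  shows "r = 0"
proof (rule ccontr)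
  assume r0: "r \<noteq> 0"
  let ?j = "Suc (degree d)"
  obtain s where s: "d * r ^ ?j = s * b ^ ?j" using al unfolding almost_def by blast
  have nz: "d * r ^ ?j \<noteq> 0" using d r0 by simp
  hence s0: "s \<noteq> 0" using s by auto
  have "degree (d * r ^ ?j) = degree d + ?j * degree r" using d r0
    by (subst degree_mult_eq) (simp_all add: degree_power_eq del: power_Suc)
  moreover have "degree (s * b ^ ?j) = degree s + ?j * degree b" using s0 b
    by (subst degree_mult_eq) (simp_all add: degree_power_eq del: power_Suc)
  ultimately have "degree d + ?j * degree r \<ge> ?j * degree b" using s by simp
  moreover have "?j * degree b \<ge> ?j * Suc (degree r)" using r r0 by (intro mult_le_mono2) simp
  ultimately show False by simp
qed

lemma pseudo_division:
  fixes b :: "'a::idom poly"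
  assumes S: "subrng S" and b: "b \<in> Polys S" "b \<noteq> 0" and "a \<in> Polys S"
  shows "\<exists>k. \<exists>q\<in>Polys S. \<exists>r. smult (lead_coeff b ^ k) a = q * b + r \<and> (r = 0 \<or> degree r < degree b)"
  using assms(4)
proof (induction "degree a" arbitrary: a rule: less_induct)
  case less
  note R = subrng_Polys[OF S]
  show ?case
  proof (cases "a = 0 \<or> degree a < degree b")
    case True
    hence "smult (lead_coeff b ^ 0) a = 0 * b + a \<and> (a = 0 \<or> degree a < degree b)" by simp
    thus ?thesis using subrng_0[OF R] by blast
  next
    case False
    let ?m = "monom (lead_coeff a) (degree a - degree b)"
    let ?a = "smult (lead_coeff b) a - ?m * b"
    have lb: "lead_coeff b \<in> S" and la: "lead_coeff a \<in> S" using b less.prems by (auto intro: Polys_coeff)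
    have mR: "?m \<in> Polys S" by (rule Polys_monom[OF S la])
    have "smult (lead_coeff b) a \<in> Polys S" using lb less.prems S by (auto simp: Polys_def subrng_mult)
    hence aR: "?a \<in> Polys S" using mR b R by (blast intro: subrng_closed)
    have "degree (smult (lead_coeff b) a) \<le> degree a" by (rule degree_smult_le)
    moreover have "degree (?m * b) \<le> degree a"
      using degree_mult_le[of ?m b] degree_monom_le[of "lead_coeff a" "degree a - degree b"] False by linarith
    ultimately have "degree ?a \<le> degree a" by (rule degree_diff_le)
    moreover have "coeff ?a (degree a) = 0" using False by (simp add: coeff_monom_mult)
    ultimately have deg: "?a = 0 \<or> degree ?a < degree a"
      by (metis le_neq_implies_less leading_coeff_0_iff)
    have "\<exists>k. \<exists>q\<in>Polys S. \<exists>r. smult (lead_coeff b ^ k) ?a = q * b + r \<and> (r = 0 \<or> degree r < degree b)"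
    proof (cases "?a = 0")
      case True
      hence "smult (lead_coeff b ^ 0) ?a = 0 * b + 0" by simp
      thus ?thesis using subrng_0[OF R] by blast
    next
      case False
      thus ?thesis using less.hyps[OF _ aR] deg by blast
    qed
    then obtain k q r where q: "q \<in> Polys S" "smult (lead_coeff b ^ k) ?a = q * b + r"
      "r = 0 \<or> degree r < degree b" by blast
    have "smult (lead_coeff b ^ Suc k) a = smult (lead_coeff b ^ k) ?a + smult (lead_coeff b ^ k) (?m * b)"
      by (simp add: smult_diff_right mult.commute)
    also have "\<dots> = (q + smult (lead_coeff b ^ k) ?m) * b + r" by (simp only: q(2)) (simp add: algebra_simps)
    finally have "smult (lead_coeff b ^ Suc k) a = (q + smult (lead_coeff b ^ k) ?m) * b + r" .
    moreover have "smult (lead_coeff b ^ k) ?m \<in> Polys S"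
      using lb la S by (auto simp: Polys_def intro!: subrng_closed)
    hence "q + smult (lead_coeff b ^ k) ?m \<in> Polys S" using q(1) R by (blast intro: subrng_closed)
    ultimately show ?thesis using q(3) by blast
  qed
qed

text \<open>Pseudo-division and the preceding lemma reduce \<open>a/b\<close> to \<open>q/c\<close> with a polynomial \<open>q\<close> and a constant \<open>c\<close>.
  The leading coefficient of \<open>q/c\<close> is almost integral over \<open>S\<close>, so it lies in \<open>S\<close>, and it can be split
  off.\<close>

theorem cic_Polys:
  fixes S :: "'a::idom set"
  assumes S: "subrng S" and cic: "cic S"
  shows "cic (Polys S)"
  unfolding cic_def
proof (intro ballI impI)
  fix a b d assume a: "a \<in> Polys S" and b: "b \<in> Polys S" and d: "d \<in> Polys S"
    and b0: "b \<noteq> 0" and d0: "d \<noteq> 0" and al: "almost (Polys S) d a b"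
  note R = subrng_Polys[OF S]
  obtain k q r where q: "q \<in> Polys S" and qr: "smult (lead_coeff b ^ k) a = q * b + r"
    and r: "r = 0 \<or> degree r < degree b" using pseudo_division[OF S b b0 a] by blast
  define c where "c = lead_coeff b ^ k"
  have c: "c \<in> S" "c \<noteq> 0" unfolding c_def using b b0 S by (auto intro!: subrng_power Polys_coeff)
  have cR: "[:c:] \<in> Polys S" using c S by (simp add: Polys_pCons Polys_0)
  have "almost (Polys S) d ([:c:] * a + (- q) * b) b"
    by (rule almost_lin[OF R al cR subrng_minus[OF R q]])
  moreover have "[:c:] * a + (- q) * b = r" using qr by (simp add: c_def)
  ultimately have "r = 0" using almost_deg_less[OF _ d0 b0 r] by simp
  hence ca: "[:c:] * a = q * b" using qr by (simp add: c_def)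
  have alq: "almost (Polys S) d q [:c:]"
    unfolding almost_def
  proof
    fix j
    obtain s where s: "s \<in> Polys S" "d * a ^ j = s * b ^ j" using al unfolding almost_def by blast
    have "(d * q ^ j) * b ^ j = d * ([:c:] * a) ^ j" by (simp only: ca power_mult_distrib mult.assoc)
    also have "\<dots> = [:c:] ^ j * (d * a ^ j)" by (simp only: power_mult_distrib mult_ac)
    also have "\<dots> = (s * [:c:] ^ j) * b ^ j" by (simp only: s(2) mult_ac)
    finally have "d * q ^ j = s * [:c:] ^ j" using b0 by simp
    thus "\<exists>s\<in>Polys S. d * q ^ j = s * [:c:] ^ j" using s(1) by blast
  qed
  have "\<exists>q'\<in>Polys S. q = [:c:] * q'" if "q \<in> Polys S" "almost (Polys S) d q [:c:]" for q
    using that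
  proof (induction "degree q" arbitrary: q rule: less_induct)
    case less
    show ?case
    proof (cases "q = 0")
      case True thus ?thesis using subrng_0[OF R] by auto
    next
      case False
      have "almost S (lead_coeff d) (lead_coeff q) c"
        unfolding almost_def
      proof
        fix j
        obtain s where s: "s \<in> Polys S" "d * q ^ j = s * [:c:] ^ j"
          using less.prems(2) unfolding almost_def by blast
        have "lead_coeff d * lead_coeff q ^ j = lead_coeff (d * q ^ j)"
          by (simp add: lead_coeff_mult lead_coeff_power)
        also have "\<dots> = lead_coeff s * c ^ j"
          by (simp add: s(2) lead_coeff_mult lead_coeff_power)
        finally show "\<exists>s\<in>S. lead_coeff d * lead_coeff q ^ j = s * c ^ j"
          using Polys_coeff[OF s(1)] by blast
      qed
      then obtain l where l: "l \<in> S" "lead_coeff q = l * c"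
        using cic c d0 Polys_coeff[OF d] Polys_coeff[OF less.prems(1)] unfolding cic_def
        by (metis leading_coeff_0_iff)
      let ?m = "monom l (degree q)"
      let ?q = "1 * q + (- ?m) * [:c:]"
      have mR: "?m \<in> Polys S" using l S by (simp add: Polys_monom)
      have qR: "?q \<in> Polys S" using mR less.prems(1) cR R by (intro subrng_closed)
      have al2: "almost (Polys S) d ?q [:c:]"
        using almost_lin[OF R less.prems(2) subrng_1[OF R] subrng_minus[OF R mR]] .
      have qeq: "?q = q - monom (l * c) (degree q)" by (simp add: smult_monom mult.commute)
      have "degree ?q \<le> degree q" unfolding qeq by (rule degree_diff_le) (simp_all add: degree_monom_le)
      moreover have "coeff ?q (degree q) = 0" unfolding qeq by (simp add: l(2))
      ultimately have "?q = 0 \<or> degree ?q < degree q"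
        by (metis le_neq_implies_less leading_coeff_0_iff)
      hence "\<exists>q'\<in>Polys S. ?q = [:c:] * q'"
        using less.hyps[OF _ qR al2] subrng_0[OF R] by (metis mult_zero_right)
      then obtain q' where q': "q' \<in> Polys S" "?q = [:c:] * q'" by blast
      have "q = [:c:] * (q' + ?m)" using q'(2) by (simp add: algebra_simps)
      moreover have "q' + ?m \<in> Polys S" using q' mR R by (intro subrng_closed)
      ultimately show ?thesis by blast
    qed
  qed
  from this[OF q alq] obtain q' where q': "q' \<in> Polys S" "q = [:c:] * q'" by blast
  have "[:c:] * a = [:c:] * (q' * b)" using ca q'(2) by (simp add: mult.assoc)
  moreover have "[:c:] \<noteq> 0" using c by simp
  ultimately have "a = q' * b" by (metis mult_left_cancel)
  thus "\<exists>s\<in>Polys S. a = s * b" using q'(1) by blast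
qed

section \<open>Elements of the ambient field\<close>

lemma rhom_fps_to_fls: "rhom fps_to_fls"
  by (simp add: rhom_def fls_times_fps_to_fls)

lemma rhom_to_fract: "rhom to_fract"
  by (simp add: rhom_def)

lemma rhom_const_yz: "rhom const_yz"
  unfolding const_yz_def[abs_def]
  using rhom_comp[OF rhom_comp[OF rhom_const_poly rhom_const_poly] rhom_to_fract] by simp

lemma rhom_Abs_fps_map: assumes h: "rhom h" shows "rhom (\<lambda>a. Abs_fps (\<lambda>n. h (fps_nth a n)))"
  unfolding rhom_def
  by (auto simp: fps_eq_iff fps_mult_nth rhom_simps[OF h])

lemma rhom_series_el: "rhom series_el"
  unfolding series_el_def[abs_def]
  using rhom_comp[OF rhom_Abs_fps_map[OF rhom_const_yz] rhom_fps_to_fls] by simp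

text \<open>The embedding of \<open>k[[x]][y,z]\<close> into the ambient field; \<open>y\<close> is the inner and \<open>z\<close> the outer variable.\<close>

definition emb :: "'k::field fps poly poly \<Rightarrow> 'k kyzx" where
  "emb = evh (evh series_el y_el) z_el"

lemma rhom_emb: "rhom emb"
  unfolding emb_def by (intro rhom_evh rhom_series_el)

text \<open>The coefficient of \<open>x\<^sup>n\<close> of an element of \<open>k[[x]][y,z]\<close>, a polynomial in \<open>y\<close> and \<open>z\<close>.\<close>

definition cf :: "nat \<Rightarrow> 'k::field fps poly poly \<Rightarrow> 'k poly poly" where
  "cf n = map_poly (map_poly (\<lambda>c. fps_nth c n))"

lemma coeff_cf: "coeff (coeff (cf n p) j) i = fps_nth (coeff (coeff p j) i) n"
  by (simp add: cf_def coeff_map_poly)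

lemma emb_eq: fixes p :: "'k::field fps poly poly"
  shows "emb p = fps_to_fls (Abs_fps (\<lambda>n. to_fract (cf n p)))"
proof -
  have 1: "evh series_el y_el c = fps_to_fls (Abs_fps (\<lambda>n. to_fract [:map_poly (\<lambda>c. fps_nth c n) c:]))"
    for c :: "'k fps poly"
  proof (induction c)
    case 0
    show ?case by (simp add: evh_0 rhom_series_el fps_zero_def[symmetric])
  next
    case (pCons a c)
    have eq: "to_fract [:pCons (fps_nth a n) (map_poly (\<lambda>c. fps_nth c n) c):] =
      const_yz (fps_nth a n) + to_fract [:[:0, 1:]:] * to_fract [:map_poly (\<lambda>c. fps_nth c n) c:]" for n
      unfolding const_yz_def by (simp flip: to_fract_add to_fract_mult)
    have "evh series_el y_el (pCons a c) = fps_to_fls (Abs_fps (\<lambda>n. const_yz (fps_nth a n)) +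
      fps_const (to_fract [:[:0, 1:]:]) * Abs_fps (\<lambda>n. to_fract [:map_poly (\<lambda>c. fps_nth c n) c:]))"
      unfolding evh_pCons[OF rhom_series_el] pCons.IH
      by (simp add: series_el_def y_el_def fls_times_fps_to_fls)
    also have "\<dots> = fps_to_fls (Abs_fps (\<lambda>n. to_fract [:map_poly (\<lambda>c. fps_nth c n) (pCons a c):]))"
      by (rule arg_cong[of _ _ fps_to_fls]) (simp add: fps_eq_iff map_poly_pCons eq)
    finally show ?case .
  qed
  show ?thesis
  proof (induction p)
    case 0
    show ?case by (simp add: emb_def evh_0 rhom_evh rhom_series_el cf_def fps_zero_def[symmetric])
  next
    case (pCons c p)
    have eq: "to_fract (cf n (pCons c p)) =
      to_fract [:map_poly (\<lambda>c. fps_nth c n) c:] + to_fract [:0, 1:] * to_fract (cf n p)" for n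
      unfolding cf_def by (simp add: map_poly_pCons flip: to_fract_add to_fract_mult)
    have "emb (pCons c p) = fps_to_fls (Abs_fps (\<lambda>n. to_fract [:map_poly (\<lambda>c. fps_nth c n) c:]) +
      fps_const (to_fract [:0, 1:]) * Abs_fps (\<lambda>n. to_fract (cf n p)))"
      using pCons.IH unfolding emb_def
      by (simp add: evh_pCons rhom_evh rhom_series_el 1 z_el_def fls_times_fps_to_fls)
    also have "\<dots> = fps_to_fls (Abs_fps (\<lambda>n. to_fract (cf n (pCons c p))))"
      by (rule arg_cong[of _ _ fps_to_fls]) (simp add: fps_eq_iff eq)
    finally show ?case .
  qed
qed

lemma emb_eq_0: "emb p = 0 \<Longrightarrow> p = 0"
proof -
  assume "emb p = 0"
  hence "to_fract (cf n p) = 0" for n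
    by (simp add: emb_eq fps_eq_iff)
  hence "cf n p = 0" for n by simp
  hence "fps_nth (coeff (coeff p j) i) n = 0" for i j n by (metis coeff_cf coeff_0)
  hence "coeff p j = 0" for j by (intro poly_eqI fps_ext) simp
  thus "p = 0" by (intro poly_eqI) simp
qed

lemma emb_inj: "emb p = emb q \<Longrightarrow> p = q"
  by (rule rhom_inj[OF rhom_emb emb_eq_0])

lemma emb_nz: "p \<noteq> 0 \<Longrightarrow> emb p \<noteq> 0"
  using emb_eq_0 by blast

lemmas emb_simps = rhom_simps[OF rhom_emb]

lemma emb_const: "emb [:[:c:]:] = series_el c"
  by (simp add: emb_def evh_const rhom_evh rhom_series_el)

lemma emb_y: "emb [:[:0, 1:]:] = y_el"
  by (simp add: emb_def rhom_evh rhom_series_el evh_pCons evh_0 rhom_1 rhom_0 del: One_nat_def)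

lemma emb_z: "emb [:0, 1:] = z_el"
  unfolding emb_def
  by (simp add: rhom_evh rhom_series_el evh_pCons evh_0 rhom_1[OF rhom_evh[OF rhom_series_el]])

lemma series_el_X: "series_el fps_X = (x_el :: 'k::field kyzx)"
proof -
  have "Abs_fps (\<lambda>n. const_yz (fps_nth (fps_X :: 'k fps) n)) = fps_X"
    by (auto simp: fps_eq_iff rhom_simps[OF rhom_const_yz])
  thus ?thesis unfolding series_el_def x_el_def by (simp only: fps_X_to_fls)
qed

lemma series_el_const: "series_el (fps_const c) = fls_const (const_yz c)"
proof -
  have "Abs_fps (\<lambda>n. const_yz (fps_nth (fps_const c) n)) = fps_const (const_yz c)"
    by (auto simp: fps_eq_iff rhom_simps[OF rhom_const_yz])
  thus ?thesis by (simp add: series_el_def)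
qed

lemma x_el_nz: "x_el \<noteq> 0"
  by (simp add: x_el_def)

section \<open>The rings \<open>k[y,z]\<^sub>(\<^sub>y\<^sub>,\<^sub>z\<^sub>)\<close> and \<open>R\<^sup>*\<close>\<close>

text \<open>Polynomials outside the ideal \<open>(y,z)\<close>, which become units in \<open>k[y,z]\<^sub>(\<^sub>y\<^sub>,\<^sub>z\<^sub>)\<close>.\<close>

definition unitc :: "'k::field poly poly \<Rightarrow> bool" where
  "unitc q \<longleftrightarrow> poly (poly q 0) 0 \<noteq> 0"

lemma unitc_1: "unitc 1" and unitc_mult: "unitc p \<Longrightarrow> unitc q \<Longrightarrow> unitc (p * q)"
  and unitc_nz: "unitc q \<Longrightarrow> q \<noteq> 0"
  by (auto simp: unitc_def)

lemma loc_iff: "r \<in> loc_yz \<longleftrightarrow> (\<exists>p q. unitc q \<and> r = Fract p q)"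
  by (auto simp: loc_yz_def unitc_def)

lemma loc_cases: assumes "r \<in> loc_yz" obtains p q where "unitc q" "r = Fract p q" "q \<noteq> 0"
  using assms unitc_nz unfolding loc_iff by blast

lemma loc_to_fract: "to_fract p \<in> loc_yz"
  unfolding loc_iff to_fract_def using unitc_1 by blast

lemma subrng_loc: "subrng loc_yz"
  unfolding subrng_def
proof (intro conjI ballI)
  show "1 \<in> loc_yz" using loc_to_fract[of 1] by simp
next
  fix r s :: "'a poly poly fract" assume "r \<in> loc_yz" "s \<in> loc_yz"
  then obtain p q p' q' where *: "unitc q" "r = Fract p q" "q \<noteq> 0" "unitc q'" "s = Fract p' q'" "q' \<noteq> 0"
    by (metis loc_cases)
  have "r - s = Fract (p * q' - p' * q) (q * q')" "r * s = Fract (p * p') (q * q')"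
    using * by (simp_all add: diff_fract)
  thus "r - s \<in> loc_yz" "r * s \<in> loc_yz" unfolding loc_iff using unitc_mult *(1,4) by blast+
qed

lemma loc_inverse: "unitc p \<Longrightarrow> unitc q \<Longrightarrow> inverse (Fract p q) \<in> loc_yz"
  by (auto simp: loc_iff)

lemma R_star_iff: "a \<in> R_star \<longleftrightarrow> (\<exists>F. (\<forall>n. fps_nth F n \<in> loc_yz) \<and> a = fps_to_fls F)"
  by (auto simp: R_star_def)

lemma subrng_R_star: "subrng (R_star :: 'k::field kyzx set)"
proof -
  let ?S = "{F :: 'k::field poly poly fract fps. \<forall>n. fps_nth F n \<in> loc_yz}"
  have "subrng ?S"
    unfolding subrng_def
    by (auto simp: fps_mult_nth fps_one_def intro!: subrng_sum[OF subrng_loc] subrng_0[OF subrng_loc]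
      subrng_1[OF subrng_loc] subrng_mult[OF subrng_loc] subrng_diff[OF subrng_loc])
  hence "subrng (fps_to_fls ` ?S)" by (rule subrng_image[OF _ rhom_fps_to_fls])
  moreover have "(R_star :: 'k kyzx set) = fps_to_fls ` ?S" unfolding R_star_def by blast
  ultimately show ?thesis by simp
qed

lemma R_star_nth: "a \<in> R_star \<Longrightarrow> fls_nth a (int n) \<in> loc_yz"
  by (auto simp: R_star_iff)

lemma emb_R_star: "emb p \<in> R_star"
  unfolding emb_eq R_star_iff using loc_to_fract by (metis fps_nth_Abs_fps)

lemma const_R_star: "r \<in> loc_yz \<Longrightarrow> fls_const r \<in> R_star"
  unfolding R_star_iff using subrng_0[OF subrng_loc]
  by (intro exI[of _ "fps_const r"]) auto

lemma x_R_star: "x_el \<in> R_star"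
  using emb_R_star[of "[:[:fps_X:]:]"] by (simp add: emb_const series_el_X)

lemma R_star_mult_nth_0:
  assumes "a \<in> R_star" "b \<in> R_star" shows "fls_nth (a * b) 0 = fls_nth a 0 * fls_nth b 0"
proof -
  obtain F G where "a = fps_to_fls F" "b = fps_to_fls G" using assms by (auto simp: R_star_iff)
  hence "a * b = fps_to_fls (F * G)" by (simp add: fls_times_fps_to_fls)
  thus ?thesis using \<open>a = _\<close> \<open>b = _\<close> by (simp add: fps_mult_nth)
qed

lemma x_mult_nth_0: "a \<in> R_star \<Longrightarrow> fls_nth (x_el * a) 0 = 0"
  by (auto simp: x_el_def R_star_iff fls_X_times_conv_shift)

text \<open>A power series is its constant coefficient plus \<open>x\<close> times its tail, and tails of elements of \<open>R\<^sup>*\<close>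
  lie in \<open>R\<^sup>*\<close>.\<close>

lemma fps_to_fls_tail:
  "fps_to_fls F = fls_const (fps_nth F 0) + x_el * fps_to_fls (fps_shift 1 F)"
proof -
  have "F = fps_const (fps_nth F 0) + fps_X * fps_shift 1 F"
    by (auto simp: fps_eq_iff)
  hence "fps_to_fls F = fps_to_fls (fps_const (fps_nth F 0) + fps_X * fps_shift 1 F)" by simp
  also have "\<dots> = fls_const (fps_nth F 0) + x_el * fps_to_fls (fps_shift 1 F)"
    unfolding fps_to_fls_plus fls_times_fps_to_fls by (simp add: x_el_def)
  finally show ?thesis .
qed

lemma R_star_tail:
  assumes "a \<in> R_star"
  shows "\<exists>a'\<in>R_star. a = fls_const (fls_nth a 0) + x_el * a'"
proof -
  obtain F where F: "\<forall>n. fps_nth F n \<in> loc_yz" "a = fps_to_fls F" using assms by (auto simp: R_star_iff)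
  have "fps_to_fls (fps_shift 1 F) \<in> R_star" using F(1) by (auto simp: R_star_iff intro!: exI)
  moreover have "fls_nth a 0 = fps_nth F 0" using F(2) by simp
  ultimately show ?thesis using fps_to_fls_tail[of F] F(2) by metis
qed

text \<open>An element of \<open>R\<^sup>*\<close> with constant coefficient invertible in \<open>k[y,z]\<^sub>(\<^sub>y\<^sub>,\<^sub>z\<^sub>)\<close> is a unit.\<close>

lemma R_star_inverse:
  assumes a: "a \<in> R_star" and p: "fls_nth a 0 = Fract p q" and u: "unitc p" "unitc q"
  shows "a \<noteq> 0" and "inverse a \<in> R_star"
proof -
  obtain F where F: "\<And>n. fps_nth F n \<in> loc_yz" "a = fps_to_fls F" using a by (auto simp: R_star_iff)
  have F0: "fps_nth F 0 = Fract p q" using p F by simp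
  have nz: "fps_nth F 0 \<noteq> 0" 
    unfolding F0 using unitc_nz[OF u(1)] unitc_nz[OF u(2)] by (simp add: Zero_fract_def eq_fract)
  show "a \<noteq> 0" using nz F by auto
  define G where "G = inverse F"
  have FG: "F * G = 1" using inverse_mult_eq_1'[OF nz] by (simp add: G_def)
  have "fps_nth G n \<in> loc_yz" for n
  proof (induction n rule: less_induct)
    case (less n)
    have "fps_nth F 0 * fps_nth G n + (\<Sum>i=1..n. fps_nth F i * fps_nth G (n - i)) = fps_nth (F * G) n"
      by (simp add: fps_mult_nth sum.atLeast_Suc_atMost)
    also have "\<dots> = (if n = 0 then 1 else 0)" by (simp add: FG)
    finally have "fps_nth F 0 * fps_nth G n =
      (if n = 0 then 1 else 0) - (\<Sum>i=1..n. fps_nth F i * fps_nth G (n - i))" by (simp add: algebra_simps)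
    hence "fps_nth G n = inverse (fps_nth F 0) *
      ((if n = 0 then 1 else 0) - (\<Sum>i=1..n. fps_nth F i * fps_nth G (n - i)))"
      using nz by (metis (no_types, lifting) left_inverse mult.assoc mult_1)
    moreover have "inverse (fps_nth F 0) \<in> loc_yz" unfolding F0 by (rule loc_inverse[OF u])
    moreover have "(\<Sum>i=1..n. fps_nth F i * fps_nth G (n - i)) \<in> loc_yz"
      by (intro subrng_sum subrng_mult subrng_loc F less) auto
    ultimately show ?case using subrng_0[OF subrng_loc] subrng_1[OF subrng_loc]
      by (auto intro!: subrng_mult[OF subrng_loc] subrng_diff[OF subrng_loc] subrng_minus[OF subrng_loc])
  qed
  hence "fps_to_fls G \<in> R_star" by (auto simp: R_star_iff)
  moreover have "a * fps_to_fls G = 1" using FG F(2) by (metis fls_times_fps_to_fls fps_to_fls_eq_1_iff)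
  ultimately show "inverse a \<in> R_star" by (metis inverse_unique)
qed

lemma emb_nth_0: "fls_nth (emb p) 0 = to_fract (cf 0 p)"
  by (simp add: emb_eq)

lemma emb_inverse: assumes "unitc (cf 0 d)" shows "emb d \<noteq> 0" "inverse (emb d) \<in> R_star"
  using R_star_inverse[OF emb_R_star, of d "cf 0 d" 1] assms unitc_1 emb_nth_0[of d]
  by (auto simp: to_fract_def)

lemma fls_const_emb:
  assumes "r \<in> loc_yz"
  obtains c d where "unitc (cf 0 d)" "fls_const r = emb c / emb d"
    "c \<in> Polys (Polys (range fps_const))" "d \<in> Polys (Polys (range fps_const))"
proof -
  obtain p q where pq: "unitc q" "r = Fract p q" "q \<noteq> 0" using assms by (rule loc_cases)
  define L where "L = map_poly (map_poly (fps_const :: 'a \<Rightarrow> 'a fps))"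
  have L0: "cf 0 (L p) = p" for p
    by (intro poly_eqI) (simp add: coeff_cf L_def coeff_map_poly)
  have Ln: "cf n (L p) = 0" if "n \<noteq> 0" for n p
    using that by (intro poly_eqI) (simp add: coeff_cf L_def coeff_map_poly)
  have eL: "emb (L p) = fls_const (to_fract p)" for p
  proof -
    have "Abs_fps (\<lambda>n. to_fract (cf n (L p))) = fps_const (to_fract p)"
      by (auto simp: fps_eq_iff L0 Ln)
    thus ?thesis by (simp add: emb_eq)
  qed
  show thesis
  proof
    show "unitc (cf 0 (L q))" by (simp add: L0 pq)
    have "r = to_fract p / to_fract q" using pq by (simp add: to_fract_def)
    thus "fls_const r = emb (L p) / emb (L q)" unfolding eL by (simp add: fls_const_divide_const)
    have "0 \<in> range fps_const" by (metis fps_const_0_eq_0 rangeI)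
    thus "L p \<in> Polys (Polys (range fps_const))" "L q \<in> Polys (Polys (range fps_const))"
      by (auto simp: Polys_def L_def coeff_map_poly)
  qed
qed

section \<open>The setting\<close>

text \<open>The polynomial ring \<open>k[x]\<close> inside \<open>k[[x]]\<close>.\<close>

definition kx :: "'k::field fps set" where
  "kx = range fps_of_poly"

lemma rhom_fps_of_poly: "rhom fps_of_poly"
  by (simp add: rhom_def fps_of_poly_add fps_of_poly_mult)

lemma subrng_range: "rhom h \<Longrightarrow> subrng (range h)"
  by (rule subrng_image) (simp add: subrng_def)

lemma subrng_kx: "subrng kx"
  unfolding kx_def by (rule subrng_range[OF rhom_fps_of_poly])

lemma const_kx: "fps_const c \<in> kx"
  unfolding kx_def using fps_of_poly_const[of c] by (metis rangeI)

lemma X_kx: "fps_X \<in> kx"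
proof -
  have "fps_X = fps_of_poly [:0, 1:]" by (auto simp: fps_eq_iff coeff_pCons split: nat.splits)
  thus ?thesis unfolding kx_def by (metis rangeI)
qed

text \<open>The series \<open>\<alpha>\<close> and \<open>\<beta>\<close> of the construction.\<close>

locale setting =
  fixes \<alpha> \<beta> :: "'k::field fps"
  assumes alpha0: "fps_nth \<alpha> 0 = 0" and beta0: "fps_nth \<beta> 0 = 0"
    and indep: "alg_independent2 field_kx (fps_to_fls \<alpha>) (fps_to_fls \<beta>)"
begin

text \<open>\<open>T = k[x,\<alpha>,\<beta>]\<close>, and \<open>V\<close> is the intersection of its fraction field with \<open>k[[x]]\<close>, a discrete
  valuation ring with uniformizer \<open>x\<close>; \<open>VV = V[y,z]\<close>.\<close>

definition T :: "'k fps set" where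
  "T = adj (adj kx \<alpha>) \<beta>"

definition V :: "'k fps set" where
  "V = {v. \<exists>s\<in>T. \<exists>t\<in>T. t \<noteq> 0 \<and> v * t = s}"

definition VV :: "'k fps poly poly set" where
  "VV = Polys (Polys V)"

lemma subrng_T: "subrng T"
  unfolding T_def by (intro subrng_adj subrng_kx)

lemma kx_T: "kx \<subseteq> T"
  unfolding T_def by (blast intro: adj_incl subrng_adj subrng_kx)

lemma T_V: "T \<subseteq> V"
proof
  fix t assume "t \<in> T"
  moreover have "1 \<in> T" by (rule subrng_1[OF subrng_T])
  moreover have "t * 1 = t" "(1 :: 'k fps) \<noteq> 0" by simp_all
  ultimately show "t \<in> V" unfolding V_def by blast
qed

lemma subrng_V: "subrng V"
  unfolding subrng_def
proof (intro conjI ballI)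
  show "1 \<in> V" using T_V subrng_1[OF subrng_T] by blast
next
  fix v w assume "v \<in> V" "w \<in> V"
  then obtain s t s' t' where *: "s \<in> T" "t \<in> T" "t \<noteq> 0" "v * t = s" "s' \<in> T" "t' \<in> T" "t' \<noteq> 0" "w * t' = s'"
    unfolding V_def by blast
  have "(v - w) * (t * t') = s * t' - s' * t" "(v * w) * (t * t') = s * s'"
    unfolding *(4,8)[symmetric] by (simp_all add: algebra_simps)
  moreover have "s * t' - s' * t \<in> T" "s * s' \<in> T" "t * t' \<in> T" "t * t' \<noteq> 0"
    using * by (auto intro!: subrng_diff[OF subrng_T] subrng_mult[OF subrng_T])
  ultimately show "v - w \<in> V" "v * w \<in> V" unfolding V_def by blast+
qed

lemma V_div:
  assumes "a \<in> V" "b \<in> V" "b \<noteq> 0" "a = s * b" shows "s \<in> V"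
proof -
  obtain p q p' q' where *: "p \<in> T" "q \<in> T" "q \<noteq> 0" "a * q = p" "p' \<in> T" "q' \<in> T" "q' \<noteq> 0" "b * q' = p'"
    using assms unfolding V_def by blast
  have "s * (p' * q) = p * q'" unfolding *(4,8)[symmetric] assms(4) by (simp add: algebra_simps)
  moreover have "p' * q \<noteq> 0" "p' * q \<in> T" "p * q' \<in> T"
    using * assms(3) by (auto intro!: subrng_mult[OF subrng_T])
  ultimately show ?thesis unfolding V_def by blast
qed

lemma noeth_V: "noeth V"
  unfolding noeth_def
proof (intro allI impI)
  fix b :: "nat \<Rightarrow> 'k fps" assume b: "\<forall>n. b n \<in> V"
  show "\<exists>n. b n \<in> idl V (b ` {..<n})"
  proof (cases "\<exists>n. b n = 0")
    case True thus ?thesis by (metis idl.zero)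
  next
    case False
    obtain n where n: "\<And>m. subdegree (b n) \<le> subdegree (b m)"
      using arg_min_nat_lemma[of "\<lambda>_. True" 0 "\<lambda>n. subdegree (b n)"] by blast
    have "b n dvd b (Suc n)" using False n by (simp add: fps_dvd_iff)
    then obtain s where s: "b (Suc n) = s * b n" by (metis dvd_div_mult_self)
    have "s \<in> V" using V_div[OF _ _ _ s] b False by blast
    hence "s * b n + 0 \<in> idl V (b ` {..<Suc n})" by (intro idl.step idl.zero) auto
    hence "b (Suc n) \<in> idl V (b ` {..<Suc n})" using s by simp
    thus ?thesis by blast
  qed
qed

lemma cic_V: "cic V"
  unfolding cic_def
proof (intro ballI impI)
  fix a b d assume *: "a \<in> V" "b \<in> V" "d \<in> V" "b \<noteq> 0" "d \<noteq> 0" "almost V d a b"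
  have "b dvd a"
  proof (cases "a = 0")
    case False
    let ?j = "Suc (subdegree d)"
    obtain s where s: "d * a ^ ?j = s * b ^ ?j" using *(6) unfolding almost_def by blast
    have nz: "d * a ^ ?j \<noteq> 0" using False * by simp
    hence "s \<noteq> 0" using s by auto
    have "subdegree (d * a ^ ?j) = subdegree d + ?j * subdegree a" using False *
      by (simp add: subdegree_power del: power_Suc)
    moreover have "subdegree (s * b ^ ?j) = subdegree s + ?j * subdegree b" using \<open>s \<noteq> 0\<close> *
      by (simp add: subdegree_power del: power_Suc)
    ultimately have "subdegree d + ?j * subdegree a \<ge> ?j * subdegree b" using s by simp
    moreover have "?j * subdegree b \<ge> ?j * Suc (subdegree a)" if "subdegree a < subdegree b"
      using that by (intro mult_le_mono2) simp
    ultimately have "subdegree b \<le> subdegree a" by (cases "subdegree a < subdegree b") auto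
    thus ?thesis using False * by (simp add: fps_dvd_iff)
  qed simp
  then obtain s where s: "a = s * b" by (metis dvd_div_mult_self)
  thus "\<exists>s\<in>V. a = s * b" using V_div[OF *(1,2,4) s] by blast
qed

lemma const_V: "range fps_const \<subseteq> V"
  using const_kx kx_T T_V by blast

lemma X_V: "fps_X \<in> V"
  using X_kx kx_T T_V by blast

lemma subrng_VV: "subrng VV"
  unfolding VV_def by (intro subrng_Polys subrng_V)

lemma noeth_VV: "noeth VV"
  unfolding VV_def by (intro hilbert_basis subrng_Polys subrng_V noeth_V)

lemma cic_VV: "cic VV"
  unfolding VV_def by (intro cic_Polys subrng_Polys subrng_V cic_V)

lemma VV_const: "v \<in> V \<Longrightarrow> [:[:v:]:] \<in> VV"
  unfolding VV_def by (simp add: Polys_pCons Polys_0 subrng_Polys subrng_V)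

section \<open>The localization of \<open>V[y,z]\<close> at its maximal ideal \<open>(x,y,z)\<close>\<close>

text \<open>The denominators are the elements of \<open>V[y,z]\<close> outside \<open>(x,y,z)\<close>; all of \<open>N\<close> lies in \<open>R\<^sup>*\<close>.\<close>

definition N :: "'k kyzx set" where
  "N = {emb c / emb d | c d. c \<in> VV \<and> d \<in> VV \<and> unitc (cf 0 d)}"

lemma N_cases:
  assumes "r \<in> N"
  obtains c d where "c \<in> VV" "d \<in> VV" "unitc (cf 0 d)" "emb d \<noteq> 0" "r = emb c / emb d"
  using assms emb_inverse(1) unfolding N_def by blast

lemma N_I: "c \<in> VV \<Longrightarrow> d \<in> VV \<Longrightarrow> unitc (cf 0 d) \<Longrightarrow> emb c / emb d \<in> N"
  unfolding N_def by blast

lemma cf0_mult: "cf 0 (p * q) = cf 0 p * cf 0 (q :: 'k fps poly poly)"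
  and cf0_1: "cf 0 (1 :: 'k fps poly poly) = 1"
  and cf0_diff: "cf 0 (p - q) = cf 0 p - cf 0 (q :: 'k fps poly poly)"
proof -
  have "rhom (\<lambda>c :: 'k fps. fps_nth c 0)" by (simp add: rhom_def fps_mult_nth)
  hence "rhom (cf 0 :: 'k fps poly poly \<Rightarrow> _)" unfolding cf_def by (intro rhom_map_poly)
  thus "cf 0 (p * q) = cf 0 p * cf 0 q" "cf 0 (1 :: 'k fps poly poly) = 1"
    "cf 0 (p - q) = cf 0 p - cf 0 q" for p q :: "'k fps poly poly"
    by (simp_all add: rhom_simps)
qed

lemma VV_N: "c \<in> VV \<Longrightarrow> emb c \<in> N"
  using N_I[of c 1] subrng_1[OF subrng_VV] by (simp add: cf0_1 unitc_1 emb_simps)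

lemma subrng_N: "subrng N"
  unfolding subrng_def
proof (intro conjI ballI)
  show "1 \<in> N" using VV_N[OF subrng_1[OF subrng_VV]] by (simp add: emb_simps)
next
  fix r s assume "r \<in> N" "s \<in> N"
  then obtain c d c' d' where *: "c \<in> VV" "d \<in> VV" "unitc (cf 0 d)" "emb d \<noteq> 0" "r = emb c / emb d"
    "c' \<in> VV" "d' \<in> VV" "unitc (cf 0 d')" "emb d' \<noteq> 0" "s = emb c' / emb d'" by (metis N_cases)
  have "r - s = emb (c * d' - c' * d) / emb (d * d')" "r * s = emb (c * c') / emb (d * d')"
    using * by (simp_all add: emb_simps diff_frac_eq)
  moreover have "c * d' - c' * d \<in> VV" "c * c' \<in> VV" "d * d' \<in> VV"
    using * by (auto intro!: subrng_diff[OF subrng_VV] subrng_mult[OF subrng_VV])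
  moreover have "unitc (cf 0 (d * d'))" using * by (simp add: cf0_mult unitc_mult)
  ultimately show "r - s \<in> N" "r * s \<in> N" unfolding N_def by blast+
qed

lemma N_R_star: "N \<subseteq> R_star"
proof
  fix r assume "r \<in> N"
  then obtain c d where "unitc (cf 0 d)" "r = emb c / emb d" by (metis N_cases)
  thus "r \<in> R_star" using subrng_mult[OF subrng_R_star emb_R_star emb_inverse(2)]
    by (simp add: divide_inverse)
qed

lemma const_N: assumes "r \<in> loc_yz" shows "fls_const r \<in> N"
proof -
  from assms obtain c d where *: "unitc (cf 0 d)" "fls_const r = emb c / emb d"
    "c \<in> Polys (Polys (range fps_const))" "d \<in> Polys (Polys (range fps_const))"
    by (rule fls_const_emb)
  have "c \<in> VV \<and> d \<in> VV" unfolding VV_def using *(3,4) Polys_mono[OF Polys_mono[OF const_V]] by blast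
  thus ?thesis using * N_I by simp
qed

lemma x_eq_emb: "x_el = emb [:[:fps_X:]:]"
  by (simp add: emb_const series_el_X)

lemma x_N: "x_el \<in> N"
  unfolding x_eq_emb by (intro VV_N VV_const X_V)

lemma noeth_N: "noeth N"
  unfolding noeth_def
proof (intro allI impI)
  fix b :: "nat \<Rightarrow> 'k kyzx" assume "\<forall>n. b n \<in> N"
  hence "\<forall>n. \<exists>c d. c \<in> VV \<and> d \<in> VV \<and> unitc (cf 0 d) \<and> emb d \<noteq> 0 \<and> b n = emb c / emb d"
    by (metis N_cases)
  then obtain c d where cd: "\<And>n. c n \<in> VV" "\<And>n. d n \<in> VV" "\<And>n. unitc (cf 0 (d n))"
    "\<And>n. emb (d n) \<noteq> 0" "\<And>n. b n = emb (c n) / emb (d n)" by metis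
  obtain n where n: "c n \<in> idl VV (c ` {..<n})" using noeth_VV cd(1) unfolding noeth_def by blast
  have "emb r \<in> idl N (b ` {..<n})" if "r \<in> idl VV (c ` {..<n})" for r
    using that
  proof (induction rule: idl.induct)
    case zero show ?case by (simp add: emb_simps idl.zero)
  next
    case (step s e r)
    then obtain i where i: "i < n" "e = c i" by blast
    have "emb (s * e + r) = emb (s * d i) * b i + emb r" using cd(4,5)[of i] by (simp add: i emb_simps)
    moreover have "emb (s * d i) \<in> N" by (intro VV_N subrng_mult[OF subrng_VV] step cd)
    ultimately show ?case using step i by (auto intro!: idl.step)
  qed
  from this[OF n] have "(1 / emb (d n)) * emb (c n) \<in> idl N (b ` {..<n})"
    by (intro idl_mult subrng_N) (use N_I[of 1 "d n"] cd subrng_1[OF subrng_VV] in \<open>auto simp: emb_simps\<close>)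
  hence "b n \<in> idl N (b ` {..<n})" using cd(5)[of n] by simp
  thus "\<exists>n. b n \<in> idl N (b ` {..<n})" by blast
qed

lemma N_div_x: assumes r: "r \<in> R_star" and xr: "x_el * r \<in> N" shows "r \<in> N"
proof -
  obtain c d where *: "c \<in> VV" "d \<in> VV" "unitc (cf 0 d)" "emb d \<noteq> 0" "x_el * r = emb c / emb d"
    using xr by (rule N_cases)
  have c: "emb c = x_el * (r * emb d)" using * by (simp add: field_simps)
  have "fls_nth (emb c) 0 = 0" unfolding c
    by (rule x_mult_nth_0) (intro subrng_mult subrng_R_star r emb_R_star)
  hence "cf 0 c = 0" by (simp add: emb_nth_0)
  hence c0: "fps_nth (coeff (coeff c j) i) 0 = 0" for i j by (metis coeff_cf coeff_0)
  define c' where "c' = map_poly (map_poly (fps_shift 1)) c"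
  have coeff_c': "coeff (coeff c' j) i = fps_shift 1 (coeff (coeff c j) i)" for i j
    by (simp add: c'_def coeff_map_poly)
  have shift: "fps_X * coeff (coeff c' j) i = coeff (coeff c j) i" for i j
    unfolding coeff_c' using c0[of j i] by (auto simp: fps_eq_iff)
  have cV: "coeff (coeff c j) i \<in> V" for i j using *(1) unfolding VV_def by (auto intro: Polys_coeff)
  have "coeff (coeff c' j) i \<in> V" for i j
    by (rule V_div[OF cV[of j i] X_V]) (use shift[of j i] in \<open>auto simp: mult.commute\<close>)
  hence c'V: "c' \<in> VV" unfolding VV_def Polys_def by simp
  have "c = [:[:fps_X:]:] * c'" by (intro poly_eqI) (simp add: shift)
  hence "emb c = x_el * emb c'" by (metis emb_simps(3) x_eq_emb)
  hence "x_el * (r * emb d) = x_el * emb c'" using c by simp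
  hence "r * emb d = emb c'" using x_el_nz by (metis mult_left_cancel)
  hence "r = emb c' / emb d" using *(4) by (simp add: field_simps)
  thus ?thesis using N_I c'V * by simp
qed

lemma N_inverse: assumes "s \<in> N" shows "1 - x_el * s \<noteq> 0" "inverse (1 - x_el * s) \<in> N"
proof -
  obtain c d where *: "c \<in> VV" "d \<in> VV" "unitc (cf 0 d)" "emb d \<noteq> 0" "s = emb c / emb d"
    using assms by (rule N_cases)
  let ?e = "d - [:[:fps_X:]:] * c"
  have eq: "1 - x_el * s = emb ?e / emb d"
    using * by (simp add: emb_simps(6) emb_simps(3) x_eq_emb diff_divide_distrib del: mult_pCons_left)
  have eV: "?e \<in> VV" by (intro subrng_diff subrng_mult subrng_VV * VV_const X_V)
  have "cf 0 ([:[:fps_X:]:] :: 'k fps poly poly) = 0" by (simp add: cf_def map_poly_pCons)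
  hence "cf 0 ?e = cf 0 d" by (simp only: cf0_diff cf0_mult mult_zero_left diff_zero)
  hence u: "unitc (cf 0 ?e)" using * by simp
  show "1 - x_el * s \<noteq> 0" unfolding eq using emb_inverse(1)[OF u] *(4) by simp
  show "inverse (1 - x_el * s) \<in> N" unfolding eq using N_I[OF *(2) eV u] by simp
qed

text \<open>\<open>R\<^sup>*\<close> is the \<open>x\<close>-adic completion of the Noetherian local ring \<open>N\<close>, so principal ideals of \<open>N\<close> are
  contracted from \<open>R\<^sup>*\<close>. Writing \<open>t\<^sub>n\<close> for the \<open>n\<close>-th tail of \<open>a = p/q\<close>, the elements \<open>q t\<^sub>n\<close> of \<open>N\<close>
  satisfy \<open>q t\<^sub>n = x q t\<^sub>n\<^sub>+\<^sub>1\<close> modulo \<open>qN\<close>, and the Noetherian property makes one of them a multiple of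
  \<open>q\<close>.\<close>

theorem fraction_in_N:
  assumes p: "p \<in> VV" and q: "q \<in> VV" and q0: "q \<noteq> 0" and a: "a \<in> R_star" and eq: "a * emb q = emb p"
  shows "a \<in> N"
proof -
  obtain F where F: "\<And>n. fps_nth F n \<in> loc_yz" "a = fps_to_fls F" using a by (auto simp: R_star_iff)
  define t where "t n = fps_to_fls (fps_shift n F)" for n
  define r where "r n = fls_const (fps_nth F n)" for n
  have rN: "r n \<in> N" for n unfolding r_def by (intro const_N F)
  have t0: "t 0 = a" by (simp add: t_def F)
  have tS: "t n = r n + x_el * t (Suc n)" for n
  proof -
    have "fps_shift 1 (fps_shift n F) = fps_shift (Suc n) F" by (simp add: fps_eq_iff)
    thus ?thesis using fps_to_fls_tail[of "fps_shift n F"] by (simp add: t_def r_def)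
  qed
  have tR: "t n \<in> R_star" for n unfolding t_def R_star_iff using F(1) by (intro exI[of _ "fps_shift n F"]) simp
  define b where "b n = emb q * t n" for n
  have qN: "emb q \<in> N" by (rule VV_N[OF q])
  have bS: "b n = r n * emb q + x_el * b (Suc n)" for n
    unfolding b_def by (subst tS) (simp add: algebra_simps)
  have bN: "b n \<in> N" for n
  proof (induction n)
    case 0
    show ?case using VV_N[OF p] eq by (simp add: b_def t0 mult.commute)
  next
    case (Suc n)
    have "x_el * b (Suc n) = b n - r n * emb q" by (simp add: bS[of n])
    also have "\<dots> \<in> N" by (intro subrng_diff[OF subrng_N] subrng_mult[OF subrng_N] Suc rN qN)
    finally show ?case
      by (rule N_div_x[rotated]) (auto simp: b_def intro!: subrng_mult[OF subrng_R_star] emb_R_star tR)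
  qed
  have rel: "\<exists>s\<in>N. b i = s * emb q + x_el ^ k * b (i + k)" for i k
  proof (induction k)
    case 0
    show ?case by (rule bexI[of _ 0]) (auto simp: subrng_0[OF subrng_N])
  next
    case (Suc k)
    then obtain s where s: "s \<in> N" "b i = s * emb q + x_el ^ k * b (i + k)" by blast
    have "b i = (s + x_el ^ k * r (i + k)) * emb q + x_el ^ Suc k * b (i + Suc k)"
      unfolding s(2) by (subst bS) (simp add: algebra_simps)
    moreover have "s + x_el ^ k * r (i + k) \<in> N"
      by (intro subrng_add[OF subrng_N] subrng_mult[OF subrng_N] subrng_power[OF subrng_N] x_N s rN)
    ultimately show ?case by blast
  qed
  define b' where "b' n = (case n of 0 \<Rightarrow> emb q | Suc m \<Rightarrow> b m)" for n
  have "\<forall>n. b' n \<in> N" using qN bN by (auto simp: b'_def split: nat.splits)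
  then obtain n where n: "b' n \<in> idl N (b' ` {..<n})" using noeth_N unfolding noeth_def by blast
  have "n \<noteq> 0"
  proof
    assume "n = 0"
    hence "emb q \<in> idl N {}" using n by (simp add: b'_def)
    hence "emb q = 0" by (cases rule: idl.cases) auto
    thus False using emb_nz[OF q0] by blast
  qed
  then obtain m where m: "n = Suc m" by (cases n) auto
  have "\<exists>s1\<in>N. \<exists>s2\<in>N. e = s1 * emb q + x_el * (s2 * b m)" if "e \<in> idl N (b' ` {..<Suc m})" for e
    using that
  proof (induction rule: idl.induct)
    case zero
    show ?case by (intro bexI[of _ 0]) (auto simp: subrng_0[OF subrng_N])
  next
    case (step s c e)
    then obtain s1 s2 where e: "s1 \<in> N" "s2 \<in> N" "e = s1 * emb q + x_el * (s2 * b m)" by blast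
    obtain i where i: "i < Suc m" "c = b' i" using step by blast
    show ?case
    proof (cases i)
      case 0
      hence "s * c + e = (s + s1) * emb q + x_el * (s2 * b m)" by (simp add: i b'_def e algebra_simps)
      moreover have "s + s1 \<in> N" by (intro subrng_add[OF subrng_N] step e)
      ultimately show ?thesis using e by blast
    next
      case (Suc l)
      then obtain k where k: "m = l + Suc k" using i by (metis Suc_less_eq add_Suc_right less_imp_Suc_add)
      obtain s3 where s3: "s3 \<in> N" "b l = s3 * emb q + x_el ^ Suc k * b m" using rel[of l "Suc k"] k by auto
      have "s * c + e = (s * s3 + s1) * emb q + x_el * ((s * x_el ^ k + s2) * b m)"
        by (simp add: Suc i b'_def e s3 algebra_simps)
      moreover have "s * s3 + s1 \<in> N" "s * x_el ^ k + s2 \<in> N"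
        by (intro subrng_add[OF subrng_N] subrng_mult[OF subrng_N] subrng_power[OF subrng_N] step e s3 x_N)+
      ultimately show ?thesis by blast
    qed
  qed
  from this[OF n[unfolded m]] obtain s1 s2 where s: "s1 \<in> N" "s2 \<in> N" "b m = s1 * emb q + x_el * (s2 * b m)"
    by (auto simp: b'_def)
  have "emb q * (t m * (1 - x_el * s2)) = emb q * s1"
    using s(3) unfolding b_def by (simp add: algebra_simps)
  hence "t m * (1 - x_el * s2) = s1" using emb_nz[OF q0] by simp
  hence "t m = s1 * inverse (1 - x_el * s2)" using N_inverse(1)[OF s(2)] by (simp add: field_simps)
  hence "t m \<in> N" using subrng_mult[OF subrng_N s(1) N_inverse(2)[OF s(2)]] by simp
  moreover have "t k \<in> N" if "t (Suc k) \<in> N" for k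
    by (subst tS) (intro subrng_add[OF subrng_N] subrng_mult[OF subrng_N] rN x_N that)
  ultimately have "t 0 \<in> N" by (induction m) auto
  thus ?thesis by (simp add: t0)
qed

end

section \<open>Algebraic independence\<close>

text \<open>An element \<open>w\<close> that is killed by a homomorphism injective on \<open>S\<close> is transcendental over \<open>S\<close>: the constant
  term of a relation vanishes, and \<open>w\<close> can be cancelled. The lemma gives the independence of the
  powers of \<open>h\<^sub>1 w\<close> over \<open>h\<^sub>1 S\<close> at the same time.\<close>

lemma transcendental_over:
  fixes h1 :: "'a::comm_ring_1 \<Rightarrow> 'b::idom" and h2 :: "'b \<Rightarrow> 'c::comm_ring_1"
  assumes h1: "rhom h1" and h2: "rhom h2" and w: "h1 w \<noteq> 0" "h2 (h1 w) = 0"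
    and S: "\<And>s. s \<in> S \<Longrightarrow> h2 (h1 s) = 0 \<Longrightarrow> s = 0"
    and p: "p \<in> Polys S" and 0: "h1 (poly p w) = 0"
  shows "p = 0"
  using p 0
proof (induction p rule: Polys_induct)
  case (pCons c p)
  have "h2 (h1 c) = h2 (h1 (poly (pCons c p) w))"
    by (simp add: rhom_simps[OF h1] rhom_simps[OF h2] w)
  hence c: "c = 0" using S pCons by (simp add: rhom_0[OF h2])
  hence "h1 w * h1 (poly p w) = 0" using pCons.prems by (simp add: rhom_simps[OF h1])
  hence "p = 0" using w pCons.IH by simp
  thus ?case using c by simp
qed simp

text \<open>If \<open>w\<close> is transcendental over \<open>S\<close>, then \<open>1\<close> and \<open>w\<close> are linearly independent over \<open>S[w\<^sup>2]\<close>.\<close>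

lemma parity:
  fixes w :: "'a::comm_ring_1"
  assumes tr: "\<And>r. r \<in> Polys S \<Longrightarrow> poly r w = 0 \<Longrightarrow> r = 0"
    and p: "p \<in> Polys S" and q: "q \<in> Polys S" and 0: "poly p (w\<^sup>2) + w * poly q (w\<^sup>2) = 0"
  shows "p = 0 \<and> q = 0"
proof -
  have "p \<in> Polys S \<longrightarrow> q \<in> Polys S \<longrightarrow>
    (\<exists>r\<in>Polys S. poly r w = poly p (w\<^sup>2) + w * poly q (w\<^sup>2) \<and> (r = 0 \<longrightarrow> p = 0 \<and> q = 0))"
  proof (induction p q rule: poly_induct2)
    case 0
    show ?case by (auto intro!: bexI[of _ 0])
  next
    case (pCons a p b q)
    show ?case
    proof (intro impI)
      assume *: "pCons a p \<in> Polys S" "pCons b q \<in> Polys S"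
      then obtain r where r: "r \<in> Polys S" "poly r w = poly p (w\<^sup>2) + w * poly q (w\<^sup>2)"
        "r = 0 \<longrightarrow> p = 0 \<and> q = 0" using pCons by (auto simp: Polys_pCons)
      have "pCons a (pCons b r) \<in> Polys S" using * r by (simp add: Polys_pCons)
      moreover have "poly (pCons a (pCons b r)) w = poly (pCons a p) (w\<^sup>2) + w * poly (pCons b q) (w\<^sup>2)"
        by (simp add: r(2) power2_eq_square algebra_simps)
      moreover have "pCons a (pCons b r) = 0 \<longrightarrow> pCons a p = 0 \<and> pCons b q = 0" using r(3) by auto
      ultimately show "\<exists>r\<in>Polys S. poly r w = poly (pCons a p) (w\<^sup>2) + w * poly (pCons b q) (w\<^sup>2) \<and>
        (r = 0 \<longrightarrow> pCons a p = 0 \<and> pCons b q = 0)" by blast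
    qed
  qed
  thus ?thesis using tr p q 0 by metis
qed

lemma poly_map_poly_hom: "rhom h \<Longrightarrow> poly (map_poly h p) (h a) = h (poly p a)"
  by (induction p) (simp_all add: map_poly_pCons_0 rhom_simps)

lemma poly_poly_hom:
  assumes h: "rhom h"
  shows "poly (poly (map_poly (map_poly h) p) [:h b:]) (h a) = h (poly (poly p [:b:]) a)"
proof -
  have "[:h b:] = map_poly h [:b:]" by (simp add: map_poly_pCons_0 rhom_0[OF h])
  thus ?thesis using poly_map_poly_hom[OF rhom_map_poly[OF h], of p "[:b:]"] poly_map_poly_hom[OF h]
    by simp
qed

lemma clear_denominators:
  fixes T :: "'a::idom set"
  assumes T: "1 \<in> T" "\<And>s t. s \<in> T \<Longrightarrow> t \<in> T \<Longrightarrow> s * t \<in> T" and T': "0 \<in> T'" "\<And>s t. s \<in> T \<Longrightarrow> t \<in> T' \<Longrightarrow> s * t \<in> T'"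
    and S: "\<And>s. s \<in> S \<Longrightarrow> \<exists>t\<in>T. t \<noteq> 0 \<and> t * s \<in> T'"
    and p: "p \<in> Polys S"
  shows "\<exists>t\<in>T. t \<noteq> 0 \<and> smult t p \<in> Polys T'"
  using p
proof (induction p rule: Polys_induct)
  case 0
  show ?case using T(1) T'(1) by (intro bexI[of _ 1]) (auto simp: Polys_def)
next
  case (pCons c p)
  obtain s where s: "s \<in> T" "s \<noteq> 0" "smult s p \<in> Polys T'" using pCons by blast
  obtain t where t: "t \<in> T" "t \<noteq> 0" "t * c \<in> T'" using S pCons by blast
  have "s * (t * c) \<in> T'" by (rule T'(2)) (use s t in auto)
  moreover have "coeff (smult s p) i \<in> T'" for i using s(3) by (rule Polys_coeff)
  hence "t * coeff (smult s p) i \<in> T'" for i by (rule T'(2)[OF t(1)])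
  hence "smult (s * t) p \<in> Polys T'" by (simp add: Polys_def mult_ac)
  ultimately have "smult (s * t) (pCons c p) \<in> Polys T'" by (simp add: Polys_pCons mult_ac)
  thus ?case using s t T(2) by (intro bexI[of _ "s * t"]) auto
qed

lemma subrng_consts: assumes R: "subrng R" shows "subrng {c. [:c:] \<in> R}"
proof -
  have "[:a - b:] \<in> R" "[:a * b:] \<in> R" if "[:a:] \<in> R" "[:b:] \<in> R" for a b
    using subrng_diff[OF R that] subrng_mult[OF R that] by (simp_all add: mult.commute)
  moreover have "[:1:] \<in> R" using subrng_1[OF R] by (simp add: one_pCons)
  ultimately show ?thesis by (simp add: subrng_def)
qed

context setting
begin

text \<open>\<open>D = k[x][y,z]\<close>; the elements \<open>u = y - \<alpha>\<close> and \<open>v = z - \<beta>\<close> have the squares \<open>f\<close> and \<open>g\<close>.\<close>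

definition D :: "'k fps poly poly set" where
  "D = Polys (Polys kx)"

definition uu :: "'k fps poly poly" where
  "uu = [:[:- \<alpha>, 1:]:]"

definition vv :: "'k fps poly poly" where
  "vv = [:[:- \<beta>:], 1:]"

definition ff :: "'k fps poly poly" where
  "ff = uu\<^sup>2"

definition gg :: "'k fps poly poly" where
  "gg = vv\<^sup>2"

text \<open>\<open>U\<^sub>0 = k[x,y,z,f,g]\<close> and \<open>U\<^sub>1 = k[x,y,z,u,v] = k[x,\<alpha>,\<beta>,y,z]\<close>.\<close>

definition U0 :: "'k fps poly poly set" where
  "U0 = adj (adj D ff) gg"

definition U1 :: "'k fps poly poly set" where
  "U1 = adj (adj D uu) vv"

text \<open>The specialization \<open>y \<mapsto> \<alpha>\<close>, \<open>z \<mapsto> \<beta>\<close>.\<close>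

definition sp :: "'k fps poly poly \<Rightarrow> 'k fps" where
  "sp p = poly (poly p [:\<beta>:]) \<alpha>"

lemma subrng_D: "subrng D"
  unfolding D_def by (intro subrng_Polys subrng_kx)

lemma subrng_U0: "subrng U0"
  unfolding U0_def by (intro subrng_adj subrng_D)

lemma subrng_U1: "subrng U1"
  unfolding U1_def by (intro subrng_adj subrng_D)

lemma D_U0: "D \<subseteq> U0" and ff_U0: "ff \<in> U0" and gg_U0: "gg \<in> U0"
  unfolding U0_def using adj_incl adj_gen subrng_adj subrng_D by blast+

lemma D_U1: "D \<subseteq> U1" and uu_U1: "uu \<in> U1" and vv_U1: "vv \<in> U1"
  unfolding U1_def using adj_incl adj_gen subrng_adj subrng_D by blast+

lemma D_const: "c \<in> kx \<Longrightarrow> [:[:c:]:] \<in> D"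
  unfolding D_def by (simp add: Polys_pCons Polys_0 subrng_Polys subrng_kx)

lemma y_D: "[:[:0, 1:]:] \<in> D"
  unfolding D_def by (simp add: Polys_pCons Polys_0 subrng_Polys subrng_kx subrng_0 subrng_1)

lemma z_D: "[:0, 1:] \<in> D"
  unfolding D_def by (simp add: Polys_pCons Polys_0 subrng_Polys subrng_kx subrng_0 subrng_1)

lemma D_minimal:
  assumes R: "subrng R" and "\<And>c. c \<in> kx \<Longrightarrow> [:[:c:]:] \<in> R" "[:[:0, 1:]:] \<in> R" "[:0, 1:] \<in> R"
  shows "D \<subseteq> R"
  unfolding D_def
proof (rule Polys_minimal[OF R])
  have "subrng {c. [:c:] \<in> R}" by (rule subrng_consts[OF R])
  hence "Polys kx \<subseteq> {c. [:c:] \<in> R}" by (rule Polys_minimal) (use assms in auto)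
  thus "\<And>c. c \<in> Polys kx \<Longrightarrow> [:c:] \<in> R" by blast
qed (rule assms)

lemma U0_cases:
  assumes "h \<in> U0"
  obtains d h1 h2 where "d \<in> D" "h1 \<in> U0" "h2 \<in> U0" "h = d + ff * h1 + gg * h2"
proof -
  obtain p where p: "p \<in> Polys (adj D ff)" "h = poly p gg" using assms unfolding U0_def adj_def by blast
  obtain c p' where c: "p = pCons c p'" by (cases p)
  hence p': "p' \<in> Polys (adj D ff)" "c \<in> adj D ff" using p by (simp_all add: Polys_pCons)
  obtain q where q: "q \<in> Polys D" "c = poly q ff" using p'(2) unfolding adj_def by blast
  obtain d q' where d: "q = pCons d q'" by (cases q)
  hence q': "q' \<in> Polys D" "d \<in> D" using q by (simp_all add: Polys_pCons)
  have "poly p' gg \<in> U0" unfolding U0_def using p' by (simp add: adj_def)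
  moreover have "poly q' ff \<in> adj D ff" using q' by (simp add: adj_def)
  hence "poly q' ff \<in> U0" unfolding U0_def by (blast intro: adj_incl subrng_adj subrng_D)
  moreover have "h = d + ff * poly q' ff + gg * poly p' gg" using p q c d by simp
  ultimately show thesis using that q' by blast
qed

lemma fps_to_fls_kx: "c \<in> kx \<Longrightarrow> fps_to_fls c \<in> field_kx"
proof -
  assume "c \<in> kx"
  then obtain p where p: "c = fps_of_poly p" unfolding kx_def by blast
  have "fps_to_fls (fps_of_poly p) \<in> field_kx"
  proof (induction p)
    case 0
    have "fls_const 0 \<in> field_kx" unfolding field_kx_def by (rule generate_field.incl) blast
    thus ?case by simp
  next
    case (pCons a p)
    have 1: "fls_const a \<in> field_kx" unfolding field_kx_def by (rule generate_field.incl) blast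
    have 2: "fls_X \<in> field_kx" unfolding field_kx_def by (rule generate_field.incl) blast
    have "fps_of_poly (pCons a p) = fps_const a + fps_X * fps_of_poly p"
      by (simp add: fps_of_poly_pCons mult.commute)
    hence eq: "fps_to_fls (fps_of_poly (pCons a p)) = fls_const a + fls_X * fps_to_fls (fps_of_poly p)"
      by (simp only: fls_times_fps_to_fls fps_to_fls_plus fps_X_to_fls fps_const_to_fls)
    have "fls_X * fps_to_fls (fps_of_poly p) \<in> field_kx"
      using generate_field.eng_mult[OF 2[unfolded field_kx_def] pCons.IH[unfolded field_kx_def]]
      by (simp add: ring_of_type_algebra_def field_kx_def)
    with 1 show ?case unfolding eq field_kx_def
      using generate_field.eng_add[of "fls_const a" ring_of_type_algebra]
      by (fastforce simp: ring_of_type_algebra_def)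
  qed
  thus ?thesis using p by simp
qed

text \<open>This is the algebraic independence of \<open>\<alpha>\<close> and \<open>\<beta>\<close> over \<open>k(x)\<close>.\<close>

lemma D_sp: assumes "d \<in> D" "sp d = 0" shows "d = 0"
proof -
  let ?q = "map_poly (map_poly fps_to_fls) d"
  have "coeff (coeff ?q i) j \<in> field_kx" for i j
    using assms(1) by (auto simp: D_def coeff_map_poly intro!: fps_to_fls_kx Polys_coeff)
  moreover have "poly (poly ?q [:fps_to_fls \<beta>:]) (fps_to_fls \<alpha>) = 0"
    using assms(2) by (simp add: poly_poly_hom[OF rhom_fps_to_fls] sp_def)
  ultimately have "?q = 0" using indep unfolding alg_independent2_def by blast
  hence "coeff (coeff ?q i) j = 0" for i j by simp
  hence "coeff (coeff d i) j = 0" for i j by (simp add: coeff_map_poly)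
  thus ?thesis by (intro poly_eqI) simp
qed

lemma u_transcendental': "p \<in> Polys D \<Longrightarrow> poly (poly p uu) [:\<beta>:] = 0 \<Longrightarrow> p = 0"
  by (rule transcendental_over[OF rhom_poly[of "[:\<beta>:]"] rhom_poly[of \<alpha>], where w = uu and S = D])
    (use D_sp in \<open>auto simp: uu_def sp_def\<close>)

lemma u_transcendental: "p \<in> Polys D \<Longrightarrow> poly p uu = 0 \<Longrightarrow> p = 0"
  using u_transcendental' by simp

lemma v_transcendental: "p \<in> Polys (adj D uu) \<Longrightarrow> poly p vv = 0 \<Longrightarrow> p = 0"
proof (rule transcendental_over[where ?h1.0 = "\<lambda>p. p" and ?h2.0 = "\<lambda>p. poly p [:\<beta>:]" and w = vv and S = "adj D uu"])
  show "rhom (\<lambda>p :: 'k fps poly poly. p)" by (simp add: rhom_def)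
  fix s assume "s \<in> adj D uu" "poly s [:\<beta>:] = 0"
  thus "s = 0" using u_transcendental' unfolding adj_def by fastforce
qed (auto simp: vv_def rhom_poly)

text \<open>The elements \<open>1, u, v, uv\<close> form a basis of the \<open>U\<^sub>0\<close>-module \<open>U\<^sub>1\<close>.\<close>

lemma U0_independent:
  assumes "c1 \<in> U0" "c2 \<in> U0" "c3 \<in> U0" "c4 \<in> U0"
    and 0: "c1 + c2 * uu + c3 * vv + c4 * (uu * vv) = 0"
  shows "c1 = 0 \<and> c2 = 0 \<and> c3 = 0 \<and> c4 = 0"
proof -
  have "\<exists>A\<in>Polys (adj D ff). c = poly A gg" if "c \<in> U0" for c
    using that unfolding U0_def adj_def by blast
  from this[OF assms(1)] this[OF assms(2)] this[OF assms(3)] this[OF assms(4)]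
  obtain A1 A2 A3 A4 where A: "A1 \<in> Polys (adj D ff)" "A2 \<in> Polys (adj D ff)"
    "A3 \<in> Polys (adj D ff)" "A4 \<in> Polys (adj D ff)" and
    c: "c1 = poly A1 gg" "c2 = poly A2 gg" "c3 = poly A3 gg" "c4 = poly A4 gg" by blast
  have Du: "subrng (adj D uu)" by (intro subrng_adj subrng_D)
  have u: "uu \<in> adj D uu" by (intro adj_gen subrng_D)
  have "adj D ff \<subseteq> adj D uu"
    unfolding ff_def by (intro adj_minimal Du subrng_power u) (auto intro: adj_incl subrng_D)
  hence A': "A + smult uu B \<in> Polys (adj D uu)"
    if "A \<in> Polys (adj D ff)" "B \<in> Polys (adj D ff)" for A B
    using that unfolding Polys_def by (auto intro!: subrng_add[OF Du] subrng_mult[OF Du] u)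
  have "poly (A1 + smult uu A2) (vv\<^sup>2) + vv * poly (A3 + smult uu A4) (vv\<^sup>2) = 0"
    using 0 by (simp add: c gg_def algebra_simps)
  from parity[OF v_transcendental A'[OF A(1,2)] A'[OF A(3,4)] this]
  have *: "A1 + smult uu A2 = 0" "A3 + smult uu A4 = 0" by blast+
  have "A = 0 \<and> B = 0" if AB: "A \<in> Polys (adj D ff)" "B \<in> Polys (adj D ff)" "A + smult uu B = 0" for A B
  proof -
    have "coeff A i = 0 \<and> coeff B i = 0" for i
    proof -
      obtain p q where pq: "p \<in> Polys D" "q \<in> Polys D" "coeff A i = poly p ff" "coeff B i = poly q ff"
        using Polys_coeff[OF AB(1), of i] Polys_coeff[OF AB(2), of i] unfolding adj_def by blast
      have "coeff (A + smult uu B) i = 0" using AB(3) by simp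
      hence "poly p (uu\<^sup>2) + uu * poly q (uu\<^sup>2) = 0" using pq by (simp add: ff_def)
      from parity[OF u_transcendental pq(1,2) this] show ?thesis using pq by simp
    qed
    thus ?thesis by (simp add: poly_eq_iff)
  qed
  from this[OF A(1,2) *(1)] this[OF A(3,4) *(2)] show ?thesis by (simp add: c)
qed

lemma U1_span:
  assumes "h \<in> U1"
  obtains c1 c2 c3 c4 where "c1 \<in> U0" "c2 \<in> U0" "c3 \<in> U0" "c4 \<in> U0"
    "h = c1 + c2 * uu + c3 * vv + c4 * (uu * vv)"
proof -
  define W where "W = {c1 + c2 * uu + c3 * vv + c4 * (uu * vv) | c1 c2 c3 c4.
    c1 \<in> U0 \<and> c2 \<in> U0 \<and> c3 \<in> U0 \<and> c4 \<in> U0}"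
  have I: "c1 + c2 * uu + c3 * vv + c4 * (uu * vv) \<in> W"
    if "c1 \<in> U0" "c2 \<in> U0" "c3 \<in> U0" "c4 \<in> U0" for c1 c2 c3 c4 unfolding W_def using that by blast
  note cl = subrng_add[OF subrng_U0] subrng_mult[OF subrng_U0] subrng_diff[OF subrng_U0]
    subrng_0[OF subrng_U0] subrng_1[OF subrng_U0] ff_U0 gg_U0
  have U0W: "U0 \<subseteq> W" using I[of _ 0 0 0] cl by auto
  have "subrng W"
    unfolding subrng_def
  proof (intro conjI ballI)
    show "1 \<in> W" using U0W cl by blast
  next
    fix a b assume "a \<in> W" "b \<in> W"
    then obtain c1 c2 c3 c4 d1 d2 d3 d4 where *: "c1 \<in> U0" "c2 \<in> U0" "c3 \<in> U0" "c4 \<in> U0"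
      "a = c1 + c2 * uu + c3 * vv + c4 * (uu * vv)" "d1 \<in> U0" "d2 \<in> U0" "d3 \<in> U0" "d4 \<in> U0"
      "b = d1 + d2 * uu + d3 * vv + d4 * (uu * vv)" unfolding W_def by blast
    have "a - b = (c1 - d1) + (c2 - d2) * uu + (c3 - d3) * vv + (c4 - d4) * (uu * vv)"
      unfolding *(5,10) by (simp only: algebra_simps)
    also have "\<dots> \<in> W" using * by (intro I cl)
    finally show "a - b \<in> W" .
    have "a * b = (c1 * d1 + c2 * d2 * ff + c3 * d3 * gg + c4 * d4 * (ff * gg)) +
      (c1 * d2 + c2 * d1 + c3 * d4 * gg + c4 * d3 * gg) * uu +
      (c1 * d3 + c3 * d1 + c2 * d4 * ff + c4 * d2 * ff) * vv +
      (c1 * d4 + c4 * d1 + c2 * d3 + c3 * d2) * (uu * vv)"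
      unfolding *(5,10) ff_def gg_def power2_eq_square by (simp only: algebra_simps)
    also have "\<dots> \<in> W" using * by (intro I cl)
    finally show "a * b \<in> W" .
  qed
  moreover have "uu \<in> W" "vv \<in> W" using I[of 0 1 0 0] I[of 0 0 1 0] cl by auto
  ultimately have "U1 \<subseteq> W" unfolding U1_def using D_U0 U0W by (intro adj_minimal) auto
  thus thesis using that assms unfolding W_def by blast
qed

lemma TT_U1: "Polys (Polys T) \<subseteq> U1"
proof -
  note 0 = subrng_consts
  have 1: "subrng {t. [:[:t:]:] \<in> U1}" using 0[OF 0[OF subrng_U1]] by simp
  have y: "[:[:0, 1:]:] \<in> U1" and z: "[:0, 1:] \<in> U1" using y_D z_D D_U1 by blast+
  have "[:[:\<alpha>:]:] = [:[:0, 1:]:] - uu" "[:[:\<beta>:]:] = [:0, 1:] - vv" by (simp_all add: uu_def vv_def)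
  hence "[:[:\<alpha>:]:] \<in> U1" "[:[:\<beta>:]:] \<in> U1" using subrng_diff[OF subrng_U1] uu_U1 vv_U1 y z by metis+
  hence "T \<subseteq> {t. [:[:t:]:] \<in> U1}" unfolding T_def using D_const D_U1 by (intro adj_minimal 1) auto
  hence "Polys T \<subseteq> {c. [:c:] \<in> U1}" using y by (intro Polys_minimal 0[OF subrng_U1]) auto
  thus ?thesis using z by (intro Polys_minimal subrng_U1) auto
qed

lemma VV_clear:
  assumes "p \<in> VV" obtains t where "t \<in> T" "t \<noteq> 0" "[:[:t:]:] * p \<in> U1"
proof -
  have 1: "\<exists>t\<in>T. t \<noteq> 0 \<and> smult t c \<in> Polys T" if "c \<in> Polys V" for c
  proof (rule clear_denominators[OF _ _ _ _ _ that])
    fix s assume "s \<in> V"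
    thus "\<exists>t\<in>T. t \<noteq> 0 \<and> t * s \<in> T" unfolding V_def by (auto simp: mult.commute)
  qed (use subrng_closed[OF subrng_T] in auto)
  have 2: "\<exists>t\<in>(\<lambda>t. [:t:]) ` T. t \<noteq> 0 \<and> t * s \<in> Polys T" if "s \<in> Polys V" for s
    using 1[OF that] by fastforce
  have 3: "s * t \<in> Polys T" if "s \<in> (\<lambda>t. [:t:]) ` T" "t \<in> Polys T" for s t
    using that by (auto simp: Polys_def subrng_mult[OF subrng_T])
  have 4: "1 \<in> (\<lambda>t. [:t:]) ` T" using subrng_1[OF subrng_T] by (metis imageI one_pCons)
  have 5: "s * t \<in> (\<lambda>t. [:t:]) ` T" if "s \<in> (\<lambda>t. [:t:]) ` T" "t \<in> (\<lambda>t. [:t:]) ` T" for s t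
    using that subrng_mult[OF subrng_T] by (auto simp: mult.commute)
  have "\<exists>t\<in>(\<lambda>t. [:t:]) ` T. t \<noteq> 0 \<and> smult t p \<in> Polys (Polys T)"
    using clear_denominators[OF 4 5 Polys_0[OF subrng_T] 3 2] assms unfolding VV_def by blast
  then obtain t where "t \<in> T" "[:t:] \<noteq> 0" "smult [:t:] p \<in> Polys (Polys T)" by blast
  thus thesis using that[of t] TT_U1 by auto
qed

end

section \<open>The order along \<open>y = \<alpha>\<close>, \<open>z = \<beta>\<close>\<close>

text \<open>Powers of the ideal generated by two elements \<open>f\<close>, \<open>g\<close> of a subring \<open>S\<close>.\<close>

fun pw :: "'a::comm_ring_1 set \<Rightarrow> 'a \<Rightarrow> 'a \<Rightarrow> nat \<Rightarrow> 'a set" where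
  "pw S f g 0 = S"
| "pw S f g (Suc n) = {f * a + g * b | a b. a \<in> pw S f g n \<and> b \<in> pw S f g n}"

lemma pw_SucI: "a \<in> pw S f g n \<Longrightarrow> b \<in> pw S f g n \<Longrightarrow> f * a + g * b \<in> pw S f g (Suc n)"
  by auto

lemma pw_SucE:
  assumes "c \<in> pw S f g (Suc n)"
  obtains a b where "a \<in> pw S f g n" "b \<in> pw S f g n" "c = f * a + g * b"
  using assms by auto

lemma pw_diff: "subrng S \<Longrightarrow> a \<in> pw S f g n \<Longrightarrow> b \<in> pw S f g n \<Longrightarrow> a - b \<in> pw S f g n"
proof (induction n arbitrary: a b)
  case (Suc n)
  obtain a1 a2 b1 b2 where *: "a1 \<in> pw S f g n" "a2 \<in> pw S f g n" "a = f * a1 + g * a2"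
    "b1 \<in> pw S f g n" "b2 \<in> pw S f g n" "b = f * b1 + g * b2"
    using Suc.prems(2,3) by (metis pw_SucE)
  have "a - b = f * (a1 - b1) + g * (a2 - b2)" by (simp add: * algebra_simps)
  thus ?case using * Suc by (metis pw_SucI)
qed (simp add: subrng_diff)

lemma pw_0: "subrng S \<Longrightarrow> 0 \<in> pw S f g n"
proof (induction n)
  case (Suc n) thus ?case using pw_SucI[of 0 S f g n 0] by simp
qed (simp add: subrng_0)

lemma pw_add: "subrng S \<Longrightarrow> a \<in> pw S f g n \<Longrightarrow> b \<in> pw S f g n \<Longrightarrow> a + b \<in> pw S f g n"
  using pw_diff[of S a f g n "0 - b"] pw_diff[of S 0 f g n b] pw_0[of S f g n] by simp

lemma pw_smult: "subrng S \<Longrightarrow> s \<in> S \<Longrightarrow> a \<in> pw S f g n \<Longrightarrow> s * a \<in> pw S f g n"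
proof (induction n arbitrary: a)
  case (Suc n)
  obtain a1 a2 where *: "a1 \<in> pw S f g n" "a2 \<in> pw S f g n" "a = f * a1 + g * a2"
    using Suc.prems(3) by (metis pw_SucE)
  have "s * a = f * (s * a1) + g * (s * a2)" by (simp add: * algebra_simps)
  thus ?case using * Suc by (metis pw_SucI)
qed (simp add: subrng_mult)

lemma pw_sum: "subrng S \<Longrightarrow> (\<And>i. i \<in> I \<Longrightarrow> F i \<in> pw S f g n) \<Longrightarrow> (\<Sum>i\<in>I. F i) \<in> pw S f g n"
  by (induction I rule: infinite_finite_induct) (simp_all add: pw_0 pw_add)

lemma pw_f: "subrng S \<Longrightarrow> a \<in> pw S f g n \<Longrightarrow> f * a \<in> pw S f g (Suc n)"
  using pw_SucI[of a S f g n 0] pw_0[of S f g n] by simp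

lemma pw_g: "subrng S \<Longrightarrow> a \<in> pw S f g n \<Longrightarrow> g * a \<in> pw S f g (Suc n)"
  using pw_SucI[of 0 S f g n a] pw_0[of S f g n] by simp

lemma pw_mult:
  "subrng S \<Longrightarrow> a \<in> pw S f g n \<Longrightarrow> b \<in> pw S f g m \<Longrightarrow> a * b \<in> pw S f g (n + m)"
proof (induction n arbitrary: a)
  case (Suc n)
  obtain a1 a2 where *: "a1 \<in> pw S f g n" "a2 \<in> pw S f g n" "a = f * a1 + g * a2"
    using Suc.prems(2) by (metis pw_SucE)
  have "a * b = f * (a1 * b) + g * (a2 * b)" by (simp add: * algebra_simps)
  thus ?case using * Suc pw_SucI by (metis add_Suc)
qed (simp add: pw_smult)

lemma pw_in: "subrng S \<Longrightarrow> f \<in> S \<Longrightarrow> g \<in> S \<Longrightarrow> pw S f g n \<subseteq> S"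
  by (induction n) (auto intro!: subrng_add subrng_mult)

lemma pw_mono_Suc: "subrng S \<Longrightarrow> f \<in> S \<Longrightarrow> g \<in> S \<Longrightarrow> pw S f g (Suc n) \<subseteq> pw S f g n"
  by (auto intro!: pw_add pw_smult)

lemma pw_hom:
  assumes h: "rhom h" and "h ` S \<subseteq> S'"
  shows "a \<in> pw S f g n \<Longrightarrow> h a \<in> pw S' (h f) (h g) n"
proof (induction n arbitrary: a)
  case 0 thus ?case using assms(2) by auto
next
  case (Suc n)
  then obtain a1 a2 where "a1 \<in> pw S f g n" "a2 \<in> pw S f g n" "a = f * a1 + g * a2"
    by (metis pw_SucE)
  thus ?case using Suc.IH pw_SucI by (metis rhom_add[OF h] rhom_mult[OF h])
qed

context setting
begin

text \<open>The substitution \<open>u \<mapsto> XT\<close>, \<open>v \<mapsto> T\<close>: the order in \<open>T\<close> of the result is the \<open>(u,v)\<close>-adic order.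
  In the target, \<open>X\<close> is the inner variable and \<open>T\<close> the outer one.\<close>

definition tau :: "'k fps poly poly \<Rightarrow> 'k fps poly poly" where
  "tau = evh (evh (\<lambda>a. [:[:a:]:]) [:[:\<alpha>:], [:0, 1:]:]) [:[:\<beta>:], 1:]"

lemma rhom_const2: "rhom (\<lambda>a :: 'a::comm_ring_1. [:[:a:]:])"
  using rhom_comp[OF rhom_const_poly rhom_const_poly] .

lemma rhom_tau1: "rhom (evh (\<lambda>a. [:[:a:]:]) [:[:\<alpha>:], [:0, 1:]:])"
  by (intro rhom_evh rhom_const2)

lemma rhom_tau: "rhom tau"
  unfolding tau_def by (intro rhom_evh rhom_const2)

lemma tau_uu: "tau uu = [:[:0, 1:]:] * [:0, 1:]"
proof -
  have "tau uu = evh (\<lambda>a. [:[:a:]:]) [:[:\<alpha>:], [:0, 1:]:] [:- \<alpha>, 1:]"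
    unfolding tau_def uu_def by (rule evh_const[OF rhom_tau1])
  also have "\<dots> = [:[:- \<alpha>:]:] + [:[:\<alpha>:], [:0, 1:]:] * ([:[:1:]:] + [:[:\<alpha>:], [:0, 1:]:] * 0)"
    by (simp only: evh_pCons[OF rhom_const2] evh_0[OF rhom_const2])
  finally show ?thesis by simp
qed

lemma tau_vv: "tau vv = [:0, 1:]"
proof -
  have 1: "evh (\<lambda>a. [:[:a:]:]) [:[:\<alpha>:], [:0, 1:]:] 1 = (1 :: 'k fps poly poly)" by (rule rhom_1[OF rhom_tau1])
  have 2: "evh (\<lambda>a. [:[:a:]:]) [:[:\<alpha>:], [:0, 1:]:] [:- \<beta>:] = [:[:- \<beta>:]:]" by (rule evh_const[OF rhom_const2])
  have "tau vv = [:[:- \<beta>:]:] + [:[:\<beta>:], 1:] * (1 + [:[:\<beta>:], 1:] * 0)"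
    unfolding tau_def vv_def by (simp only: evh_pCons[OF rhom_tau1] evh_0[OF rhom_tau1] 1 2)
  thus ?thesis by simp
qed

lemma tau_at_0: "poly (tau p) 0 = [:sp p:]"
proof -
  have 1: "poly (evh (\<lambda>a. [:[:a:]:]) [:[:\<alpha>:], [:0, 1:]:] c) 0 = [:poly c \<alpha>:]" for c :: "'k fps poly"
    by (induction c) (simp_all add: evh_0 evh_pCons rhom_const2)
  show ?thesis
    by (induction p) (simp_all add: tau_def evh_0 evh_pCons rhom_tau1 1 sp_def)
qed

text \<open>Sending \<open>X\<close> to \<open>u/v\<close> and \<open>T\<close> to \<open>v\<close> gives a left inverse with values in a fraction field.\<close>

lemma tau_inj: assumes "tau p = 0" shows "p = 0"
proof -
  let ?ha = "\<lambda>a. to_fract [:[:a:]:] :: 'k fps poly poly fract"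
  let ?hb = "evh ?ha (Fract uu vv)"
  let ?hh = "evh ?hb (to_fract vv)"
  have h0: "rhom ?ha" using rhom_comp[OF rhom_const2 rhom_to_fract] .
  have h1: "rhom ?hb" by (rule rhom_evh[OF h0])
  have h: "rhom ?hh" by (rule rhom_evh[OF h1])
  have vv0: "vv \<noteq> 0" by (simp add: vv_def)
  have hc: "?hh [:[:a:]:] = to_fract [:[:a:]:]" for a
    using evh_const[OF h1] evh_const[OF h0] by metis
  have hT: "?hh [:0, 1:] = to_fract vv"
    by (simp only: evh_pCons[OF h1] evh_0[OF h1] rhom_0[OF h1] rhom_1[OF h1]) simp
  have "?hb [:0, 1:] = Fract uu vv"
    by (simp only: evh_pCons[OF h0] evh_0[OF h0]) (simp flip: one_pCons)
  hence hX: "?hh [:[:0, 1:]:] = Fract uu vv" using evh_const[OF h1] by metis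
  have e1: "?hh [:[:\<alpha>:], [:0, 1:]:] = to_fract [:[:0, 1:]:]"
  proof -
    have "[:[:\<alpha>:], [:0, 1:]:] = [:[:\<alpha>:]:] + [:[:0, 1:]:] * [:0, 1:]" by simp
    hence "?hh [:[:\<alpha>:], [:0, 1:]:] = to_fract [:[:\<alpha>:]:] + Fract uu vv * to_fract vv"
      by (simp only: rhom_add[OF h] rhom_mult[OF h] hc hX hT)
    also have "Fract uu vv * to_fract vv = to_fract uu"
      using vv0 by (simp add: to_fract_def eq_fract)
    also have "to_fract [:[:\<alpha>:]:] + to_fract uu = to_fract [:[:0, 1:]:]"
      by (simp add: uu_def flip: to_fract_add)
    finally show ?thesis .
  qed
  have e2: "?hh [:[:\<beta>:], 1:] = to_fract [:0, 1:]"
  proof -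
    have "[:[:\<beta>:], 1:] = [:[:\<beta>:]:] + [:0, 1 :: 'k fps poly:]" by simp
    hence "?hh [:[:\<beta>:], 1:] = to_fract [:[:\<beta>:]:] + to_fract vv" by (simp only: rhom_add[OF h] hc hT)
    also have "\<dots> = to_fract [:0, 1:]" by (simp add: vv_def flip: to_fract_add)
    finally show ?thesis .
  qed
  have 1: "?hh (evh (\<lambda>a. [:[:a:]:]) [:[:\<alpha>:], [:0, 1:]:] c) = to_fract [:c:]" for c :: "'k fps poly"
  proof (induction c)
    case 0 show ?case by (simp add: evh_0 rhom_const2 rhom_0[OF h])
  next
    case (pCons a c)
    have "?hh (evh (\<lambda>a. [:[:a:]:]) [:[:\<alpha>:], [:0, 1:]:] (pCons a c)) =
      to_fract [:[:a:]:] + to_fract [:[:0, 1:]:] * to_fract [:c:]"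
      by (simp only: evh_pCons[OF rhom_const2] rhom_add[OF h] rhom_mult[OF h] hc e1 pCons.IH)
    also have "\<dots> = to_fract [:pCons a c:]" by (simp flip: to_fract_add to_fract_mult)
    finally show ?case .
  qed
  have "?hh (tau p) = to_fract p" for p
  proof (induction p)
    case 0 show ?case by (simp add: rhom_0[OF rhom_tau] rhom_0[OF h])
  next
    case (pCons c p)
    have "?hh (tau (pCons c p)) = to_fract [:c:] + to_fract [:0, 1:] * to_fract p"
      using pCons.IH unfolding tau_def
      by (simp only: evh_pCons[OF rhom_tau1] rhom_add[OF h] rhom_mult[OF h] 1 e2)
    also have "\<dots> = to_fract (pCons c p)" by (simp flip: to_fract_add to_fract_mult)
    finally show ?case .
  qed
  from this[of p] show ?thesis using assms rhom_0[OF h] by simp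
qed

text \<open>The powers of \<open>(f,g)U\<^sub>0\<close>.\<close>

abbreviation J :: "nat \<Rightarrow> 'k fps poly poly set" where
  "J \<equiv> pw U0 ff gg"

lemma tau_ff: "tau ff = [:[:0, 1:]\<^sup>2:] * [:0, 1:]\<^sup>2" and tau_gg: "tau gg = [:0, 1:]\<^sup>2"
proof -
  have "tau ff = [:[:0, 1:]:]\<^sup>2 * [:0, 1:]\<^sup>2"
    unfolding ff_def rhom_power[OF rhom_tau] tau_uu by (rule power_mult_distrib)
  thus "tau ff = [:[:0, 1:]\<^sup>2:] * [:0, 1:]\<^sup>2" by (simp add: power2_eq_square)
  show "tau gg = [:0, 1:]\<^sup>2" unfolding gg_def rhom_power[OF rhom_tau] tau_vv ..
qed

lemma J_dvd: "b \<in> J n \<Longrightarrow> [:0, 1:] ^ (2 * n) dvd tau b"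
proof (induction n arbitrary: b)
  case (Suc n)
  from Suc.prems obtain a a' where *: "a \<in> J n" "a' \<in> J n" "b = ff * a + gg * a'" by (rule pw_SucE)
  have "[:0, 1:]\<^sup>2 dvd tau ff" "[:0, 1:]\<^sup>2 dvd tau gg" unfolding tau_ff tau_gg
    by (rule dvd_triv_right, simp)
  hence "[:0, 1:]\<^sup>2 * [:0, 1:] ^ (2 * n) dvd tau ff * tau a" "[:0, 1:]\<^sup>2 * [:0, 1:] ^ (2 * n) dvd tau gg * tau a'"
    using Suc.IH * by (blast intro: mult_dvd_mono)+
  hence "[:0, 1:]\<^sup>2 * [:0, 1:] ^ (2 * n) dvd tau b"
    unfolding * rhom_add[OF rhom_tau] rhom_mult[OF rhom_tau] by (rule dvd_add)
  moreover have "2 * Suc n = 2 + 2 * n" by simp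
  ultimately show ?case by (simp only: power_add)
qed simp

text \<open>Every element of \<open>(f,g)\<^sup>nU\<^sub>0\<close> is a form of degree \<open>n\<close> in \<open>f, g\<close> with coefficients in \<open>D\<close>, modulo
  \<open>(f,g)\<^sup>n\<^sup>+\<^sup>1U\<^sub>0\<close>.\<close>

lemma J_form:
  "b \<in> J n \<Longrightarrow> \<exists>d. (\<forall>i. d i \<in> D) \<and> (\<exists>r\<in>J (Suc n). b = (\<Sum>i\<le>n. d i * ff ^ i * gg ^ (n - i)) + r)"
proof (induction n arbitrary: b)
  case 0
  hence "b \<in> U0" by simp
  then obtain d h1 h2 where *: "d \<in> D" "h1 \<in> U0" "h2 \<in> U0" "b = d + ff * h1 + gg * h2"
    by (rule U0_cases)
  have "ff * h1 + gg * h2 \<in> J (Suc 0)" using * by (intro pw_SucI) simp_all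
  moreover have "b = (\<Sum>i\<le>0. d * ff ^ i * gg ^ (0 - i)) + (ff * h1 + gg * h2)" using * by (simp add: add.assoc)
  ultimately show ?case using *(1) by (intro exI[of _ "\<lambda>_. d"]) blast
next
  case (Suc n)
  from Suc.prems obtain a a' where *: "a \<in> J n" "a' \<in> J n" "b = ff * a + gg * a'" by (rule pw_SucE)
  obtain d r where d: "\<And>i. d i \<in> D" "r \<in> J (Suc n)" "a = (\<Sum>i\<le>n. d i * ff ^ i * gg ^ (n - i)) + r"
    using Suc.IH[OF *(1)] by blast
  obtain d' r' where d': "\<And>i. d' i \<in> D" "r' \<in> J (Suc n)" "a' = (\<Sum>i\<le>n. d' i * ff ^ i * gg ^ (n - i)) + r'"
    using Suc.IH[OF *(2)] by blast
  define e where "e i = (case i of 0 \<Rightarrow> 0 | Suc j \<Rightarrow> d j)" for i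
  define e' where "e' i = (if i \<le> n then d' i else 0)" for i
  have "e i + e' i \<in> D" for i using d(1) d'(1) subrng_0[OF subrng_D] subrng_add[OF subrng_D]
    by (simp add: e_def e'_def split: nat.splits)
  moreover have "ff * r + gg * r' \<in> J (Suc (Suc n))" using d d' by (intro pw_SucI)
  moreover have "(\<Sum>i\<le>Suc n. (e i + e' i) * ff ^ i * gg ^ (Suc n - i)) =
      (\<Sum>i\<le>Suc n. e i * ff ^ i * gg ^ (Suc n - i)) + (\<Sum>i\<le>Suc n. e' i * ff ^ i * gg ^ (Suc n - i))"
    by (simp only: distrib_right sum.distrib)
  moreover have "(\<Sum>i\<le>Suc n. e i * ff ^ i * gg ^ (Suc n - i)) = ff * (\<Sum>i\<le>n. d i * ff ^ i * gg ^ (n - i))"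
    by (simp add: sum.atMost_Suc_shift e_def sum_distrib_left algebra_simps del: sum.atMost_Suc)
  moreover have "(\<Sum>i\<le>Suc n. e' i * ff ^ i * gg ^ (Suc n - i)) = gg * (\<Sum>i\<le>n. d' i * ff ^ i * gg ^ (n - i))"
  proof -
    have "(\<Sum>i\<le>n. e' i * ff ^ i * gg ^ (Suc n - i)) = (\<Sum>i\<le>n. gg * (d' i * ff ^ i * gg ^ (n - i)))"
      by (intro sum.cong) (auto simp: e'_def Suc_diff_le)
    thus ?thesis by (simp add: e'_def sum_distrib_left)
  qed
  ultimately have "b = (\<Sum>i\<le>Suc n. (e i + e' i) * ff ^ i * gg ^ (Suc n - i)) + (ff * r + gg * r')"
    unfolding * d d' by (simp only: distrib_left add_ac)
  thus ?case using \<open>\<And>i. e i + e' i \<in> D\<close> \<open>ff * r + gg * r' \<in> J (Suc (Suc n))\<close>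
    by (intro exI[of _ "\<lambda>i. e i + e' i"]) blast
qed

text \<open>The order of an element of \<open>U\<^sub>0\<close> is at least \<open>2n\<close> iff the element lies in \<open>(f,g)\<^sup>nU\<^sub>0\<close>: the
  leading form \<open>\<Sum> d\<^sub>i f\<^sup>i g\<^sup>n\<^sup>-\<^sup>i\<close> is mapped to \<open>T\<^sup>2\<^sup>n \<Sum> d\<^sub>i(\<alpha>,\<beta>) X\<^sup>2\<^sup>i\<close> up to higher order, and
  \<open>d\<^sub>i(\<alpha>,\<beta>) \<noteq> 0\<close> unless \<open>d\<^sub>i = 0\<close>.\<close>

lemma dvd_J: "b \<in> U0 \<Longrightarrow> [:0, 1:] ^ (2 * n) dvd tau b \<Longrightarrow> b \<in> J n"
proof (induction n)
  case (Suc n)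
  let ?t = "[:0, 1:] :: 'k fps poly poly"
  have t0: "?t ^ (2 * n) \<noteq> 0" by simp
  have "?t ^ (2 * n) dvd ?t ^ (2 * Suc n)" by (rule le_imp_power_dvd) simp
  hence "b \<in> J n" using Suc by (meson dvd_trans)
  then obtain d r where d: "\<And>i. d i \<in> D" "r \<in> J (Suc n)" "b = (\<Sum>i\<le>n. d i * ff ^ i * gg ^ (n - i)) + r"
    using J_form by blast
  define Y where "Y = (\<Sum>i\<le>n. tau (d i) * [:[:0, 1:] ^ (2 * i):])"
  have "tau (d i * ff ^ i * gg ^ (n - i)) = ?t ^ (2 * n) * (tau (d i) * [:[:0, 1:] ^ (2 * i):])"
    if "i \<le> n" for i
  proof -
    have "[:a:] ^ i = [:a ^ i:]" for a :: "'k fps poly" by (induction i) (simp_all add: mult.commute)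
    hence "tau ff ^ i = [:[:0, 1:] ^ (2 * i):] * ?t ^ (2 * i)"
      unfolding tau_ff by (simp only: power_mult_distrib power_mult)
    moreover have "tau gg ^ (n - i) = ?t ^ (2 * (n - i))" unfolding tau_gg by (simp only: power_mult)
    moreover have "?t ^ (2 * n) = ?t ^ (2 * i) * ?t ^ (2 * (n - i))"
      using that by (simp flip: power_add add: algebra_simps)
    ultimately show ?thesis by (simp only: rhom_mult[OF rhom_tau] rhom_power[OF rhom_tau] mult_ac)
  qed
  hence "(\<Sum>i\<le>n. tau (d i * ff ^ i * gg ^ (n - i))) = ?t ^ (2 * n) * Y"
    unfolding Y_def sum_distrib_left by (intro sum.cong) auto
  hence "tau b = ?t ^ (2 * n) * Y + tau r"
    unfolding d(3) by (simp only: rhom_add[OF rhom_tau] rhom_sum[OF rhom_tau])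
  hence "?t ^ (2 * n) * Y = tau b - tau r" by simp
  hence "?t ^ (2 * Suc n) dvd ?t ^ (2 * n) * Y" using dvd_diff[OF Suc.prems(2) J_dvd[OF d(2)]] by simp
  moreover have "?t ^ (2 * Suc n) = ?t ^ (2 * n) * ?t\<^sup>2" by (simp add: power_add mult_ac power2_eq_square)
  ultimately have "?t\<^sup>2 dvd Y" using t0 by (metis dvd_mult_cancel_left)
  hence "?t dvd Y" by (metis dvd_mult_left power2_eq_square)
  hence "poly Y 0 = 0" by auto
  moreover have "poly Y 0 = (\<Sum>i\<le>n. monom (sp (d i)) (2 * i))"
    unfolding Y_def by (simp add: poly_sum tau_at_0 monom_altdef)
  ultimately have 0: "(\<Sum>i\<le>n. monom (sp (d i)) (2 * i)) = 0" by simp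
  have "d j = 0" if "j \<le> n" for j
  proof -
    have "0 = coeff (\<Sum>i\<le>n. monom (sp (d i)) (2 * i)) (2 * j)" unfolding 0 by simp
    also have "\<dots> = (\<Sum>i\<le>n. if i = j then sp (d i) else 0)"
      unfolding coeff_sum by (intro sum.cong) auto
    also have "\<dots> = sp (d j)" using that by simp
    finally show ?thesis using D_sp d(1) by metis
  qed
  hence "b = r" unfolding d(3) by simp
  thus ?case using d by simp
qed simp

text \<open>The \<open>(u,v)\<close>-adic order, meaningful for nonzero arguments; the value at \<open>0\<close> is never used.\<close>

definition ordr :: "'k fps poly poly \<Rightarrow> nat" where
  "ordr p = order 0 (tau p)"

lemma ordr_mult: "p \<noteq> 0 \<Longrightarrow> q \<noteq> 0 \<Longrightarrow> ordr (p * q) = ordr p + ordr q"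
  unfolding ordr_def rhom_mult[OF rhom_tau] using tau_inj by (intro order_mult) auto

lemma ordr_power: "p \<noteq> 0 \<Longrightarrow> ordr (p ^ n) = n * ordr p"
proof (induction n)
  case 0 show ?case by (simp add: ordr_def rhom_1[OF rhom_tau])
next
  case (Suc n) thus ?case by (simp add: ordr_mult)
qed

lemma ordr_le_iff: "p \<noteq> 0 \<Longrightarrow> [:0, 1:] ^ n dvd tau p \<longleftrightarrow> n \<le> ordr p"
  unfolding ordr_def using tau_inj[of p] order_divides[of 0 n "tau p"] by auto

lemma ordr_J: "b \<in> U0 \<Longrightarrow> b \<noteq> 0 \<Longrightarrow> b \<in> J n \<longleftrightarrow> 2 * n \<le> ordr b"
  using dvd_J[of b n] J_dvd[of b n] ordr_le_iff[of b "2 * n"] by blast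

lemma ordr_eq_0: assumes "b \<in> U0" "b \<notin> J 1" shows "b \<noteq> 0" "ordr b = 0"
proof -
  show b0: "b \<noteq> 0" using assms pw_0[OF subrng_U0] by blast
  obtain d h1 h2 where *: "d \<in> D" "h1 \<in> U0" "h2 \<in> U0" "b = d + ff * h1 + gg * h2"
    using assms U0_cases by metis
  have "poly (tau b) 0 \<noteq> 0"
  proof
    assume "poly (tau b) 0 = 0"
    moreover have "poly (tau b) 0 = [:sp d:]"
      unfolding * rhom_add[OF rhom_tau] rhom_mult[OF rhom_tau] tau_ff tau_gg
      by (simp add: tau_at_0)
    ultimately have "d = 0" using D_sp * by simp
    hence "b \<in> J 1" using pw_SucI[of h1 U0 ff gg 0 h2] * by simp
    thus False using assms by blast
  qed
  thus "ordr b = 0" unfolding ordr_def by (rule order_0I)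
qed

end

section \<open>The ring \<open>A\<close>\<close>

lemma inv_ring_of_type_algebra:
  fixes a :: "'a::field" assumes "a \<noteq> 0" shows "inv\<^bsub>ring_of_type_algebra\<^esub> a = inverse a"
proof -
  interpret F: field "ring_of_type_algebra :: 'a ring" by (rule field_from_type_algebra)
  show ?thesis
    by (rule F.comm_inv_char) (use assms in \<open>auto simp: ring_of_type_algebra_def\<close>)
qed

lemma minus_ring_of_type_algebra: "\<ominus>\<^bsub>ring_of_type_algebra\<^esub> a = - (a :: 'a::comm_ring_1)"
proof -
  interpret F: cring "ring_of_type_algebra :: 'a ring" by (rule cring_from_type_algebra)
  show ?thesis
    by (rule F.minus_equality) (auto simp: ring_of_type_algebra_def)
qed

lemma generate_field_closed:
  fixes H :: "'a::field set"
  defines "K \<equiv> generate_field ring_of_type_algebra H"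
  shows "subrng K" and "a \<in> K \<Longrightarrow> inverse a \<in> K" and "H \<subseteq> K"
proof -
  have neg: "- a \<in> K" if "a \<in> K" for a
    using generate_field.a_inv[OF that[unfolded K_def]] by (simp add: minus_ring_of_type_algebra K_def)
  have add: "a + b \<in> K" if "a \<in> K" "b \<in> K" for a b
    using generate_field.eng_add[OF that[unfolded K_def]] by (simp add: K_def ring_of_type_algebra_def)
  have mult: "a * b \<in> K" if "a \<in> K" "b \<in> K" for a b
    using generate_field.eng_mult[OF that[unfolded K_def]] by (simp add: K_def ring_of_type_algebra_def)
  have one: "1 \<in> K"
    using generate_field.one[of ring_of_type_algebra H] by (simp add: K_def ring_of_type_algebra_def)
  show S: "subrng K" unfolding subrng_def
    using one mult add[OF _ neg] by simp
  show "H \<subseteq> K" unfolding K_def by (auto intro: generate_field.incl)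
  assume a: "a \<in> K"
  show "inverse a \<in> K"
  proof (cases "a = 0")
    case True thus ?thesis using subrng_0[OF S] by simp
  next
    case False
    hence "a \<noteq> \<zero>\<^bsub>ring_of_type_algebra\<^esub>" by (simp add: ring_of_type_algebra_def)
    from generate_field.m_inv[OF a[unfolded K_def] this] show ?thesis
      by (simp add: inv_ring_of_type_algebra[OF False] K_def)
  qed
qed

context setting
begin

text \<open>\<open>K = k(x,y,z,f,g)\<close> and \<open>A = K \<inter> R\<^sup>*\<close>, as sets.\<close>

definition K :: "'k kyzx set" where
  "K = field_kxyzfg \<alpha> \<beta>"

definition A :: "'k kyzx set" where
  "A = K \<inter> R_star"

lemma subrng_K: "subrng K" and K_inverse: "a \<in> K \<Longrightarrow> inverse a \<in> K"
  and K_incl: "range (\<lambda>c. fls_const (const_yz c)) \<union> {x_el, y_el, z_el, f_el \<alpha>, g_el \<beta>} \<subseteq> K"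
  unfolding K_def field_kxyzfg_def
  by (rule generate_field_closed(1), erule generate_field_closed(2), rule generate_field_closed(3))

lemma K_divide: "a \<in> K \<Longrightarrow> b \<in> K \<Longrightarrow> a / b \<in> K"
  by (simp add: divide_inverse subrng_mult[OF subrng_K] K_inverse)

lemma subrng_A: "subrng A"
  using subrng_K subrng_R_star unfolding A_def subrng_def by auto

lemma emb_uu: "emb uu = y_el - series_el \<alpha>"
proof -
  have "uu = [:[:0, 1:]:] - [:[:\<alpha>:]:]" by (simp add: uu_def)
  thus ?thesis by (simp only: emb_simps(6) emb_y emb_const)
qed

lemma emb_vv: "emb vv = z_el - series_el \<beta>"
proof -
  have "vv = [:0, 1:] - [:[:\<beta>:]:]" by (simp add: vv_def)
  thus ?thesis by (simp only: emb_simps(6) emb_z emb_const)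
qed

lemma emb_ff: "emb ff = f_el \<alpha>" and emb_gg: "emb gg = g_el \<beta>"
  unfolding ff_def gg_def f_el_def g_el_def emb_simps(7) emb_uu emb_vv by (rule refl)+

lemma emb_D_K: "d \<in> D \<Longrightarrow> emb d \<in> K"
proof -
  have K: "subrng {p. emb p \<in> K}"
    using subrng_1[OF subrng_K] subrng_diff[OF subrng_K] subrng_mult[OF subrng_K]
    unfolding subrng_def by (simp add: emb_simps)
  have "series_el (fps_of_poly p) \<in> K" for p
  proof (induction p)
    case 0
    show ?case using subrng_0[OF subrng_K] by (simp add: rhom_0[OF rhom_series_el])
  next
    case (pCons a p)
    have "fps_of_poly (pCons a p) = fps_const a + fps_X * fps_of_poly p"
      by (simp add: fps_of_poly_pCons mult.commute)
    hence eq: "series_el (fps_of_poly (pCons a p)) = fls_const (const_yz a) + x_el * series_el (fps_of_poly p)"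
      by (simp only: rhom_simps[OF rhom_series_el] series_el_const series_el_X)
    show ?case unfolding eq using K_incl pCons
      by (intro subrng_add[OF subrng_K] subrng_mult[OF subrng_K]) auto
  qed
  hence "D \<subseteq> {p. emb p \<in> K}"
    by (intro D_minimal K) (use K_incl in \<open>auto simp: emb_const emb_y emb_z kx_def\<close>)
  thus "d \<in> D \<Longrightarrow> emb d \<in> K" by blast
qed

lemma f_K: "f_el \<alpha> \<in> K" and g_K: "g_el \<beta> \<in> K" and x_K: "x_el \<in> K"
  using K_incl by auto

lemma emb_U0_K: "h \<in> U0 \<Longrightarrow> emb h \<in> K"
proof -
  have K: "subrng {p. emb p \<in> K}"
    using subrng_1[OF subrng_K] subrng_diff[OF subrng_K] subrng_mult[OF subrng_K]
    unfolding subrng_def by (simp add: emb_simps)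
  hence "U0 \<subseteq> {p. emb p \<in> K}" unfolding U0_def
    by (intro adj_minimal) (auto simp: emb_D_K emb_ff emb_gg f_K g_K)
  thus "h \<in> U0 \<Longrightarrow> emb h \<in> K" by blast
qed

lemma emb_U0_A: "emb ` U0 \<subseteq> A"
  using emb_U0_K emb_R_star unfolding A_def by blast

lemma f_A: "f_el \<alpha> \<in> A" and g_A: "g_el \<beta> \<in> A"
  using emb_U0_A ff_U0 gg_U0 emb_ff emb_gg by (metis image_subset_iff)+

lemma x_A: "x_el \<in> A"
  using x_K x_R_star by (simp add: A_def)

lemma const_A: assumes "r \<in> loc_yz" shows "fls_const r \<in> A"
proof -
  from assms obtain c d where *: "unitc (cf 0 d)" "fls_const r = emb c / emb d"
    "c \<in> Polys (Polys (range fps_const))" "d \<in> Polys (Polys (range fps_const))"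
    by (rule fls_const_emb)
  have "Polys (Polys (range fps_const)) \<subseteq> D" unfolding D_def
    by (intro Polys_mono) (use const_kx in blast)
  hence "fls_const r \<in> K" unfolding *(2) using *(3,4) by (intro K_divide emb_D_K) auto
  thus ?thesis using const_R_star[OF assms] by (simp add: A_def)
qed

lemma A_div_x: assumes "a \<in> K" "a = x_el * r" "r \<in> R_star" shows "r \<in> A"
proof -
  have "r = a / x_el" unfolding assms(2) by (simp only: nonzero_mult_div_cancel_left[OF x_el_nz])
  thus ?thesis using K_divide[OF assms(1) x_K] assms(3) by (simp add: A_def)
qed

lemma A_nth_0: "a \<in> A \<Longrightarrow> fls_nth a 0 \<in> loc_yz"
  using R_star_nth[of a 0] by (simp add: A_def)

lemma A_tail: assumes "a \<in> A" shows "\<exists>a'\<in>A. a = fls_const (fls_nth a 0) + x_el * a'"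
proof -
  obtain r where r: "r \<in> R_star" "a = fls_const (fls_nth a 0) + x_el * r"
    using R_star_tail[of a] assms unfolding A_def by blast
  have "a - fls_const (fls_nth a 0) \<in> A"
    by (intro subrng_diff[OF subrng_A] const_A A_nth_0 assms)
  hence "a - fls_const (fls_nth a 0) \<in> K" by (simp add: A_def)
  moreover have "a - fls_const (fls_nth a 0) = x_el * r" using r(2) by (metis add_diff_cancel_left')
  ultimately have "r \<in> A" using r(1) by (rule A_div_x)
  thus ?thesis using r(2) by blast
qed

lemma A_div_x': "a \<in> A \<Longrightarrow> fls_nth a 0 = 0 \<Longrightarrow> \<exists>a'\<in>A. a = x_el * a'"
  using A_tail[of a] by auto

lemma A_unit: assumes a: "a \<in> A" and p: "fls_nth a 0 = Fract p q" "unitc p" "unitc q"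
  shows "a \<noteq> 0" "inverse a \<in> A"
  using R_star_inverse[of a p q] assms K_inverse by (auto simp: A_def)

lemma K_fraction: assumes "a \<in> K" obtains p q where "p \<in> U0" "q \<in> U0" "q \<noteq> 0" "a * emb q = emb p"
proof -
  define Q where "Q = {a. \<exists>p\<in>U0. \<exists>q\<in>U0. q \<noteq> 0 \<and> a * emb q = emb p}"
  note cl = subrng_add[OF subrng_U0] subrng_mult[OF subrng_U0] subrng_minus[OF subrng_U0]
  have emb_Q: "emb p \<in> Q" if "p \<in> U0" for p
  proof -
    have "emb p * emb 1 = emb p" "(1 :: 'k fps poly poly) \<noteq> 0" by (simp_all add: emb_simps)
    thus ?thesis unfolding Q_def using that subrng_1[OF subrng_U0] by blast
  qed
  have "a \<in> Q"
    using assms unfolding K_def field_kxyzfg_def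
  proof (induction rule: generate_field.induct)
    case one
    show ?case using emb_Q[OF subrng_1[OF subrng_U0]] by (simp add: emb_simps ring_of_type_algebra_def)
  next
    case (incl h)
    have 1: "fls_const (const_yz c) \<in> Q" for c
      using emb_Q[of "[:[:fps_const c:]:]"] D_const[OF const_kx] D_U0 by (auto simp: emb_const series_el_const)
    have 2: "x_el \<in> Q" using emb_Q[of "[:[:fps_X:]:]"] D_const[OF X_kx] D_U0 by (auto simp: emb_const series_el_X)
    have 3: "y_el \<in> Q" "z_el \<in> Q" using emb_Q y_D z_D D_U0 emb_y emb_z by (metis subsetD)+
    have 4: "f_el \<alpha> \<in> Q" "g_el \<beta> \<in> Q" using emb_Q ff_U0 gg_U0 emb_ff emb_gg by metis+
    show ?case using incl 1 2 3 4 by blast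
  next
    case (a_inv a)
    then obtain p q where *: "p \<in> U0" "q \<in> U0" "q \<noteq> 0" "a * emb q = emb p" unfolding Q_def by blast
    have "- a * emb q = emb (- p)" using * by (simp add: emb_simps)
    thus ?case unfolding Q_def minus_ring_of_type_algebra using * cl by blast
  next
    case (m_inv a)
    then obtain p q where *: "p \<in> U0" "q \<in> U0" "q \<noteq> 0" "a * emb q = emb p" unfolding Q_def by blast
    have a: "a \<noteq> 0" using m_inv by (simp add: ring_of_type_algebra_def)
    hence "p \<noteq> 0" using * emb_nz[of q] by (auto simp: emb_simps)
    moreover have "inverse a * emb p = emb q" using *(4) a by (simp add: field_simps)
    ultimately show ?case unfolding Q_def inv_ring_of_type_algebra[OF a] using * by blast
  next
    case (eng_add a b)
    then obtain p q p' q' where *: "p \<in> U0" "q \<in> U0" "q \<noteq> 0" "a * emb q = emb p"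
      "p' \<in> U0" "q' \<in> U0" "q' \<noteq> 0" "b * emb q' = emb p'" unfolding Q_def by blast
    have "(a + b) * emb (q * q') = emb (p * q' + p' * q)"
      unfolding emb_simps *(4,8)[symmetric] by (simp add: algebra_simps)
    moreover have "p * q' + p' * q \<in> U0" "q * q' \<in> U0" "q * q' \<noteq> 0" using * cl by auto
    ultimately have "a + b \<in> Q" unfolding Q_def by blast
    thus ?case by (simp add: ring_of_type_algebra_def)
  next
    case (eng_mult a b)
    then obtain p q p' q' where *: "p \<in> U0" "q \<in> U0" "q \<noteq> 0" "a * emb q = emb p"
      "p' \<in> U0" "q' \<in> U0" "q' \<noteq> 0" "b * emb q' = emb p'" unfolding Q_def by blast
    have "(a * b) * emb (q * q') = emb (p * p')"
      unfolding emb_simps *(4,8)[symmetric] by (simp add: algebra_simps)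
    moreover have "p * p' \<in> U0" "q * q' \<in> U0" "q * q' \<noteq> 0" using * cl by auto
    ultimately have "a * b \<in> Q" unfolding Q_def by blast
    thus ?case by (simp add: ring_of_type_algebra_def)
  qed
  thus thesis using that unfolding Q_def by blast
qed

lemma U0_VV: "U0 \<subseteq> VV"
proof -
  have kV: "kx \<subseteq> V" using kx_T T_V by blast
  hence DV: "D \<subseteq> VV" unfolding D_def VV_def by (intro Polys_mono)
  have aT: "\<alpha> \<in> V" "\<beta> \<in> V" unfolding T_def using T_V adj_incl adj_gen subrng_adj subrng_kx
    by (metis T_def subsetD)+
  have "uu = [:[:0, 1:]:] - [:[:\<alpha>:]:]" "vv = [:0, 1:] - [:[:\<beta>:]:]" by (simp_all add: uu_def vv_def)
  moreover have "[:[:0, 1:]:] - [:[:\<alpha>:]:] \<in> VV" "[:0, 1:] - [:[:\<beta>:]:] \<in> VV"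
    by (intro subrng_diff[OF subrng_VV] VV_const aT subsetD[OF DV] y_D z_D)+
  ultimately have "uu \<in> VV" "vv \<in> VV" by simp_all
  thus ?thesis unfolding U0_def ff_def gg_def using DV
    by (intro adj_minimal subrng_VV subrng_power) auto
qed

lemma A_N: "A \<subseteq> N"
proof
  fix a assume a: "a \<in> A"
  hence "a \<in> K" by (simp add: A_def)
  then obtain p q where "p \<in> U0" "q \<in> U0" "q \<noteq> 0" "a * emb q = emb p" by (rule K_fraction)
  thus "a \<in> N" using U0_VV a by (intro fraction_in_N[of p q]) (auto simp: A_def)
qed

text \<open>\<open>A\<close> and \<open>R\<^sup>*\<close> have the same \<open>x\<close>-adic completion.\<close>

lemma R_star_approx: "r \<in> R_star \<Longrightarrow> \<exists>a\<in>A. \<exists>r'\<in>R_star. r = a + x_el ^ n * r'"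
proof (induction n)
  case 0
  thus ?case using subrng_0[OF subrng_A] by (intro bexI[of _ 0] bexI[of _ r]) auto
next
  case (Suc n)
  then obtain a r' where *: "a \<in> A" "r' \<in> R_star" "r = a + x_el ^ n * r'" by blast
  obtain r'' where r'': "r'' \<in> R_star" "r' = fls_const (fls_nth r' 0) + x_el * r''"
    using R_star_tail[OF *(2)] by blast
  have "fls_nth r' 0 \<in> loc_yz" using R_star_nth[OF *(2), of 0] by simp
  hence "a + x_el ^ n * fls_const (fls_nth r' 0) \<in> A"
    by (intro subrng_add[OF subrng_A] subrng_mult[OF subrng_A] subrng_power[OF subrng_A] const_A x_A *)
  moreover have "r = (a + x_el ^ n * fls_const (fls_nth r' 0)) + x_el ^ Suc n * r''"
    unfolding *(3) by (subst r''(2)) (simp add: algebra_simps)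
  ultimately show ?case using r''(1) by blast
qed

text \<open>The ideal of denominators in \<open>U\<^sub>0\<close> of an element \<open>a\<close> of \<open>A\<close> contains a power of \<open>x\<close> after extension
  to \<open>A\<close>. A denominator in \<open>N\<close> that is a unit of \<open>R\<^sup>*\<close> is multiplied into \<open>U\<^sub>1\<close>, and its
  coordinates with respect to the basis \<open>1, u, v, uv\<close> are denominators in \<open>U\<^sub>0\<close>, because \<open>a\<close> lies in \<open>K\<close>.\<close>

lemma A_denominators:
  assumes a: "a \<in> A"
  obtains C r s where "finite C" "C \<subseteq> U0" "\<forall>c\<in>C. \<exists>b\<in>U0. a * emb c = emb b"
    "\<forall>c. r c \<in> A" "x_el ^ s = (\<Sum>c\<in>C. emb c * r c)"
proof -
  have "a \<in> K" using a by (simp add: A_def)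
  then obtain p q where pq: "p \<in> U0" "q \<in> U0" "q \<noteq> 0" "a * emb q = emb p" by (rule K_fraction)
  have "a \<in> N" using A_N a by blast
  then obtain b c where bc: "b \<in> VV" "c \<in> VV" "unitc (cf 0 c)" "emb c \<noteq> 0" "a = emb b / emb c"
    by (rule N_cases)
  obtain t1 where t1: "t1 \<in> T" "t1 \<noteq> 0" "[:[:t1:]:] * b \<in> U1" using bc(1) by (rule VV_clear)
  obtain t2 where t2: "t2 \<in> T" "t2 \<noteq> 0" "[:[:t2:]:] * c \<in> U1" using bc(2) by (rule VV_clear)
  define t where "t = t1 * t2"
  have TU: "[:[:t:]:] \<in> U1" if "t \<in> T" for t
    using TT_U1 that by (auto simp: Polys_pCons Polys_0 subrng_Polys subrng_T)
  have "[:[:t:]:] * b = [:[:t2:]:] * ([:[:t1:]:] * b)" "[:[:t:]:] * c = [:[:t1:]:] * ([:[:t2:]:] * c)"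
    by (simp_all add: t_def mult_ac)
  hence tb: "[:[:t:]:] * b \<in> U1" and tc: "[:[:t:]:] * c \<in> U1"
    using subrng_mult[OF subrng_U1] TU t1 t2 by metis+
  obtain b1 b2 b3 b4 where b: "b1 \<in> U0" "b2 \<in> U0" "b3 \<in> U0" "b4 \<in> U0"
    "[:[:t:]:] * b = b1 + b2 * uu + b3 * vv + b4 * (uu * vv)" using tb by (rule U1_span)
  obtain c1 c2 c3 c4 where c: "c1 \<in> U0" "c2 \<in> U0" "c3 \<in> U0" "c4 \<in> U0"
    "[:[:t:]:] * c = c1 + c2 * uu + c3 * vv + c4 * (uu * vv)" using tc by (rule U1_span)
  have "a * emb c = emb b" using bc(4,5) by simp
  have "emb (c * p) = emb c * (a * emb q)" by (simp add: emb_simps pq(4))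
  also have "\<dots> = (a * emb c) * emb q" by (simp only: mult_ac)
  also have "\<dots> = emb (b * q)" unfolding \<open>a * emb c = emb b\<close> by (simp add: emb_simps)
  finally have "emb (c * p) = emb (b * q)" .
  hence cp: "c * p = b * q" by (rule emb_inj)
  have "(c1 * p - b1 * q) + (c2 * p - b2 * q) * uu + (c3 * p - b3 * q) * vv + (c4 * p - b4 * q) * (uu * vv)
    = ([:[:t:]:] * c) * p - ([:[:t:]:] * b) * q" unfolding b(5) c(5) by (simp only: algebra_simps)
  also have "\<dots> = [:[:t:]:] * (c * p) - [:[:t:]:] * (b * q)" by (simp only: mult.assoc)
  also have "\<dots> = 0" by (simp only: cp diff_self)
  finally have 0: "(c1 * p - b1 * q) + (c2 * p - b2 * q) * uu + (c3 * p - b3 * q) * vv +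
    (c4 * p - b4 * q) * (uu * vv) = 0" .
  have "c1 * p - b1 * q = 0 \<and> c2 * p - b2 * q = 0 \<and> c3 * p - b3 * q = 0 \<and> c4 * p - b4 * q = 0"
    by (rule U0_independent[OF _ _ _ _ 0])
      (auto intro!: subrng_diff[OF subrng_U0] subrng_mult[OF subrng_U0] b c pq)
  hence cpi: "c1 * p = b1 * q" "c2 * p = b2 * q" "c3 * p = b3 * q" "c4 * p = b4 * q" by simp_all
  have den: "a * emb c' = emb b'" if "c' * p = b' * q" for b' c'
  proof -
    have "a * emb c' * emb q = emb c' * emb p" using pq(4) by (metis mult.assoc mult.commute)
    also have "\<dots> = emb b' * emb q" using that by (metis emb_simps(3))
    finally show ?thesis using emb_nz[OF pq(3)] by simp
  qed
  \<comment> \<open>The denominator is a power of \<open>x\<close> times a unit of \<open>R\<^sup>*\<close>.\<close>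
  have t0: "t \<noteq> 0" using t1 t2 by (simp add: t_def)
  define s where "s = subdegree t"
  define t' where "t' = unit_factor t"
  have tt': "t = fps_X ^ s * t'" unfolding s_def t'_def by (rule fps_unit_factor_decompose')
  have t'0: "fps_nth t' 0 \<noteq> 0" using t0 by (simp add: t'_def)
  have "cf 0 ([:[:t':]:] * c) = [:[:fps_nth t' 0:]:] * cf 0 c"
    unfolding cf0_mult by (simp add: cf_def map_poly_pCons)
  hence u: "unitc (cf 0 ([:[:t':]:] * c))" using t'0 bc(3) by (simp add: unitc_def)
  define w where "w = inverse (emb ([:[:t':]:] * c))"
  have w: "w \<in> R_star" "emb ([:[:t':]:] * c) * w = 1" unfolding w_def using emb_inverse[OF u] by simp_all
  have "[:[:t:]:] * c = [:[:fps_X:]:] ^ s * ([:[:t':]:] * c)"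
  proof -
    have "[:[:fps_X :: 'k fps:]:] ^ s = [:[:fps_X ^ s:]:]"
      by (induction s) (simp_all add: mult.commute one_pCons)
    thus ?thesis by (simp add: tt')
  qed
  hence "emb ([:[:t:]:] * c) = x_el ^ s * emb ([:[:t':]:] * c)" by (metis emb_simps(3,7) x_eq_emb)
  hence xs: "x_el ^ s = emb ([:[:t:]:] * c) * w" using w(2) by (simp add: mult.assoc)
  define Cs where "Cs = [(c1, 1), (c2, uu), (c3, vv), (c4, uu * vv)]"
  have "emb ([:[:t:]:] * c) = emb c1 + emb c2 * emb uu + emb c3 * emb vv + emb c4 * emb (uu * vv)"
    unfolding c(5) by (simp only: emb_simps)
  hence "x_el ^ s = emb c1 * w + emb c2 * (emb uu * w) + emb c3 * (emb vv * w) + emb c4 * (emb (uu * vv) * w)"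
    unfolding xs by (simp add: algebra_simps)
  moreover have "\<exists>a\<in>A. \<exists>r\<in>R_star. emb e * w = a + x_el ^ Suc s * r" for e
    by (intro R_star_approx subrng_mult[OF subrng_R_star] emb_R_star w)
  then obtain av rv where av: "\<And>e. av e \<in> A" "\<And>e. rv e \<in> R_star"
    "\<And>e. emb e * w = av e + x_el ^ Suc s * rv e" by metis
  ultimately have xs1: "x_el ^ s = emb c1 * av 1 + emb c2 * av uu + emb c3 * av vv + emb c4 * av (uu * vv) +
    x_el ^ Suc s * (emb c1 * rv 1 + emb c2 * rv uu + emb c3 * rv vv + emb c4 * rv (uu * vv))"
    using av(3)[of 1] unfolding av(3)[of uu] av(3)[of vv] av(3)[of "uu * vv"]
    by (simp add: emb_simps algebra_simps)
  define m where "m = emb c1 * av 1 + emb c2 * av uu + emb c3 * av vv + emb c4 * av (uu * vv)"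
  define r where "r = emb c1 * rv 1 + emb c2 * rv uu + emb c3 * rv vv + emb c4 * rv (uu * vv)"
  have cA: "emb c1 \<in> A" "emb c2 \<in> A" "emb c3 \<in> A" "emb c4 \<in> A" using c emb_U0_A by blast+
  have mA: "m \<in> A" unfolding m_def
    by (intro subrng_add[OF subrng_A] subrng_mult[OF subrng_A] cA av)
  have rR: "r \<in> R_star" unfolding r_def
    by (intro subrng_add[OF subrng_R_star] subrng_mult[OF subrng_R_star] emb_R_star av)
  have xr: "x_el ^ s * (1 - x_el * r) = m" using xs1 unfolding m_def[symmetric] r_def[symmetric]
    by (simp add: algebra_simps)
  have "x_el ^ Suc s * r = x_el ^ s - m" using xr by (simp add: algebra_simps)
  moreover have "(x_el :: 'k kyzx) ^ Suc s \<noteq> 0" by (simp add: x_el_nz)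
  ultimately have "r = (x_el ^ s - m) / x_el ^ Suc s" by (metis nonzero_mult_div_cancel_left)
  moreover have "m \<in> K" using mA by (simp add: A_def)
  ultimately have "r \<in> K" using K_divide subrng_diff[OF subrng_K] subrng_power[OF subrng_K x_K] by metis
  hence rA: "r \<in> A" using rR by (simp add: A_def)
  have eA: "1 - x_el * r \<in> A" by (intro subrng_closed subrng_A rA x_A)
  have "fls_nth (1 - x_el * r) 0 = 1" using x_mult_nth_0[OF rR] by simp
  hence e: "1 - x_el * r \<noteq> 0" "inverse (1 - x_el * r) \<in> A"
    using A_unit[OF eA, of 1 1] unitc_1 by (simp_all add: One_fract_def)
  define i where "i = inverse (1 - x_el * r)"
  have "x_el ^ s = m * i" using xr e(1) unfolding i_def by (simp add: field_simps)
  hence fin: "x_el ^ s = emb c1 * (av 1 * i) + emb c2 * (av uu * i) + emb c3 * (av vv * i) + emb c4 * (av (uu * vv) * i)"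
    unfolding m_def by (simp add: algebra_simps)
  have "av e * i \<in> A" for e unfolding i_def by (intro subrng_mult[OF subrng_A] av e)
  \<comment> \<open>The four coordinates need not be distinct, so coefficients of equal ones are added up.\<close>
  define r' where "r' c = (if c = c1 then av 1 * i else 0) + (if c = c2 then av uu * i else 0) +
    (if c = c3 then av vv * i else 0) + (if c = c4 then av (uu * vv) * i else 0)" for c
  have "r' c \<in> A" for c unfolding r'_def
    using \<open>\<And>e. av e * i \<in> A\<close> subrng_0[OF subrng_A] by (intro subrng_add[OF subrng_A]) auto
  moreover have "(\<Sum>c\<in>{c1, c2, c3, c4}. emb c * r' c) = x_el ^ s"
    unfolding r'_def distrib_left sum.distrib fin
    by (intro arg_cong2[of _ _ _ _ "(+)"]) (simp_all add: if_distrib[of "(*) _"] sum.delta cong: if_cong)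
  moreover have "\<exists>b\<in>U0. a * emb c = emb b" if "c \<in> {c1, c2, c3, c4}" for c
    using that den cpi b by blast
  ultimately show thesis using that[of "{c1, c2, c3, c4}" r' s] c by auto
qed

end

section \<open>The powers of \<open>(f,g)A\<close>\<close>

lemma idl_scale:
  fixes e :: "'a::field"
  assumes "e \<noteq> 0" "r \<in> idl S ((\<lambda>j. e * F j) ` I)"
  shows "r / e \<in> idl S (F ` I)"
  using assms(2)
proof (induction rule: idl.induct)
  case (step s b r)
  then obtain j where j: "j \<in> I" "b = e * F j" by blast
  hence "(s * b + r) / e = s * F j + r / e" using assms(1) by (simp add: add_divide_distrib)
  thus ?case using step j by (auto intro!: idl.step)
qed (simp add: idl.zero)

text \<open>An integral element whose first powers have the common denominator \<open>D\<close> is almost integral.\<close>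

lemma integral_powers:
  fixes w :: "'a::comm_ring_1"
  assumes B: "subrng B" and int: "w ^ m \<in> idl B ((^) w ` {..<m})" and D: "\<And>i. i < m \<Longrightarrow> D * w ^ i \<in> B"
  shows "D * w ^ j \<in> B"
proof (induction j rule: less_induct)
  case (less j)
  show ?case
  proof (cases "j < m")
    case False
    have "D * (r * w ^ (j - m)) \<in> B" if "r \<in> idl B ((^) w ` {..<m})" for r
      using that
    proof (induction rule: idl.induct)
      case (step s b r)
      then obtain i where i: "i < m" "b = w ^ i" by blast
      have "D * w ^ (i + (j - m)) \<in> B" by (rule less) (use i False in auto)
      hence "s * (D * w ^ (i + (j - m))) + D * (r * w ^ (j - m)) \<in> B"
        using step by (intro subrng_add[OF B] subrng_mult[OF B, of s])
      thus ?case by (simp add: i power_add algebra_simps)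
    qed (simp add: subrng_0[OF B])
    from this[OF int] show ?thesis using False by (simp flip: power_add)
  qed (rule D)
qed

context setting
begin

text \<open>The powers of the ideal \<open>(f,g)A\<close>.\<close>

abbreviation P :: "nat \<Rightarrow> 'k kyzx set" where
  "P \<equiv> pw A (f_el \<alpha>) (g_el \<beta>)"

lemma P_A: "P n \<subseteq> A"
  by (intro pw_in subrng_A f_A g_A)

lemma emb_J_P: "b \<in> J n \<Longrightarrow> emb b \<in> P n"
  using pw_hom[OF rhom_emb emb_U0_A, of b ff gg n] by (simp only: emb_ff emb_gg)

lemma series_el_nth_0: "fls_nth (series_el a) 0 = const_yz (fps_nth a 0)"
  by (simp add: series_el_def)

lemma f_nth_0: "fls_nth (f_el \<alpha>) 0 = to_fract [:[:0, 1:]:] ^ 2"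
  and g_nth_0: "fls_nth (g_el \<beta>) 0 = to_fract [:0, 1:] ^ 2"
proof -
  have R: "emb uu \<in> R_star" "emb vv \<in> R_star" by (rule emb_R_star)+
  have "fls_nth (emb uu) 0 = to_fract [:[:0, 1:]:]" "fls_nth (emb vv) 0 = to_fract [:0, 1:]"
    unfolding emb_uu emb_vv
    by (simp_all add: series_el_nth_0 alpha0 beta0 rhom_0[OF rhom_const_yz] y_el_def z_el_def)
  thus "fls_nth (f_el \<alpha>) 0 = to_fract [:[:0, 1:]:] ^ 2" "fls_nth (g_el \<beta>) 0 = to_fract [:0, 1:] ^ 2"
    unfolding emb_ff[symmetric] emb_gg[symmetric] ff_def gg_def power2_eq_square emb_simps(3)
    using R by (simp_all add: R_star_mult_nth_0)
qed

lemma A_mult_nth_0: "a \<in> A \<Longrightarrow> b \<in> A \<Longrightarrow> fls_nth (a * b) 0 = fls_nth a 0 * fls_nth b 0"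
  by (rule R_star_mult_nth_0) (auto simp: A_def)

lemma A_power_nth_0: "a \<in> A \<Longrightarrow> fls_nth (a ^ n) 0 = fls_nth a 0 ^ n"
  by (induction n) (simp_all add: A_mult_nth_0 subrng_power[OF subrng_A])

text \<open>In \<open>k[y,z]\<^sub>(\<^sub>y\<^sub>,\<^sub>z\<^sub>)\<close>, the elements \<open>y\<^sup>m\<close> and \<open>z\<^sup>2\<close> form a regular sequence.\<close>

lemma loc_regular:
  fixes h s :: "'k poly poly fract"
  assumes "h \<in> loc_yz" "s \<in> loc_yz"
    and 0: "to_fract [:[:0, 1:]:] ^ m * h + to_fract [:0, 1:] ^ 2 * s = 0"
  shows "\<exists>l\<in>loc_yz. h = to_fract [:0, 1:] ^ 2 * l"
proof -
  obtain p q p' q' where *: "unitc q" "h = Fract p q" "q \<noteq> 0" "unitc q'" "s = Fract p' q'" "q' \<noteq> 0"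
    using assms by (metis loc_cases)
  let ?y = "[:[:0, 1:]:] :: 'k poly poly" and ?z = "[:0, 1:] :: 'k poly poly"
  have pw: "to_fract a ^ n = Fract (a ^ n) 1" for a :: "'k poly poly" and n
    by (induction n) (simp_all add: to_fract_def One_fract_def)
  have "?y ^ m * p * q' + ?z ^ 2 * p' * q = 0"
    using 0 * by (simp add: pw Zero_fract_def eq_fract algebra_simps)
  hence "?y ^ m * p * q' = ?z ^ 2 * (- p' * q)" by (simp add: algebra_simps eq_neg_iff_add_eq_0)
  hence dvd: "?z ^ 2 dvd ?y ^ m * p * q'" by (metis dvd_triv_left)
  have ym: "poly (?y ^ m) 0 \<noteq> 0" by simp
  have "poly q' 0 \<noteq> 0" using *(4) by (auto simp: unitc_def)
  hence o: "order 0 (?y ^ m) = 0" "order 0 q' = 0" using ym by (simp_all add: order_0I)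
  have "?z ^ 2 dvd p"
  proof (cases "p = 0")
    case False
    have nz: "?y ^ m * p * q' \<noteq> 0" using False *(6) ym by auto
    hence "2 \<le> order 0 (?y ^ m * p * q')" using dvd order_divides[of 0 2 "?y ^ m * p * q'"] by simp
    also have "\<dots> = order 0 p" using nz o by (simp add: order_mult)
    finally show ?thesis using order_divides[of 0 2 p] by simp
  qed simp
  then obtain r where "p = ?z ^ 2 * r" by blast
  hence "h = to_fract ?z ^ 2 * Fract r q" using * by (simp add: pw)
  thus ?thesis using *(1) loc_iff by blast
qed

text \<open>\<open>y\<^sup>2\<close> and \<open>z\<^sup>2\<close> generate a proper ideal of \<open>k[y,z]\<^sub>(\<^sub>y\<^sub>,\<^sub>z\<^sub>)\<close>.\<close>

lemma loc_yz_proper: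
  fixes a b :: "'k poly poly fract"
  assumes "a \<in> loc_yz" "b \<in> loc_yz"
  shows "to_fract [:[:0, 1:]:] ^ 2 * a + to_fract [:0, 1:] ^ 2 * b \<noteq> 1"
proof
  obtain p q p' q' where *: "unitc q" "a = Fract p q" "q \<noteq> 0" "unitc q'" "b = Fract p' q'" "q' \<noteq> 0"
    using assms by (metis loc_cases)
  let ?y = "[:[:0, 1:]:] :: 'k poly poly" and ?z = "[:0, 1:] :: 'k poly poly"
  have pw: "to_fract a ^ n = Fract (a ^ n) 1" for a :: "'k poly poly" and n
    by (induction n) (simp_all add: to_fract_def One_fract_def)
  assume "to_fract ?y ^ 2 * a + to_fract ?z ^ 2 * b = 1"
  hence "?y ^ 2 * p * q' + ?z ^ 2 * p' * q = q * q'"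
    using * by (simp add: pw One_fract_def eq_fract algebra_simps)
  hence "poly (poly (?y ^ 2 * p * q' + ?z ^ 2 * p' * q) 0) 0 = poly (poly (q * q') 0) 0" by (rule arg_cong)
  thus False using *(1,4) by (simp add: unitc_def)
qed

lemma P_top:
  "c \<in> P (Suc n) \<Longrightarrow> \<exists>h\<in>A. \<exists>S\<in>P n. c = h * f_el \<alpha> ^ Suc n + g_el \<beta> * S"
proof (induction n arbitrary: c)
  case 0
  then obtain a b where "a \<in> A" "b \<in> A" "c = f_el \<alpha> * a + g_el \<beta> * b" by auto
  thus ?case by (auto simp: mult.commute)
next
  case (Suc n)
  from Suc.prems obtain a b where ab: "a \<in> P (Suc n)" "b \<in> P (Suc n)" "c = f_el \<alpha> * a + g_el \<beta> * b"
    by (rule pw_SucE)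
  obtain h S where h: "h \<in> A" "S \<in> P n" "a = h * f_el \<alpha> ^ Suc n + g_el \<beta> * S" using Suc.IH[OF ab(1)] by blast
  have "c = h * f_el \<alpha> ^ Suc (Suc n) + g_el \<beta> * (f_el \<alpha> * S + b)"
    unfolding ab h by (simp add: algebra_simps)
  moreover have "f_el \<alpha> * S + b \<in> P (Suc n)"
    by (rule pw_add[OF subrng_A pw_f[OF subrng_A h(2)] ab(2)])
  ultimately show ?case using h(1) by blast
qed

lemma f_power_P: "h \<in> A \<Longrightarrow> h * f_el \<alpha> ^ n \<in> P n"
proof (induction n)
  case (Suc n)
  thus ?case using pw_f[OF subrng_A, of "h * f_el \<alpha> ^ n" "f_el \<alpha>" "g_el \<beta>" n]
    by (simp add: mult_ac del: pw.simps)
qed simp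

text \<open>\<open>x\<close> is a nonzerodivisor modulo \<open>P\<^sup>n\<close>, since \<open>y\<^sup>2\<close>, \<open>z\<^sup>2\<close> is a regular sequence in \<open>A/xA\<close>.\<close>

lemma x_regular: "b \<in> A \<Longrightarrow> x_el * b \<in> P n \<Longrightarrow> b \<in> P n"
proof (induction n arbitrary: b)
  case (Suc n)
  let ?f = "f_el \<alpha>" and ?g = "g_el \<beta>"
  obtain h S where h: "h \<in> A" "S \<in> P n" "x_el * b = h * ?f ^ Suc n + ?g * S" using P_top[OF Suc.prems(2)] by blast
  have SA: "S \<in> A" using h P_A by blast
  have fA: "?f ^ Suc n \<in> A" by (rule subrng_power[OF subrng_A f_A])
  have bR: "b \<in> R_star" using Suc.prems by (simp add: A_def)
  have "0 = fls_nth (h * ?f ^ Suc n + ?g * S) 0" unfolding h(3)[symmetric] using x_mult_nth_0[OF bR] by simp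
  also have "\<dots> = (to_fract [:[:0, 1:]:] ^ 2) ^ Suc n * fls_nth h 0 + to_fract [:0, 1:] ^ 2 * fls_nth S 0"
    using A_mult_nth_0[OF h(1) fA] A_mult_nth_0[OF g_A SA] A_power_nth_0[OF f_A, of "Suc n"]
    by (simp add: f_nth_0 g_nth_0 mult_ac)
  finally have "to_fract [:[:0, 1:]:] ^ (2 * Suc n) * fls_nth h 0 + to_fract [:0, 1:] ^ 2 * fls_nth S 0 = 0"
    by (simp only: power_mult)
  then obtain l where l: "l \<in> loc_yz" "fls_nth h 0 = to_fract [:0, 1:] ^ 2 * l"
    using loc_regular[OF A_nth_0[OF h(1)] A_nth_0[OF SA]] by blast
  have lA: "fls_const l \<in> A" by (rule const_A[OF l(1)])
  have "h - ?g * fls_const l \<in> A" by (intro subrng_diff[OF subrng_A] subrng_mult[OF subrng_A] h g_A lA)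
  moreover have "fls_nth (h - ?g * fls_const l) 0 = 0"
    using A_mult_nth_0[OF g_A lA] by (simp add: l(2) g_nth_0)
  ultimately obtain h' where h': "h' \<in> A" "h - ?g * fls_const l = x_el * h'" using A_div_x' by blast
  hence hh: "h = ?g * fls_const l + x_el * h'" by (simp add: algebra_simps)
  define S' where "S' = fls_const l * ?f ^ Suc n + S"
  have "fls_const l * ?f ^ Suc n \<in> P n"
    using f_power_P[OF lA, of "Suc n"] pw_mono_Suc[OF subrng_A f_A g_A] by blast
  hence S'P: "S' \<in> P n" unfolding S'_def using h(2) by (rule pw_add[OF subrng_A])
  hence S'A: "S' \<in> A" using P_A by blast
  have gS': "?g * S' = x_el * (b - h' * ?f ^ Suc n)"
    using h(3) unfolding hh S'_def by (simp add: algebra_simps)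
  have bA: "b - h' * ?f ^ Suc n \<in> A" by (intro subrng_diff[OF subrng_A] subrng_mult[OF subrng_A] Suc.prems h' fA)
  hence "fls_nth (?g * S') 0 = 0" unfolding gS' using x_mult_nth_0 by (auto simp: A_def)
  hence "fls_nth S' 0 = 0" using A_mult_nth_0[OF g_A S'A] by (simp add: g_nth_0)
  then obtain b' where b': "b' \<in> A" "S' = x_el * b'" using A_div_x'[OF S'A] by blast
  have b'P: "b' \<in> P n" using Suc.IH[OF b'(1)] S'P b'(2) by simp
  have "x_el * (?g * b') = x_el * (b - h' * ?f ^ Suc n)" using gS' b'(2) by (simp add: mult_ac)
  hence "?g * b' = b - h' * ?f ^ Suc n" using x_el_nz by (metis mult_left_cancel)
  hence "b = h' * ?f ^ Suc n + ?g * b'" by (simp add: algebra_simps)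
  moreover have "h' * ?f ^ Suc n \<in> P (Suc n)" by (rule f_power_P[OF h'(1)])
  moreover have "?g * b' \<in> P (Suc n)" by (rule pw_g[OF subrng_A b'P])
  ultimately show ?case using pw_add[OF subrng_A] by metis
qed simp

lemma x_power_regular: "b \<in> A \<Longrightarrow> x_el ^ s * b \<in> P n \<Longrightarrow> b \<in> P n"
proof (induction s)
  case (Suc s)
  have "x_el ^ s * b \<in> A" by (intro subrng_mult[OF subrng_A] subrng_power[OF subrng_A] x_A Suc.prems)
  moreover have "x_el * (x_el ^ s * b) \<in> P n" using Suc.prems(2) by (simp add: mult.assoc)
  ultimately have "x_el ^ s * b \<in> P n" by (rule x_regular)
  thus ?case using Suc by blast
qed simp

lemma one_notin_P: "1 \<notin> P 1"
proof
  assume "1 \<in> P 1"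
  hence "1 \<in> P (Suc 0)" by simp
  then obtain a b where ab: "a \<in> P 0" "b \<in> P 0" "1 = f_el \<alpha> * a + g_el \<beta> * b" by (rule pw_SucE)
  hence abA: "a \<in> A" "b \<in> A" by simp_all
  have "to_fract [:[:0, 1:]:] ^ 2 * fls_nth a 0 + to_fract [:0, 1:] ^ 2 * fls_nth b 0 = fls_nth (f_el \<alpha> * a + g_el \<beta> * b) 0"
    using A_mult_nth_0[OF f_A abA(1)] A_mult_nth_0[OF g_A abA(2)] by (simp add: f_nth_0 g_nth_0)
  also have "\<dots> = 1" unfolding ab(3)[symmetric] by simp
  finally show False using loc_yz_proper[OF A_nth_0[OF abA(1)] A_nth_0[OF abA(2)]] by simp
qed

text \<open>An element of \<open>A\<close> whose order is at least \<open>2n\<close> lies in \<open>P\<^sup>n\<close>: this holds for its multiples by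
  denominators in \<open>U\<^sub>0\<close>, hence for a multiple by a power of \<open>x\<close>, which can be cancelled.\<close>

theorem order_P:
  assumes a: "a \<in> A" and pq: "p \<in> U0" "q \<in> U0" "q \<noteq> 0" "a * emb q = emb p"
    and ord: "p \<noteq> 0 \<Longrightarrow> ordr q + 2 * n \<le> ordr p"
  shows "a \<in> P n"
proof -
  obtain C r s where C: "finite C" "C \<subseteq> U0" "\<forall>c\<in>C. \<exists>b\<in>U0. a * emb c = emb b"
    "\<forall>c. r c \<in> A" "x_el ^ s = (\<Sum>c\<in>C. emb c * r c)" using a by (rule A_denominators)
  have "r c * (a * emb c) \<in> P n" if c: "c \<in> C" for c
  proof -
    obtain b where b: "b \<in> U0" "a * emb c = emb b" using C(3) c by blast
    have "emb (b * q) = emb (p * c)"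
      unfolding emb_simps(3) b(2)[symmetric] pq(4)[symmetric] by (simp add: mult_ac)
    hence bq: "b * q = p * c" by (rule emb_inj)
    have "b \<in> J n"
    proof (cases "b = 0")
      case True thus ?thesis using pw_0[OF subrng_U0] by simp
    next
      case False
      hence "p \<noteq> 0" "c \<noteq> 0" using bq pq(3) by auto
      hence "ordr b + ordr q = ordr p + ordr c" using bq ordr_mult False pq(3) by metis
      hence "2 * n \<le> ordr b" using ord[OF \<open>p \<noteq> 0\<close>] by simp
      thus ?thesis using ordr_J b False by blast
    qed
    hence "emb b \<in> P n" by (rule emb_J_P)
    thus ?thesis unfolding b(2) by (rule pw_smult[OF subrng_A C(4)[rule_format]])
  qed
  hence "(\<Sum>c\<in>C. r c * (a * emb c)) \<in> P n" by (rule pw_sum[OF subrng_A])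
  moreover have "(\<Sum>c\<in>C. r c * (a * emb c)) = x_el ^ s * a"
    unfolding C(5) sum_distrib_right by (intro sum.cong) (simp_all add: mult_ac)
  ultimately show ?thesis using x_power_regular[OF a] by simp
qed

text \<open>Conversely, an element of \<open>P\<^sup>n\<close> is a fraction with denominator of order \<open>0\<close> and numerator in
  \<open>(f,g)\<^sup>nU\<^sub>0\<close>.\<close>

lemma P_order:
  "a \<in> P n \<Longrightarrow> \<exists>c\<in>U0. \<exists>b\<in>J n. c \<noteq> 0 \<and> ordr c = 0 \<and> a * emb c = emb b"
proof (induction n arbitrary: a)
  case 0
  hence a: "a \<in> A" by simp
  obtain C r s where C: "finite C" "C \<subseteq> U0" "\<forall>c\<in>C. \<exists>b\<in>U0. a * emb c = emb b"
    "\<forall>c. r c \<in> A" "x_el ^ s = (\<Sum>c\<in>C. emb c * r c)" using a by (rule A_denominators)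
  have "\<exists>c\<in>C. c \<notin> J 1"
  proof (rule ccontr)
    assume "\<not> (\<exists>c\<in>C. c \<notin> J 1)"
    hence "r c * emb c \<in> P 1" if "c \<in> C" for c using that emb_J_P by (intro pw_smult[OF subrng_A C(4)[rule_format]]) blast
    hence "(\<Sum>c\<in>C. r c * emb c) \<in> P 1" by (rule pw_sum[OF subrng_A])
    hence "x_el ^ s * 1 \<in> P 1" unfolding C(5) by (simp add: mult.commute del: pw.simps)
    hence "1 \<in> P 1" by (rule x_power_regular[OF subrng_1[OF subrng_A]])
    thus False using one_notin_P by blast
  qed
  then obtain c where c: "c \<in> C" "c \<notin> J 1" by blast
  hence "c \<noteq> 0 \<and> ordr c = 0" using ordr_eq_0[of c] C(2) by blast
  thus ?case using c C(2,3) by auto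
next
  case (Suc n)
  from Suc.prems obtain a1 a2 where a: "a1 \<in> P n" "a2 \<in> P n" "a = f_el \<alpha> * a1 + g_el \<beta> * a2"
    by (rule pw_SucE)
  obtain c1 b1 where 1: "c1 \<in> U0" "b1 \<in> J n" "c1 \<noteq> 0" "ordr c1 = 0" "a1 * emb c1 = emb b1" using Suc.IH[OF a(1)] by blast
  obtain c2 b2 where 2: "c2 \<in> U0" "b2 \<in> J n" "c2 \<noteq> 0" "ordr c2 = 0" "a2 * emb c2 = emb b2" using Suc.IH[OF a(2)] by blast
  have "a * emb (c1 * c2) = emb (ff * (c2 * b1) + gg * (c1 * b2))"
    unfolding a(3) emb_simps 1(5)[symmetric] 2(5)[symmetric] emb_ff emb_gg by (simp add: algebra_simps)
  moreover have "ff * (c2 * b1) + gg * (c1 * b2) \<in> J (Suc n)"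
    using 1 2 by (intro pw_SucI pw_smult[OF subrng_U0])
  moreover have "c1 * c2 \<in> U0" "c1 * c2 \<noteq> 0" "ordr (c1 * c2) = 0"
    using 1 2 subrng_mult[OF subrng_U0] by (auto simp: ordr_mult)
  ultimately show ?case by blast
qed

text \<open>\<open>N\<close> is a Noetherian localization of the completely integrally closed ring \<open>V[y,z]\<close>, hence itself
  completely integrally closed.\<close>

lemma N_cic:
  assumes pq: "p \<in> VV" "q \<in> VV" "q \<noteq> 0" "c * emb q = emb p"
    and e: "e \<noteq> 0" "\<And>j. e * c ^ j \<in> N"
  shows "c \<in> N"
proof -
  obtain m where "e * c ^ m \<in> idl N ((\<lambda>j. e * c ^ j) ` {..<m})" using noeth_N e(2) unfolding noeth_def by metis
  from idl_scale[OF e(1) this] have m: "c ^ m \<in> idl N ((^) c ` {..<m})" using e(1) by simp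
  \<comment> \<open>a common denominator for the coefficients of this equation of integral dependence\<close>
  have "\<exists>d\<in>VV. unitc (cf 0 d) \<and> emb d * r \<in> idl (emb ` VV) ((^) c ` {..<m})"
    if "r \<in> idl N ((^) c ` {..<m})" for r
    using that
  proof (induction rule: idl.induct)
    case zero
    show ?case using subrng_1[OF subrng_VV] by (intro bexI[of _ 1]) (auto simp: cf0_1 unitc_1 idl.zero)
  next
    case (step s b r)
    obtain d where d: "d \<in> VV" "unitc (cf 0 d)" "emb d * r \<in> idl (emb ` VV) ((^) c ` {..<m})" using step by blast
    obtain c' d' where s: "c' \<in> VV" "d' \<in> VV" "unitc (cf 0 d')" "emb d' \<noteq> 0" "s = emb c' / emb d'"
      using step(1) by (rule N_cases)
    have VV': "subrng (emb ` VV)" by (rule subrng_image[OF subrng_VV rhom_emb])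
    have "emb (d * d') * (s * b + r) = emb (d * c') * b + emb d' * (emb d * r)"
      using s(4) by (simp add: s(5) emb_simps field_simps)
    moreover have "emb (d * c') \<in> emb ` VV" using d s subrng_mult[OF subrng_VV] by blast
    moreover have "emb d' * (emb d * r) \<in> idl (emb ` VV) ((^) c ` {..<m})"
      by (rule idl_mult[OF VV' _ d(3)]) (use s in blast)
    ultimately have "emb (d * d') * (s * b + r) \<in> idl (emb ` VV) ((^) c ` {..<m})"
      using idl.step[OF _ step(2)] by simp
    thus ?case using d s subrng_mult[OF subrng_VV] by (intro bexI[of _ "d * d'"]) (auto simp: cf0_mult unitc_mult)
  qed
  from this[OF m] obtain d where d: "d \<in> VV" "unitc (cf 0 d)" "emb d * c ^ m \<in> idl (emb ` VV) ((^) c ` {..<m})"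
    by blast
  have d0: "emb d \<noteq> 0" by (rule emb_inverse[OF d(2)])
  note cl = subrng_mult[OF subrng_VV] subrng_power[OF subrng_VV]
  have B: "subrng (emb ` VV)" by (rule subrng_image[OF subrng_VV rhom_emb])
  have m0: "m \<noteq> 0"
  proof
    assume "m = 0"
    hence "emb d = 0" using d(3) by (auto elim: idl.cases)
    thus False using d0 by simp
  qed
  define w where "w = emb d * c"
  have wq: "w * emb q = emb (d * p)" unfolding w_def emb_simps(3) pq(4)[symmetric] by simp
  have "emb d ^ (m - 1) * r \<in> idl (emb ` VV) ((^) w ` {..<m})" if "r \<in> idl (emb ` VV) ((^) c ` {..<m})" for r
    using that
  proof (induction rule: idl.induct)
    case (step s b r)
    then obtain i where i: "i < m" "b = c ^ i" by blast
    have "emb d ^ (m - 1) = emb d ^ (m - 1 - i) * emb d ^ i" using i by (simp flip: power_add)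
    hence "emb d ^ (m - 1) * (s * b + r) = (s * emb d ^ (m - 1 - i)) * w ^ i + emb d ^ (m - 1) * r"
      by (simp add: i w_def power_mult_distrib algebra_simps)
    moreover have "s * emb d ^ (m - 1 - i) \<in> emb ` VV"
      using step(1) d(1) by (intro subrng_mult[OF B] subrng_power[OF B]) auto
    ultimately show ?case using step i by (auto intro!: idl.step)
  qed (simp add: idl.zero)
  from this[OF d(3)] have "emb d ^ (m - 1) * emb d * c ^ m \<in> idl (emb ` VV) ((^) w ` {..<m})"
    by (simp add: mult.assoc)
  moreover have "emb d ^ (m - 1) * emb d = emb d ^ m" using m0 by (metis One_nat_def Suc_pred mult.commute not_gr_zero power_Suc)
  ultimately have wm: "w ^ m \<in> idl (emb ` VV) ((^) w ` {..<m})"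
    by (simp add: w_def power_mult_distrib)
  have "emb (q ^ m) * w ^ i \<in> emb ` VV" if "i < m" for i
  proof -
    have "emb q ^ m = emb q ^ (m - i) * emb q ^ i" using that by (simp flip: power_add)
    hence "emb (q ^ m) * w ^ i = emb q ^ (m - i) * (w * emb q) ^ i"
      by (simp add: power_mult_distrib emb_simps mult_ac)
    also have "\<dots> = emb (q ^ (m - i) * (d * p) ^ i)" unfolding wq by (simp add: emb_simps)
    also have "\<dots> \<in> emb ` VV" by (intro imageI cl d pq(1,2))
    finally show ?thesis .
  qed
  hence alm: "emb (q ^ m) * w ^ j \<in> emb ` VV" for j by (rule integral_powers[OF B wm])
  have "almost VV (q ^ m) (d * p) q"
    unfolding almost_def
  proof
    fix j
    obtain t where t: "t \<in> VV" "emb (q ^ m) * w ^ j = emb t" using alm by blast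
    have "emb (q ^ m * (d * p) ^ j) = (emb (q ^ m) * w ^ j) * emb q ^ j"
      by (simp add: rhom_mult[OF rhom_emb] rhom_power[OF rhom_emb] power_mult_distrib mult_ac flip: wq)
        (simp add: pq(4)[symmetric] w_def power_mult_distrib mult_ac)
    also have "\<dots> = emb (t * q ^ j)" unfolding t by (simp add: emb_simps)
    finally have "q ^ m * (d * p) ^ j = t * q ^ j" by (rule emb_inj)
    thus "\<exists>s\<in>VV. q ^ m * (d * p) ^ j = s * q ^ j" using t by blast
  qed
  moreover have "d * p \<in> VV" "q ^ m \<in> VV" "q ^ m \<noteq> 0" using cl d pq by auto
  ultimately obtain s where s: "s \<in> VV" "d * p = s * q" using cic_VV pq unfolding cic_def by blast
  have "w * emb q = emb s * emb q" unfolding wq s(2) by (simp add: emb_simps)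
  hence "w = emb s" using emb_nz[OF pq(3)] by simp
  hence "c = emb s / emb d" using d0 by (simp add: w_def field_simps)
  thus ?thesis using N_I s d by simp
qed

text \<open>The common source of the normality of \<open>P\<close> and of its Rees algebra. The element \<open>c\<close> of \<open>K\<close> lies in \<open>N\<close>
  and therefore in \<open>A\<close>; its order is at least \<open>2d\<close>, since otherwise the order of \<open>e c\<^sup>j\<close> would be too small
  for large \<open>j\<close>.\<close>

theorem P_cic:
  assumes e0: "e \<noteq> 0" and ec: "\<And>j. e * c ^ j \<in> P (n + j * d)"
  shows "c \<in> P d"
proof -
  have ecA: "e * c ^ j \<in> A" for j using ec P_A by blast
  have eK: "e \<in> K" using ecA[of 0] by (simp add: A_def)
  have "c = (e * c ^ 1) / e" using e0 by simp
  hence cK: "c \<in> K" using K_divide[OF _ eK] ecA[of 1] by (metis A_def IntD1)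
  obtain p q where pq: "p \<in> U0" "q \<in> U0" "q \<noteq> 0" "c * emb q = emb p" using cK by (rule K_fraction)
  obtain p' q' where pq': "p' \<in> U0" "q' \<in> U0" "q' \<noteq> 0" "e * emb q' = emb p'" using eK by (rule K_fraction)
  have p'0: "p' \<noteq> 0" using pq'(4) e0 emb_nz[OF pq'(3)] by (auto simp: emb_simps)
  have "c \<in> N" using U0_VV pq e0 ecA A_N by (intro N_cic[of p q c e]) auto
  hence cA: "c \<in> A" using cK N_R_star by (auto simp: A_def)
  show ?thesis
  proof (rule order_P[OF cA pq])
    assume p0: "p \<noteq> 0"
    have key: "ordr q' + j * ordr q + 2 * (n + j * d) \<le> ordr p' + j * ordr p" for j
    proof -
      obtain a b where ab: "a \<in> U0" "b \<in> J (n + j * d)" "a \<noteq> 0" "ordr a = 0" "e * c ^ j * emb a = emb b"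
        using P_order[OF ec] by blast
      have "emb (p' * p ^ j * a) = (e * emb q') * (c * emb q) ^ j * emb a"
        unfolding pq(4) pq'(4) by (simp add: emb_simps)
      also have "\<dots> = (e * c ^ j * emb a) * emb (q' * q ^ j)"
        by (simp add: emb_simps power_mult_distrib mult_ac)
      also have "\<dots> = emb (b * (q' * q ^ j))" unfolding ab by (simp add: emb_simps)
      finally have eq: "p' * p ^ j * a = b * (q' * q ^ j)" by (rule emb_inj)
      have l: "ordr (p' * p ^ j * a) = ordr p' + j * ordr p"
        using p'0 p0 ab by (simp add: ordr_mult ordr_power)
      have b0: "b \<noteq> 0" using eq p'0 p0 ab by auto
      have r: "ordr (b * (q' * q ^ j)) = ordr b + (ordr q' + j * ordr q)"
        using b0 pq pq' by (simp add: ordr_mult ordr_power)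
      have "b \<in> U0" using ab(2) pw_in[OF subrng_U0 ff_U0 gg_U0] by blast
      hence "2 * (n + j * d) \<le> ordr b" using ordr_J b0 ab(2) by blast
      thus ?thesis using eq l r by simp
    qed
    show "ordr q + 2 * d \<le> ordr p"
    proof (rule ccontr)
      assume "\<not> ordr q + 2 * d \<le> ordr p"
      hence lt: "ordr p + 1 \<le> ordr q + 2 * d" by simp
      let ?j = "Suc (ordr p')"
      have "?j * (ordr p + 1) \<le> ?j * (ordr q + 2 * d)" using lt by (rule mult_le_mono2)
      also have "\<dots> = ?j * ordr q + 2 * (?j * d)" by (simp add: algebra_simps)
      also have "\<dots> \<le> ordr p' + ?j * ordr p" using key[of ?j] by (simp add: algebra_simps)
      finally show False by simp
    qed
  qed
qed

end

section \<open>Powers of ideals and Rees algebras\<close>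

context cring
begin

lemma one_ideals_set [simp]: "\<one>\<^bsub>ideals_set R\<^esub> = carrier R"
  by (simp add: ideals_set_def)

lemma ideal_pow_0: "ideal_pow R I 0 = carrier R"
  by (simp add: nat_pow_def ideals_set_def)

lemma ideal_pow_Suc: "ideal_pow R I (Suc n) = ideal_pow R I n \<cdot> I"
  by (simp add: nat_pow_def ideals_set_def)

lemma monoid_ideals: "Group.monoid (ideals_set R)"
  using ideals_set_is_semiring semiring.axioms(2) by blast

lemma ideal_pow_ideal: "ideal I R \<Longrightarrow> ideal (ideal_pow R I n) R"
  using monoid.nat_pow_closed[OF monoid_ideals, of I n] by (simp add: ideals_set_def)

lemma ideal_pow_1: "ideal I R \<Longrightarrow> ideal_pow R I 1 = I"
  using monoid.nat_pow_eone[OF monoid_ideals, of I] by (simp add: ideals_set_def)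

lemma ideal_pow_pow: "ideal I R \<Longrightarrow> ideal_pow R (ideal_pow R I n) m = ideal_pow R I (n * m)"
  using monoid.nat_pow_pow[OF monoid_ideals, of I n m] by (simp add: ideals_set_def)

lemma ideal_pow_add: "ideal I R \<Longrightarrow> ideal_pow R I n \<cdot> ideal_pow R I m = ideal_pow R I (n + m)"
  using monoid.nat_pow_mult[OF monoid_ideals, of I n m] by (simp add: ideals_set_def)

lemma ideal_pow_mult:
  "ideal I R \<Longrightarrow> a \<in> ideal_pow R I n \<Longrightarrow> b \<in> ideal_pow R I m \<Longrightarrow> a \<otimes> b \<in> ideal_pow R I (n + m)"
  using ideal_pow_add[of I n m] ideal_prod.prod[of a "ideal_pow R I n" b "ideal_pow R I m" R] by simp

lemma ideal_pow_carrier: "ideal I R \<Longrightarrow> a \<in> ideal_pow R I n \<Longrightarrow> a \<in> carrier R"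
  using ideal.Icarr[OF ideal_pow_ideal] by blast

lemma ideal_finsum: "ideal J R \<Longrightarrow> (\<And>i. i \<in> S \<Longrightarrow> h i \<in> J) \<Longrightarrow> finsum R h S \<in> J"
proof (induction S rule: infinite_finite_induct)
  case (insert x F)
  have "h \<in> F \<rightarrow> carrier R" "h x \<in> carrier R" using insert by (auto intro: ideal.Icarr)
  thus ?case using insert by (auto simp: additive_subgroup.a_closed[OF ideal.axioms(1)])
qed (simp_all add: additive_subgroup.zero_closed[OF ideal.axioms(1)])

lemma ideal_a_inv: "ideal J R \<Longrightarrow> a \<in> J \<Longrightarrow> \<ominus> a \<in> J"
  by (simp add: additive_subgroup.a_inv_closed ideal.axioms(1))

lemma Idl2: assumes "f \<in> carrier R" "g \<in> carrier R"
  shows "Idl {f, g} = {a \<otimes> f \<oplus> b \<otimes> g | a b. a \<in> carrier R \<and> b \<in> carrier R}" (is "_ = ?J")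
proof
  have I: "ideal (Idl {f, g}) R" using assms by (intro genideal_ideal) simp
  have fg: "f \<in> Idl {f, g}" "g \<in> Idl {f, g}" using genideal_self[of "{f, g}"] assms by auto
  show "?J \<subseteq> Idl {f, g}"
    using I fg by (auto intro!: additive_subgroup.a_closed[OF ideal.axioms(1)] ideal.I_l_closed)
  have cl: "a \<otimes> f \<oplus> b \<otimes> g \<in> carrier R" if "a \<in> carrier R" "b \<in> carrier R" for a b using that assms by simp
  have "ideal ?J R"
  proof (rule idealI[OF ring_axioms])
    show "subgroup ?J (add_monoid R)"
    proof
      show "?J \<subseteq> carrier (add_monoid R)" using cl by auto
    next
      fix x y assume "x \<in> ?J" "y \<in> ?J"
      then obtain a b c d where *: "a \<in> carrier R" "b \<in> carrier R" "c \<in> carrier R" "d \<in> carrier R"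
        "x = a \<otimes> f \<oplus> b \<otimes> g" "y = c \<otimes> f \<oplus> d \<otimes> g" by blast
      have "x \<oplus> y = (a \<oplus> c) \<otimes> f \<oplus> (b \<oplus> d) \<otimes> g"
        unfolding *(5,6) using *(1-4) assms by (simp add: l_distr a_ac)
      thus "x \<otimes>\<^bsub>add_monoid R\<^esub> y \<in> ?J" using * by auto
    next
      have "\<zero> = \<zero> \<otimes> f \<oplus> \<zero> \<otimes> g" using assms by simp
      thus "\<one>\<^bsub>add_monoid R\<^esub> \<in> ?J" using zero_closed by auto
    next
      fix x assume "x \<in> ?J"
      then obtain a b where *: "a \<in> carrier R" "b \<in> carrier R" "x = a \<otimes> f \<oplus> b \<otimes> g" by blast
      have "\<ominus> x = (\<ominus> a) \<otimes> f \<oplus> (\<ominus> b) \<otimes> g"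
        unfolding *(3) using *(1-2) assms by (simp add: l_minus minus_add)
      thus "inv\<^bsub>add_monoid R\<^esub> x \<in> ?J" using * by (auto simp: a_inv_def[symmetric])
    qed
  next
    fix x r assume "x \<in> ?J" and r: "r \<in> carrier R"
    then obtain a b where *: "a \<in> carrier R" "b \<in> carrier R" "x = a \<otimes> f \<oplus> b \<otimes> g" by blast
    have "r \<otimes> x = (r \<otimes> a) \<otimes> f \<oplus> (r \<otimes> b) \<otimes> g"
      unfolding *(3) using *(1-2) assms r by (simp add: r_distr m_assoc)
    thus "r \<otimes> x \<in> ?J" using * r by auto
    moreover have "x \<otimes> r = r \<otimes> x" using * assms r by (simp add: m_comm)
    ultimately show "x \<otimes> r \<in> ?J" by simp
  qed
  moreover have "f = \<one> \<otimes> f \<oplus> \<zero> \<otimes> g" "g = \<zero> \<otimes> f \<oplus> \<one> \<otimes> g" using assms by simp_all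
  hence "{f, g} \<subseteq> ?J" using one_closed zero_closed by blast
  ultimately show "Idl {f, g} \<subseteq> ?J" by (rule genideal_minimal)
qed

lemma UP_cring_R: "UP_cring R"
  by (simp add: UP_cring_def is_cring)

lemma adjoin_gens:
  "F \<subseteq> carrier R \<Longrightarrow>
    (\<lambda>a. up_ring.monom (UP R) a 0) ` carrier R \<union> (\<lambda>s. up_ring.monom (UP R) s 1) ` F \<subseteq> carrier (UP R)"
  using UP_ring.monom_closed[of R] UP_cring_R by (auto simp: UP_cring_def UP_ring_def cring_def)

lemma rees_coeff:
  assumes I: "ideal I R" and F: "F \<subseteq> I" and p: "p \<in> carrier (adjoin_t R F)"
  shows "p \<in> carrier (UP R) \<and> (\<forall>n. up_ring.coeff (UP R) p n \<in> ideal_pow R I n)"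
proof -
  interpret U: UP_cring R "UP R" by (rule UP_cring_R)
  have z: "\<zero> \<in> ideal_pow R I n" for n
    by (rule additive_subgroup.zero_closed[OF ideal.axioms(1)[OF ideal_pow_ideal[OF I]]])
  have FR: "F \<subseteq> carrier R" using F ideal.Icarr[OF I] by blast
  have "p \<in> generate_ring (UP R) ((\<lambda>a. up_ring.monom (UP R) a 0) ` carrier R \<union> (\<lambda>s. up_ring.monom (UP R) s 1) ` F)"
    using p by (simp add: adjoin_t_def)
  thus ?thesis
  proof (induction rule: generate_ring.induct)
    case one
    show ?case using z by (auto simp: ideal_pow_0)
  next
    case (incl h)
    thus ?case
    proof
      assume "h \<in> (\<lambda>a. up_ring.monom (UP R) a 0) ` carrier R"
      thus ?thesis using z by (auto simp: ideal_pow_0)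
    next
      assume "h \<in> (\<lambda>s. up_ring.monom (UP R) s 1) ` F"
      then obtain s where s: "s \<in> F" "h = up_ring.monom (UP R) s 1" by blast
      have "s \<in> ideal_pow R I 1" using s F ideal_pow_1[OF I] by blast
      moreover have "s \<in> carrier R" using s FR by blast
      ultimately show ?thesis using s z by (simp del: nat_pow_Suc)
    qed
  next
    case (a_inv h)
    thus ?case using ideal_a_inv[OF ideal_pow_ideal[OF I]] by simp
  next
    case (eng_add h1 h2)
    thus ?case using additive_subgroup.a_closed[OF ideal.axioms(1)[OF ideal_pow_ideal[OF I]]] by simp
  next
    case (eng_mult h1 h2)
    have "up_ring.coeff (UP R) (h1 \<otimes>\<^bsub>UP R\<^esub> h2) n \<in> ideal_pow R I n" for n
    proof -
      have "(\<Oplus>i\<in>{..n}. up_ring.coeff (UP R) h1 i \<otimes> up_ring.coeff (UP R) h2 (n - i)) \<in> ideal_pow R I n"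
      proof (rule ideal_finsum[OF ideal_pow_ideal[OF I]])
        fix i assume "i \<in> {..n}"
        thus "up_ring.coeff (UP R) h1 i \<otimes> up_ring.coeff (UP R) h2 (n - i) \<in> ideal_pow R I n"
          using ideal_pow_mult[OF I, of _ i _ "n - i"] eng_mult.IH by simp
      qed
      thus ?thesis using eng_mult.IH by simp
    qed
    thus ?case using eng_mult.IH by simp
  qed
qed

text \<open>The Rees algebra of \<open>I = (f,g)\<close> consists of the polynomials whose \<open>n\<close>-th coefficient lies in \<open>I\<^sup>n\<close>.\<close>

lemma rees_carrier:
  assumes f: "f \<in> carrier R" and g: "g \<in> carrier R" and I: "I = Idl {f, g}"
  shows "carrier (adjoin_t R {f, g}) =
      {p \<in> carrier (UP R). \<forall>n. up_ring.coeff (UP R) p n \<in> ideal_pow R I n}" (is "?G = ?S")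
    and "carrier (adjoin_t R I) =
      {p \<in> carrier (UP R). \<forall>n. up_ring.coeff (UP R) p n \<in> ideal_pow R I n}"
proof -
  interpret U: UP_cring R "UP R" by (rule UP_cring_R)
  have II: "ideal I R" unfolding I using f g by (intro genideal_ideal) simp
  have fgI: "{f, g} \<subseteq> I" unfolding I using genideal_self[of "{f, g}"] f g by auto
  have IR: "I \<subseteq> carrier R" using ideal.Icarr[OF II] by blast
  let ?gen = "\<lambda>F. (\<lambda>a. up_ring.monom (UP R) a 0) ` carrier R \<union> (\<lambda>s. up_ring.monom (UP R) s 1) ` F"
  have sub: "subring ?G (UP R)"
    using U.P.generate_ring_is_subring[OF adjoin_gens[of "{f, g}"]] f g by (simp add: adjoin_t_def)
  have gens: "?gen {f, g} \<subseteq> ?G" by (auto simp: adjoin_t_def intro: generate_ring.incl)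
  have 1: "up_ring.monom (UP R) b 1 \<in> ?G" if bI: "b \<in> I" for b
  proof -
    obtain r s where b: "r \<in> carrier R" "s \<in> carrier R" "b = r \<otimes> f \<oplus> s \<otimes> g"
      using bI unfolding I Idl2[OF f g] by blast
    have "up_ring.monom (UP R) (r \<otimes> f) (0 + 1) = up_ring.monom (UP R) r 0 \<otimes>\<^bsub>UP R\<^esub> up_ring.monom (UP R) f 1"
      "up_ring.monom (UP R) (s \<otimes> g) (0 + 1) = up_ring.monom (UP R) s 0 \<otimes>\<^bsub>UP R\<^esub> up_ring.monom (UP R) g 1"
      by (rule U.monom_mult; use b f g in simp)+
    hence "up_ring.monom (UP R) b 1 =
      up_ring.monom (UP R) r 0 \<otimes>\<^bsub>UP R\<^esub> up_ring.monom (UP R) f 1 \<oplus>\<^bsub>UP R\<^esub>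
      up_ring.monom (UP R) s 0 \<otimes>\<^bsub>UP R\<^esub> up_ring.monom (UP R) g 1"
      using b f g by simp
    moreover have "up_ring.monom (UP R) r 0 \<in> ?G" "up_ring.monom (UP R) s 0 \<in> ?G"
      "up_ring.monom (UP R) f 1 \<in> ?G" "up_ring.monom (UP R) g 1 \<in> ?G" using gens b by auto
    ultimately show ?thesis using subringE(6,7)[OF sub] by metis
  qed
  have mon: "up_ring.monom (UP R) a n \<in> ?G" if "a \<in> ideal_pow R I n" for a n
    using that
  proof (induction n arbitrary: a)
    case 0
    thus ?case using gens by (auto simp: ideal_pow_0)
  next
    case (Suc n)
    from Suc.prems have "a \<in> ideal_pow R I n \<cdot> I" by (simp only: ideal_pow_Suc)
    thus ?case
    proof (induction a rule: ideal_prod.induct)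
      case (prod i j)
      have "up_ring.monom (UP R) (i \<otimes> j) (n + 1) = up_ring.monom (UP R) i n \<otimes>\<^bsub>UP R\<^esub> up_ring.monom (UP R) j 1"
        using prod IR ideal_pow_carrier[OF II] by (intro U.monom_mult) auto
      thus ?case using Suc.IH[OF prod(1)] 1[OF prod(2)] subringE(6)[OF sub] by simp
    next
      case (sum s1 s2)
      have "s1 \<in> carrier R" "s2 \<in> carrier R" using sum ideal_pow_carrier[OF II, of _ "Suc n"]
        by (simp_all only: ideal_pow_Suc)
      thus ?case using sum subringE(7)[OF sub] by simp
    qed
  qed
  have SG: "?S \<subseteq> ?G"
  proof
    fix p assume p: "p \<in> ?S"
    let ?s = "\<lambda>i. up_ring.monom (UP R) (up_ring.coeff (UP R) p i) i"
    have "finsum (UP R) ?s N \<in> ?G" if "finite N" for N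
      using that
    proof (induction N rule: finite_induct)
      case empty thus ?case using subringE(2)[OF sub] by simp
    next
      case (insert x N)
      have "?s \<in> N \<rightarrow> carrier (UP R)" "?s x \<in> carrier (UP R)" using p by auto
      hence "finsum (UP R) ?s (insert x N) = ?s x \<oplus>\<^bsub>UP R\<^esub> finsum (UP R) ?s N"
        using insert by (intro U.P.finsum_insert)
      moreover have "?s x \<in> ?G" using p mon by simp
      ultimately show ?case using insert subringE(7)[OF sub] by simp
    qed
    from this[of "{..deg R p}"] show "p \<in> ?G" using U.up_repr[of p] p by simp
  qed
  show "?G = ?S" using SG rees_coeff[OF II fgI] by blast
  have "?G \<subseteq> carrier (adjoin_t R I)"
  proof -
    have "subring (carrier (adjoin_t R I)) (UP R)"
      using U.P.generate_ring_is_subring[OF adjoin_gens[OF IR]] by (simp add: adjoin_t_def)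
    moreover have "?gen {f, g} \<subseteq> carrier (adjoin_t R I)"
      using fgI by (auto simp: adjoin_t_def intro: generate_ring.incl)
    ultimately have "generate_ring (UP R) (?gen {f, g}) \<subseteq> carrier (adjoin_t R I)"
      by (intro U.P.generate_ring_min_subring1) (use f g in auto)
    thus ?thesis by (simp add: adjoin_t_def)
  qed
  thus "carrier (adjoin_t R I) = ?S" using SG rees_coeff[OF II order_refl] by blast
qed

lemma adjoin_Idl:
  assumes "f \<in> carrier R" "g \<in> carrier R"
  shows "adjoin_t R (Idl {f, g}) = adjoin_t R {f, g}"
  using rees_carrier[OF assms refl] by (simp add: adjoin_t_def)

end

lemma (in domain) domain_adjoin: assumes "F \<subseteq> carrier R" shows "domain (adjoin_t R F)"
proof -
  interpret U: UP_domain R "UP R" by (simp add: UP_domain_def domain_axioms)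
  show ?thesis unfolding adjoin_t_def
    by (intro U.subring_is_domain U.generate_ring_is_subring adjoin_gens assms)
qed

section \<open>The field of fractions\<close>

lemma UN2_const: "u \<noteq> {} \<Longrightarrow> v \<noteq> {} \<Longrightarrow> (\<And>x y. x \<in> u \<Longrightarrow> y \<in> v \<Longrightarrow> F x y = C) \<Longrightarrow> (\<Union>x\<in>u. \<Union>y\<in>v. F x y) = C"
  by auto

context domain
begin

text \<open>The admissible denominators.\<close>

abbreviation nz :: "'a set" where "nz \<equiv> carrier R - {\<zero>}"

lemma nz_mult: "a \<in> nz \<Longrightarrow> b \<in> nz \<Longrightarrow> a \<otimes> b \<in> nz"
  using integral_iff by auto

lemma frac_class_mem: "(a', b') \<in> frac_class R a b \<longleftrightarrow>
    a \<in> carrier R \<and> b \<in> nz \<and> a' \<in> carrier R \<and> b' \<in> nz \<and> a \<otimes> b' = a' \<otimes> b"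
  by (auto simp: frac_class_def frac_rel_def)

lemma frac_trans:
  assumes "a \<in> carrier R" "b \<in> nz" "c \<in> carrier R" "d \<in> nz" "e \<in> carrier R" "h \<in> nz"
    and "a \<otimes> d = c \<otimes> b" "c \<otimes> h = e \<otimes> d"
  shows "a \<otimes> h = e \<otimes> b"
proof -
  have "d \<otimes> (a \<otimes> h) = (a \<otimes> d) \<otimes> h" using assms(1-6) by (simp add: m_ac)
  also have "\<dots> = (c \<otimes> h) \<otimes> b" unfolding assms(7) using assms(1-6) by (simp add: m_ac)
  also have "\<dots> = d \<otimes> (e \<otimes> b)" unfolding assms(8) using assms(1-6) by (simp add: m_ac)
  finally show ?thesis using assms(1-6) m_lcancel[of d "a \<otimes> h" "e \<otimes> b"] by auto
qed

lemma frac_class_eqI: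
  assumes "a \<in> carrier R" "b \<in> nz" "c \<in> carrier R" "d \<in> nz" "a \<otimes> d = c \<otimes> b"
  shows "frac_class R a b = frac_class R c d"
proof -
  have "(a', b') \<in> frac_class R c d" if m: "(a', b') \<in> frac_class R a b"
    and 1: "a \<in> carrier R" "b \<in> nz" "c \<in> carrier R" "d \<in> nz" "a \<otimes> d = c \<otimes> b" for a' b' a b c d
  proof -
    have *: "a' \<in> carrier R" "b' \<in> nz" "a \<otimes> b' = a' \<otimes> b" using m unfolding frac_class_mem by blast+
    have "c \<otimes> b' = a' \<otimes> d" using frac_trans[of c d a b a' b'] 1 * by metis
    thus ?thesis unfolding frac_class_mem using 1 * by blast
  qed
  from this[OF _ assms] this[OF _ assms(3,4,1,2) assms(5)[symmetric]] show ?thesis by auto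
qed

lemma frac_class_self: "a \<in> carrier R \<Longrightarrow> b \<in> nz \<Longrightarrow> (a, b) \<in> frac_class R a b"
  by (simp add: frac_class_mem)

lemma frac_class_eqD:
  assumes "a \<in> carrier R" "b \<in> nz" "frac_class R a b = frac_class R c d"
  shows "a \<otimes> d = c \<otimes> b"
  using frac_class_self[OF assms(1,2)] unfolding assms(3) frac_class_mem by simp

lemma frac_carrier: "q \<in> carrier (frac_field R) \<longleftrightarrow> (\<exists>a\<in>carrier R. \<exists>b\<in>nz. q = frac_class R a b)"
  by (auto simp: frac_field_def quotient_def frac_class_def)

lemma frac_closed: "a \<in> carrier R \<Longrightarrow> b \<in> nz \<Longrightarrow> frac_class R a b \<in> carrier (frac_field R)"
  using frac_carrier by blast

lemma frac_mult:
  assumes "a \<in> carrier R" "b \<in> nz" "c \<in> carrier R" "d \<in> nz"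
  shows "frac_class R a b \<otimes>\<^bsub>frac_field R\<^esub> frac_class R c d = frac_class R (a \<otimes> c) (b \<otimes> d)"
proof -
  have "(case x of (a, b) \<Rightarrow> case y of (c, d) \<Rightarrow> frac_class R (a \<otimes> c) (b \<otimes> d)) = frac_class R (a \<otimes> c) (b \<otimes> d)"
    if xy: "x \<in> frac_class R a b" "y \<in> frac_class R c d" for x y
  proof -
    obtain a' b' c' d' where x: "x = (a', b')" "y = (c', d')" by (metis surj_pair)
    have *: "a' \<in> carrier R" "b' \<in> nz" "a \<otimes> b' = a' \<otimes> b" "c' \<in> carrier R" "d' \<in> nz" "c \<otimes> d' = c' \<otimes> d"
      using xy unfolding x frac_class_mem by blast+
    have "(a' \<otimes> c') \<otimes> (b \<otimes> d) = (a' \<otimes> b) \<otimes> (c' \<otimes> d)" using *(1,2,4,5) assms by (simp add: m_ac)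
    also have "\<dots> = (a \<otimes> c) \<otimes> (b' \<otimes> d')" unfolding *(3,6)[symmetric] using *(1,2,4,5) assms by (simp add: m_ac)
    finally have "frac_class R (a' \<otimes> c') (b' \<otimes> d') = frac_class R (a \<otimes> c) (b \<otimes> d)"
      by (intro frac_class_eqI nz_mult m_closed) (use * assms in auto)
    thus ?thesis by (simp add: x)
  qed
  hence "(\<Union>x\<in>frac_class R a b. \<Union>y\<in>frac_class R c d. case x of (a, b) \<Rightarrow> case y of (c, d) \<Rightarrow>
      frac_class R (a \<otimes> c) (b \<otimes> d)) = frac_class R (a \<otimes> c) (b \<otimes> d)"
    by (intro UN2_const) (use frac_class_self[OF assms(1,2)] frac_class_self[OF assms(3,4)] in auto)
  moreover have "frac_class R a b \<otimes>\<^bsub>frac_field R\<^esub> frac_class R c d =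
    (\<Union>x\<in>frac_class R a b. \<Union>y\<in>frac_class R c d. case x of (a, b) \<Rightarrow> case y of (c, d) \<Rightarrow>
      frac_class R (a \<otimes> c) (b \<otimes> d))"
    unfolding frac_field_def by (auto simp: split_beta)
  ultimately show ?thesis by simp
qed

lemma frac_add:
  assumes "a \<in> carrier R" "b \<in> nz" "c \<in> carrier R" "d \<in> nz"
  shows "frac_class R a b \<oplus>\<^bsub>frac_field R\<^esub> frac_class R c d = frac_class R (a \<otimes> d \<oplus> c \<otimes> b) (b \<otimes> d)"
proof -
  have "(case x of (a, b) \<Rightarrow> case y of (c, d) \<Rightarrow> frac_class R (a \<otimes> d \<oplus> c \<otimes> b) (b \<otimes> d)) =
      frac_class R (a \<otimes> d \<oplus> c \<otimes> b) (b \<otimes> d)"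
    if xy: "x \<in> frac_class R a b" "y \<in> frac_class R c d" for x y
  proof -
    obtain a' b' c' d' where x: "x = (a', b')" "y = (c', d')" by (metis surj_pair)
    have *: "a' \<in> carrier R" "b' \<in> nz" "a \<otimes> b' = a' \<otimes> b" "c' \<in> carrier R" "d' \<in> nz" "c \<otimes> d' = c' \<otimes> d"
      using xy unfolding x frac_class_mem by blast+
    have "(a' \<otimes> d' \<oplus> c' \<otimes> b') \<otimes> (b \<otimes> d) = (a' \<otimes> b) \<otimes> (d \<otimes> d') \<oplus> (c' \<otimes> d) \<otimes> (b \<otimes> b')"
      using *(1,2,4,5) assms by (simp add: l_distr r_distr m_ac)
    also have "\<dots> = (a \<otimes> d \<oplus> c \<otimes> b) \<otimes> (b' \<otimes> d')"
      unfolding *(3,6)[symmetric] using *(1,2,4,5) assms by (simp add: l_distr r_distr m_ac)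
    finally have "frac_class R (a' \<otimes> d' \<oplus> c' \<otimes> b') (b' \<otimes> d') = frac_class R (a \<otimes> d \<oplus> c \<otimes> b) (b \<otimes> d)"
      by (intro frac_class_eqI nz_mult m_closed a_closed) (use * assms in auto)
    thus ?thesis by (simp add: x)
  qed
  hence "(\<Union>x\<in>frac_class R a b. \<Union>y\<in>frac_class R c d. case x of (a, b) \<Rightarrow> case y of (c, d) \<Rightarrow>
      frac_class R (a \<otimes> d \<oplus> c \<otimes> b) (b \<otimes> d)) = frac_class R (a \<otimes> d \<oplus> c \<otimes> b) (b \<otimes> d)"
    by (intro UN2_const) (use frac_class_self[OF assms(1,2)] frac_class_self[OF assms(3,4)] in auto)
  moreover have "frac_class R a b \<oplus>\<^bsub>frac_field R\<^esub> frac_class R c d =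
    (\<Union>x\<in>frac_class R a b. \<Union>y\<in>frac_class R c d. case x of (a, b) \<Rightarrow> case y of (c, d) \<Rightarrow>
      frac_class R (a \<otimes> d \<oplus> c \<otimes> b) (b \<otimes> d))"
    unfolding frac_field_def by (auto simp: split_beta)
  ultimately show ?thesis by simp
qed

lemma frac_one: "\<one>\<^bsub>frac_field R\<^esub> = frac_class R \<one> \<one>"
  and frac_zero: "\<zero>\<^bsub>frac_field R\<^esub> = frac_class R \<zero> \<one>"
  by (simp_all add: frac_field_def)

lemma one_nz: "\<one> \<in> nz"
  by simp

lemma frac_cring: "cring (frac_field R)"
proof (rule cringI)
  let ?L = "frac_field R"
  show "abelian_group ?L"
  proof (rule abelian_groupI)
    fix x y z assume "x \<in> carrier ?L" "y \<in> carrier ?L" "z \<in> carrier ?L"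
    then obtain a b c d e h where *: "a \<in> carrier R" "b \<in> nz" "x = frac_class R a b"
      "c \<in> carrier R" "d \<in> nz" "y = frac_class R c d" "e \<in> carrier R" "h \<in> nz" "z = frac_class R e h"
      unfolding frac_carrier by blast
    have "(a \<otimes> d \<oplus> c \<otimes> b) \<otimes> h \<oplus> e \<otimes> (b \<otimes> d) = a \<otimes> (d \<otimes> h) \<oplus> (c \<otimes> h \<oplus> e \<otimes> d) \<otimes> b"
      using * by (simp add: l_distr r_distr m_ac a_ac)
    moreover have "b \<otimes> d \<otimes> h = b \<otimes> (d \<otimes> h)" using * by (simp add: m_assoc)
    moreover have "b \<otimes> d \<in> nz" "d \<otimes> h \<in> nz" using * nz_mult by blast+
    moreover have "a \<otimes> d \<oplus> c \<otimes> b \<in> carrier R" "c \<otimes> h \<oplus> e \<otimes> d \<in> carrier R" using * by auto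
    ultimately show "x \<oplus>\<^bsub>?L\<^esub> y \<oplus>\<^bsub>?L\<^esub> z = x \<oplus>\<^bsub>?L\<^esub> (y \<oplus>\<^bsub>?L\<^esub> z)"
      unfolding *(3,6,9) using *(1,2,4,5,7,8) by (simp only: frac_add)
  next
    fix x y assume "x \<in> carrier ?L" "y \<in> carrier ?L"
    then obtain a b c d where *: "a \<in> carrier R" "b \<in> nz" "x = frac_class R a b"
      "c \<in> carrier R" "d \<in> nz" "y = frac_class R c d" unfolding frac_carrier by blast
    show "x \<oplus>\<^bsub>?L\<^esub> y \<in> carrier ?L"
      unfolding *(3,6) frac_add[OF *(1,2,4,5)] using * by (intro frac_closed nz_mult) auto
    show "x \<oplus>\<^bsub>?L\<^esub> y = y \<oplus>\<^bsub>?L\<^esub> x"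
      unfolding *(3,6) frac_add[OF *(1,2,4,5)] frac_add[OF *(4,5,1,2)] using * by (simp add: a_comm m_comm)
  next
    show "\<zero>\<^bsub>?L\<^esub> \<in> carrier ?L" unfolding frac_zero by (intro frac_closed one_nz) simp
  next
    fix x assume "x \<in> carrier ?L"
    then obtain a b where *: "a \<in> carrier R" "b \<in> nz" "x = frac_class R a b" unfolding frac_carrier by blast
    show "\<zero>\<^bsub>?L\<^esub> \<oplus>\<^bsub>?L\<^esub> x = x"
      unfolding frac_zero *(3) using * by (subst frac_add) auto
    have na: "\<ominus> a \<in> carrier R" using * by simp
    have "\<ominus> a \<otimes> b \<oplus> a \<otimes> b = \<zero>" using * by (simp add: l_minus l_neg)
    hence "frac_class R (\<ominus> a) b \<oplus>\<^bsub>?L\<^esub> x = frac_class R \<zero> (b \<otimes> b)"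
      unfolding *(3) frac_add[OF na *(2,1,2)] by simp
    also have "\<dots> = \<zero>\<^bsub>?L\<^esub>" unfolding frac_zero
      by (intro frac_class_eqI nz_mult) (use * in auto)
    finally show "\<exists>y\<in>carrier ?L. y \<oplus>\<^bsub>?L\<^esub> x = \<zero>\<^bsub>?L\<^esub>" using frac_closed[OF na *(2)] by blast
  qed
  show "comm_monoid ?L"
  proof (rule comm_monoidI)
    fix x y z assume "x \<in> carrier ?L" "y \<in> carrier ?L" "z \<in> carrier ?L"
    then obtain a b c d e h where *: "a \<in> carrier R" "b \<in> nz" "x = frac_class R a b"
      "c \<in> carrier R" "d \<in> nz" "y = frac_class R c d" "e \<in> carrier R" "h \<in> nz" "z = frac_class R e h"
      unfolding frac_carrier by blast
    have "b \<otimes> d \<otimes> h = b \<otimes> (d \<otimes> h)" "a \<otimes> c \<otimes> e = a \<otimes> (c \<otimes> e)" using * by (simp_all add: m_assoc)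
    thus "x \<otimes>\<^bsub>?L\<^esub> y \<otimes>\<^bsub>?L\<^esub> z = x \<otimes>\<^bsub>?L\<^esub> (y \<otimes>\<^bsub>?L\<^esub> z)"
      unfolding *(3,6,9) using * by (simp add: frac_mult nz_mult del: Diff_iff)
  next
    fix x y assume "x \<in> carrier ?L" "y \<in> carrier ?L"
    then obtain a b c d where *: "a \<in> carrier R" "b \<in> nz" "x = frac_class R a b"
      "c \<in> carrier R" "d \<in> nz" "y = frac_class R c d" unfolding frac_carrier by blast
    show "x \<otimes>\<^bsub>?L\<^esub> y \<in> carrier ?L"
      unfolding *(3,6) frac_mult[OF *(1,2,4,5)] using * by (intro frac_closed nz_mult) auto
    show "x \<otimes>\<^bsub>?L\<^esub> y = y \<otimes>\<^bsub>?L\<^esub> x"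
      unfolding *(3,6) frac_mult[OF *(1,2,4,5)] frac_mult[OF *(4,5,1,2)] using * by (simp add: m_comm)
  next
    show "\<one>\<^bsub>?L\<^esub> \<in> carrier ?L" unfolding frac_one by (intro frac_closed one_nz) simp
  next
    fix x assume "x \<in> carrier ?L"
    then obtain a b where *: "a \<in> carrier R" "b \<in> nz" "x = frac_class R a b" unfolding frac_carrier by blast
    show "\<one>\<^bsub>?L\<^esub> \<otimes>\<^bsub>?L\<^esub> x = x"
      unfolding frac_one *(3) using * by (subst frac_mult) auto
  qed
  fix x y z assume "x \<in> carrier ?L" "y \<in> carrier ?L" "z \<in> carrier ?L"
  then obtain a b c d e h where *: "a \<in> carrier R" "b \<in> nz" "x = frac_class R a b"
    "c \<in> carrier R" "d \<in> nz" "y = frac_class R c d" "e \<in> carrier R" "h \<in> nz" "z = frac_class R e h"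
    unfolding frac_carrier by blast
  have bdh: "b \<otimes> d \<in> nz" "b \<otimes> h \<in> nz" "d \<otimes> h \<in> nz" using * nz_mult by blast+
  have cl: "a \<otimes> d \<oplus> c \<otimes> b \<in> carrier R" "a \<otimes> e \<in> carrier R" "c \<otimes> e \<in> carrier R" using * by auto
  have "frac_class R ((a \<otimes> d \<oplus> c \<otimes> b) \<otimes> e) (b \<otimes> d \<otimes> h) =
    frac_class R (a \<otimes> e \<otimes> (d \<otimes> h) \<oplus> c \<otimes> e \<otimes> (b \<otimes> h)) (b \<otimes> h \<otimes> (d \<otimes> h))"
  proof (rule frac_class_eqI)
    show "b \<otimes> d \<otimes> h \<in> nz" "b \<otimes> h \<otimes> (d \<otimes> h) \<in> nz" using bdh * nz_mult by blast+
    show "(a \<otimes> d \<oplus> c \<otimes> b) \<otimes> e \<otimes> (b \<otimes> h \<otimes> (d \<otimes> h)) =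
      (a \<otimes> e \<otimes> (d \<otimes> h) \<oplus> c \<otimes> e \<otimes> (b \<otimes> h)) \<otimes> (b \<otimes> d \<otimes> h)"
      using * by (simp add: l_distr r_distr m_ac)
  qed (use * in auto)
  thus "(x \<oplus>\<^bsub>?L\<^esub> y) \<otimes>\<^bsub>?L\<^esub> z = x \<otimes>\<^bsub>?L\<^esub> z \<oplus>\<^bsub>?L\<^esub> y \<otimes>\<^bsub>?L\<^esub> z"
    unfolding *(3,6,9) frac_add[OF *(1,2,4,5)] frac_mult[OF *(1,2,7,8)] frac_mult[OF *(4,5,7,8)]
      frac_mult[OF cl(1) bdh(1) *(7,8)] frac_add[OF cl(2) bdh(2) cl(3) bdh(3)] .
qed

text \<open>The canonical embedding into the field of fractions.\<close>

abbreviation iota :: "'a \<Rightarrow> ('a \<times> 'a) set" where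
  "iota a \<equiv> frac_class R a \<one>"

lemma iota_closed: "a \<in> carrier R \<Longrightarrow> iota a \<in> carrier (frac_field R)"
  by (intro frac_closed one_nz)

lemma iota_mult: "a \<in> carrier R \<Longrightarrow> b \<in> carrier R \<Longrightarrow> iota a \<otimes>\<^bsub>frac_field R\<^esub> iota b = iota (a \<otimes> b)"
  by (simp add: frac_mult)

lemma iota_add: "a \<in> carrier R \<Longrightarrow> b \<in> carrier R \<Longrightarrow> iota a \<oplus>\<^bsub>frac_field R\<^esub> iota b = iota (a \<oplus> b)"
  by (simp add: frac_add)

lemma iota_inj: "a \<in> carrier R \<Longrightarrow> b \<in> carrier R \<Longrightarrow> iota a = iota b \<Longrightarrow> a = b"
  using frac_class_eqD[of a \<one> b \<one>] by simp

lemma iota_pow: "a \<in> carrier R \<Longrightarrow> iota a [^]\<^bsub>frac_field R\<^esub> (n::nat) = iota (a [^] n)"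
  by (induction n) (simp_all add: iota_mult frac_one)

lemma frac_image_subring: "subring (frac_image R) (frac_field R)"
proof -
  interpret L: cring "frac_field R" by (rule frac_cring)
  have neg: "\<ominus>\<^bsub>frac_field R\<^esub> iota a = iota (\<ominus> a)" if "a \<in> carrier R" for a
    using that by (intro L.minus_equality) (simp_all add: iota_add iota_closed l_neg frac_zero)
  show ?thesis
  proof (rule L.subringI)
    show "frac_image R \<subseteq> carrier (frac_field R)" by (auto simp: frac_image_def iota_closed)
    show "\<one>\<^bsub>frac_field R\<^esub> \<in> frac_image R" by (auto simp: frac_image_def frac_one)
    show "\<And>h. h \<in> frac_image R \<Longrightarrow> \<ominus>\<^bsub>frac_field R\<^esub> h \<in> frac_image R"
      by (auto simp: frac_image_def neg)
    show "\<And>h1 h2. h1 \<in> frac_image R \<Longrightarrow> h2 \<in> frac_image R \<Longrightarrow> h1 \<otimes>\<^bsub>frac_field R\<^esub> h2 \<in> frac_image R"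
      by (auto simp: frac_image_def iota_mult)
    show "\<And>h1 h2. h1 \<in> frac_image R \<Longrightarrow> h2 \<in> frac_image R \<Longrightarrow> h1 \<oplus>\<^bsub>frac_field R\<^esub> h2 \<in> frac_image R"
      by (auto simp: frac_image_def iota_add)
  qed
qed

end

text \<open>An integral element whose first powers have the common denominator \<open>d\<close> is almost integral.\<close>

lemma (in cring) integral_almost:
  fixes n :: nat
  assumes B: "subring B R" and q: "q \<in> carrier R"
    and a: "\<And>i. i \<in> {1..n} \<Longrightarrow> a i \<in> B"
    and eq: "q [^] n \<oplus> (\<Oplus>i\<in>{1..n}. a i \<otimes> q [^] (n - i)) = \<zero>"
    and d: "d \<in> carrier R" "\<And>j. j < n \<Longrightarrow> d \<otimes> q [^] j \<in> B"
  shows "d \<otimes> q [^] (j::nat) \<in> B"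
proof (induction j rule: less_induct)
  case (less j)
  note Bc = subringE(1)[OF B]
  have aR: "a i \<in> carrier R" if "i \<in> {1..n}" for i using a[OF that] Bc by blast
  show ?case
  proof (cases "j < n")
    case False
    let ?F = "\<lambda>i. a i \<otimes> q [^] (n - i)"
    have F: "?F \<in> {1..n} \<rightarrow> carrier R" using aR q by simp
    let ?c = "d \<otimes> q [^] (j - n)"
    have cR: "?c \<in> carrier R" using d q by simp
    have "q [^] n = \<ominus> (finsum R ?F {1..n})"
      using eq F q by (intro minus_equality[symmetric]) (simp_all)
    hence "?c \<otimes> q [^] n = \<ominus> (?c \<otimes> finsum R ?F {1..n})" using cR F by (simp add: r_minus)
    also have "?c \<otimes> finsum R ?F {1..n} = (\<Oplus>i\<in>{1..n}. ?c \<otimes> ?F i)"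
      using cR F by (intro finsum_rdistr) auto
    also have "\<dots> = (\<Oplus>i\<in>{1..n}. a i \<otimes> (d \<otimes> q [^] (j - i)))"
    proof (rule finsum_cong')
      fix i assume i: "i \<in> {1..n}"
      have "q [^] (j - i) = q [^] (j - n) \<otimes> q [^] (n - i)" using q i False by (simp add: nat_pow_mult)
      thus "?c \<otimes> ?F i = a i \<otimes> (d \<otimes> q [^] (j - i))" using d q aR[OF i] by (simp add: m_ac)
    qed (use d q aR in auto)
    finally have "?c \<otimes> q [^] n = \<ominus> (\<Oplus>i\<in>{1..n}. a i \<otimes> (d \<otimes> q [^] (j - i)))" .
    moreover have "?c \<otimes> q [^] n = d \<otimes> q [^] j" using d q False by (simp add: m_assoc nat_pow_mult)
    moreover have "(\<Oplus>i\<in>S. a i \<otimes> (d \<otimes> q [^] (j - i))) \<in> B" if "finite S" "S \<subseteq> {1..n}" for S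
      using that
    proof (induction S rule: finite_induct)
      case empty thus ?case using subringE(2)[OF B] by simp
    next
      case (insert x S)
      have "d \<otimes> q [^] (j - x) \<in> B" by (rule less) (use insert False in auto)
      hence "a x \<otimes> (d \<otimes> q [^] (j - x)) \<in> B" using subringE(6)[OF B] a insert by blast
      moreover have "(\<lambda>i. a i \<otimes> (d \<otimes> q [^] (j - i))) \<in> S \<rightarrow> carrier R" using d q aR insert by auto
      ultimately show ?case using insert subringE(7)[OF B] Bc by (simp add: subset_iff)
    qed
    ultimately show ?thesis using subringE(5)[OF B] by simp
  qed (rule d)
qed

text \<open>A completely integrally closed domain is integrally closed: if \<open>a/b\<close> is integral of degree \<open>n\<close>, then
  \<open>b\<^sup>n\<close> is a common denominator of its powers.\<close>

lemma (in domain) integrally_closedI: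
  assumes cic: "\<And>a b d. \<lbrakk>a \<in> carrier R; b \<in> nz; d \<in> nz;
    \<And>j::nat. \<exists>s\<in>carrier R. d \<otimes> a [^] j = s \<otimes> b [^] j\<rbrakk> \<Longrightarrow> \<exists>s\<in>carrier R. a = s \<otimes> b"
  shows "integrally_closed R"
  unfolding integrally_closed_def
proof (intro ballI impI)
  let ?L = "frac_field R"
  interpret L: cring ?L by (rule frac_cring)
  fix q assume qL: "q \<in> carrier ?L" and "integral_over_subring ?L (frac_image R) q"
  then obtain n :: nat and c where c: "\<forall>i\<in>{1..n}. c i \<in> frac_image R"
    "q [^]\<^bsub>?L\<^esub> n \<oplus>\<^bsub>?L\<^esub> (\<Oplus>\<^bsub>?L\<^esub>i\<in>{1..n}. c i \<otimes>\<^bsub>?L\<^esub> q [^]\<^bsub>?L\<^esub> (n - i)) = \<zero>\<^bsub>?L\<^esub>"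
    unfolding integral_over_subring_def by blast
  obtain a b where ab: "a \<in> carrier R" "b \<in> nz" "q = frac_class R a b" using qL unfolding frac_carrier by blast
  have bR: "b \<in> carrier R" using ab by simp
  have qb: "q \<otimes>\<^bsub>?L\<^esub> iota b = iota a"
    unfolding ab(3) frac_mult[OF ab(1,2) bR one_nz] by (intro frac_class_eqI nz_mult) (use ab in \<open>auto simp: m_ac\<close>)
  have qbj: "q [^]\<^bsub>?L\<^esub> j \<otimes>\<^bsub>?L\<^esub> iota (b [^] j) = iota (a [^] j)" for j :: nat
    using L.nat_pow_distrib[OF qL iota_closed[OF bR], of j] by (simp add: qb iota_pow[OF bR] iota_pow[OF ab(1)])
  have bn: "b [^] j \<in> nz" for j :: nat using ab by (induction j) (auto simp: integral_iff)
  have "iota (b [^] n) \<otimes>\<^bsub>?L\<^esub> q [^]\<^bsub>?L\<^esub> j \<in> frac_image R" for j :: nat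
  proof (rule L.integral_almost[OF frac_image_subring qL _ c(2)])
    fix j assume "j < n"
    hence "b [^] n = b [^] (n - j) \<otimes> b [^] j" using bR by (simp add: nat_pow_mult)
    hence "iota (b [^] n) \<otimes>\<^bsub>?L\<^esub> q [^]\<^bsub>?L\<^esub> j = iota (b [^] (n - j)) \<otimes>\<^bsub>?L\<^esub> (q [^]\<^bsub>?L\<^esub> j \<otimes>\<^bsub>?L\<^esub> iota (b [^] j))"
      using bR qL iota_closed by (simp flip: iota_mult add: L.m_ac)
    also have "\<dots> = iota (b [^] (n - j) \<otimes> a [^] j)" unfolding qbj using ab bR by (simp add: iota_mult)
    finally show "iota (b [^] n) \<otimes>\<^bsub>?L\<^esub> q [^]\<^bsub>?L\<^esub> j \<in> frac_image R" using ab bR by (simp add: frac_image_def)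
  qed (use c bR iota_closed in auto)
  hence alm: "\<exists>s\<in>carrier R. b [^] n \<otimes> a [^] j = s \<otimes> b [^] j" for j :: nat
  proof -
    obtain s where s: "s \<in> carrier R" "iota (b [^] n) \<otimes>\<^bsub>?L\<^esub> q [^]\<^bsub>?L\<^esub> j = iota s"
      using \<open>iota (b [^] n) \<otimes>\<^bsub>?L\<^esub> q [^]\<^bsub>?L\<^esub> j \<in> frac_image R\<close> unfolding frac_image_def by blast
    have "iota (b [^] n \<otimes> a [^] j) = iota (b [^] n) \<otimes>\<^bsub>?L\<^esub> (q [^]\<^bsub>?L\<^esub> j \<otimes>\<^bsub>?L\<^esub> iota (b [^] j))"
      unfolding qbj using ab bR by (simp add: iota_mult)
    also have "\<dots> = iota s \<otimes>\<^bsub>?L\<^esub> iota (b [^] j)"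
      unfolding s(2)[symmetric] using qL iota_closed bR by (simp add: L.m_assoc)
    also have "\<dots> = iota (s \<otimes> b [^] j)" using s bR by (simp add: iota_mult)
    finally have "b [^] n \<otimes> a [^] j = s \<otimes> b [^] j" by (rule iota_inj[rotated 2]) (use s ab bR in auto)
    thus ?thesis using s by blast
  qed
  obtain s where s: "s \<in> carrier R" "a = s \<otimes> b" using cic[OF ab(1,2) bn alm] by blast
  have "q = iota s" unfolding ab(3) by (intro frac_class_eqI) (use s ab in auto)
  thus "q \<in> frac_image R" using s by (simp add: frac_image_def)
qed

text \<open>If \<open>f = u\<^sup>2\<close> and \<open>g = v\<^sup>2\<close> with \<open>uv \<notin> (f,g)\<close>, then the element \<open>uvt\<close> is a witness against the
  integral closedness of \<open>R[ft,gt]\<close>: its square is \<open>ft \<cdot> gt\<close>.\<close>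

lemma (in domain) rees_not_integrally_closed:
  assumes u: "u \<in> carrier R" and v: "v \<in> carrier R" and f: "f = u \<otimes> u" and g: "g = v \<otimes> v"
    and f0: "f \<noteq> \<zero>" and uv: "u \<otimes> v \<notin> Idl {f, g}"
  shows "\<not> integrally_closed (adjoin_t R {f, g})"
proof
  let ?S = "adjoin_t R {f, g}"
  let ?L = "frac_field ?S"
  let ?m = "up_ring.monom (UP R)"
  interpret U: UP_domain R "UP R" by (simp add: UP_domain_def domain_axioms)
  have fR: "f \<in> carrier R" and gR: "g \<in> carrier R" using u v f g by auto
  interpret S: domain ?S by (rule domain_adjoin) (use fR gR in simp)
  interpret L: cring ?L by (rule S.frac_cring)
  have ops: "x \<otimes>\<^bsub>?S\<^esub> y = x \<otimes>\<^bsub>UP R\<^esub> y" "\<one>\<^bsub>?S\<^esub> = \<one>\<^bsub>UP R\<^esub>" "\<zero>\<^bsub>?S\<^esub> = \<zero>\<^bsub>UP R\<^esub>" for x y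
    by (simp_all add: adjoin_t_def)
  have car: "carrier ?S = {p \<in> carrier (UP R). \<forall>n. up_ring.coeff (UP R) p n \<in> ideal_pow R (Idl {f, g}) n}"
    by (rule rees_carrier(1)[OF fR gR refl])
  assume ic: "integrally_closed ?S"
  have I: "ideal (Idl {f, g}) R" using fR gR by (intro genideal_ideal) simp
  have mult: "?m a n \<otimes>\<^bsub>?S\<^esub> ?m b k = ?m (a \<otimes> b) (n + k)" if "a \<in> carrier R" "b \<in> carrier R" for a b n k
    unfolding ops using U.monom_mult[OF that] by simp
  have gens: "?m a 0 \<in> carrier ?S" if "a \<in> carrier R" for a
    using that by (auto simp: adjoin_t_def intro: generate_ring.incl)
  have genf: "?m f 1 \<in> carrier ?S" "?m g 1 \<in> carrier ?S"
    by (auto simp: adjoin_t_def intro: generate_ring.incl)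
  define n where "n = ?m (u \<otimes> v \<otimes> f) 1"
  define d where "d = ?m f 0"
  have nS: "n \<in> carrier ?S"
    using S.m_closed[OF gens genf(1), of "u \<otimes> v"] mult[of "u \<otimes> v" f 0 1] u v fR by (simp add: n_def)
  have dS: "d \<in> carrier ?S" unfolding d_def by (rule gens[OF fR])
  have "d \<noteq> \<zero>\<^bsub>UP R\<^esub>"
  proof
    assume "d = \<zero>\<^bsub>UP R\<^esub>"
    hence "up_ring.coeff (UP R) d 0 = \<zero>" by simp
    thus False using f0 fR by (simp add: d_def)
  qed
  hence dn: "d \<in> S.nz" using dS ops by auto
  define q where "q = frac_class ?S n d"
  have qL: "q \<in> carrier ?L" unfolding q_def by (rule S.frac_closed[OF nS dn])
  define w where "w = ?m (f \<otimes> g) 2"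
  have wS: "w \<in> carrier ?S"
    using S.m_closed[OF genf] mult[of f g 1 1] fR gR by (simp add: w_def numeral_2_eq_2)
  have q2: "q \<otimes>\<^bsub>?L\<^esub> q = S.iota w"
    unfolding q_def S.frac_mult[OF nS dn nS dn]
  proof (rule S.frac_class_eqI)
    have "n \<otimes>\<^bsub>?S\<^esub> n = ?m ((u \<otimes> v \<otimes> f) \<otimes> (u \<otimes> v \<otimes> f)) 2"
      unfolding n_def using mult[of "u \<otimes> v \<otimes> f" "u \<otimes> v \<otimes> f" 1 1] u v fR by (simp add: numeral_2_eq_2)
    also have "(u \<otimes> v \<otimes> f) \<otimes> (u \<otimes> v \<otimes> f) = (f \<otimes> g) \<otimes> (f \<otimes> f)"
      unfolding f g using u v by (simp add: m_ac)
    also have "?m \<dots> 2 = w \<otimes>\<^bsub>?S\<^esub> (d \<otimes>\<^bsub>?S\<^esub> d)"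
      unfolding w_def d_def using mult[of f f 0 0] mult[of "f \<otimes> g" "f \<otimes> f" 2 0] fR gR by simp
    finally show "n \<otimes>\<^bsub>?S\<^esub> n \<otimes>\<^bsub>?S\<^esub> \<one>\<^bsub>?S\<^esub> = w \<otimes>\<^bsub>?S\<^esub> (d \<otimes>\<^bsub>?S\<^esub> d)"
      using S.r_one[OF S.m_closed[OF nS nS]] by (rule trans[rotated])
  qed (use nS dn wS S.nz_mult S.one_nz in auto)
  have sub: "subring (frac_image ?S) ?L" by (rule S.frac_image_subring)
  define c where "c i = (if i = 1 then \<zero>\<^bsub>?L\<^esub> else \<ominus>\<^bsub>?L\<^esub> S.iota w)" for i :: nat
  have wL: "S.iota w \<in> carrier ?L" by (rule S.iota_closed[OF wS])
  have cL: "c i \<in> frac_image ?S" for i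
    using subringE(2,5)[OF sub] wS by (auto simp: c_def frac_image_def)
  have "{1..2::nat} = {1, 2}" by auto
  hence "(\<Oplus>\<^bsub>?L\<^esub>i\<in>{1..2}. c i \<otimes>\<^bsub>?L\<^esub> q [^]\<^bsub>?L\<^esub> (2 - i)) = \<ominus>\<^bsub>?L\<^esub> S.iota w"
    using wL qL by (simp add: c_def L.finsum_insert)
  hence "q [^]\<^bsub>?L\<^esub> (2::nat) \<oplus>\<^bsub>?L\<^esub> (\<Oplus>\<^bsub>?L\<^esub>i\<in>{1..2}. c i \<otimes>\<^bsub>?L\<^esub> q [^]\<^bsub>?L\<^esub> (2 - i)) = \<zero>\<^bsub>?L\<^esub>"
    using wL qL q2 by (simp add: numeral_2_eq_2 L.r_neg)
  hence "integral_over_subring ?L (frac_image ?S) q"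
    unfolding integral_over_subring_def using cL
    by (intro exI[of _ "2 :: nat"] conjI exI[of _ c] ballI) simp_all
  hence "q \<in> frac_image ?S" using ic qL unfolding integrally_closed_def by blast
  then obtain s where s: "s \<in> carrier ?S" "q = S.iota s" unfolding frac_image_def by blast
  have "n \<otimes>\<^bsub>?S\<^esub> \<one>\<^bsub>?S\<^esub> = s \<otimes>\<^bsub>?S\<^esub> d" by (rule S.frac_class_eqD[OF nS dn]) (use s q_def in simp)
  hence "n = d \<otimes>\<^bsub>?S\<^esub> s" using nS s dS S.m_comm by simp
  moreover have sU: "s \<in> carrier (UP R)" and s1: "up_ring.coeff (UP R) s 1 \<in> ideal_pow R (Idl {f, g}) 1"
    using s unfolding car by blast+
  ultimately have "n = f \<odot>\<^bsub>UP R\<^esub> s" unfolding ops d_def using U.monom_mult_is_smult[OF fR sU] by simp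
  hence "up_ring.coeff (UP R) n 1 = f \<otimes> up_ring.coeff (UP R) s 1" using fR sU by simp
  moreover have "up_ring.coeff (UP R) n 1 = f \<otimes> (u \<otimes> v)" unfolding n_def using u v fR by (simp add: m_ac)
  ultimately have "f \<otimes> (u \<otimes> v) = f \<otimes> up_ring.coeff (UP R) s 1" by (rule trans[OF sym, rotated])
  hence "u \<otimes> v = up_ring.coeff (UP R) s 1"
    by (rule iffD1[OF m_lcancel[OF f0 fR m_closed[OF u v] U.coeff_closed[OF sU]]])
  thus False using uv s1 unfolding ideal_pow_1[OF I] by metis
qed

section \<open>Subrings of a field as rings with carrier\<close>

text \<open>A subring of a field type as a ring with carrier.\<close>

definition tring :: "'a::field set \<Rightarrow> 'a ring" where
  "tring S = ring_of_type_algebra\<lparr>carrier := S\<rparr>"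

lemma tring_simps [simp]:
  "carrier (tring S) = S" "x \<otimes>\<^bsub>tring S\<^esub> y = x * y" "x \<oplus>\<^bsub>tring S\<^esub> y = x + y"
  "\<one>\<^bsub>tring S\<^esub> = 1" "\<zero>\<^bsub>tring S\<^esub> = 0"
  by (simp_all add: ring_of_type_algebra_def tring_def)

lemma tring_pow [simp]: "x [^]\<^bsub>tring S\<^esub> (n::nat) = x ^ n"
  by (induction n) (simp_all add: Group.nat_pow_def mult.commute)

lemma domain_tring: assumes S: "subrng S" shows "domain (tring S)"
proof -
  interpret F: field "ring_of_type_algebra :: 'a ring" by (rule field_from_type_algebra)
  have "subring S (ring_of_type_algebra :: 'a ring)"
    by (rule F.subringI) (use S in \<open>auto simp: ring_of_type_algebra_def
      minus_ring_of_type_algebra[unfolded ring_of_type_algebra_def] intro!: subrng_closed\<close>)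
  thus ?thesis unfolding tring_def by (rule F.subring_is_domain)
qed

lemma tring_finsum:
  assumes S: "subrng S" shows "(\<And>i. i \<in> I \<Longrightarrow> h i \<in> S) \<Longrightarrow> finsum (tring S) h I = sum h I"
proof (induction I rule: infinite_finite_induct)
  case (insert x F)
  interpret domain "tring S" by (rule domain_tring[OF S])
  have "finsum (tring S) h (insert x F) = h x \<oplus>\<^bsub>tring S\<^esub> finsum (tring S) h F"
    using insert by (intro finsum_insert) auto
  thus ?case using insert by simp
next
  case (infinite I)
  interpret domain "tring S" by (rule domain_tring[OF S])
  show ?case using infinite finsum_infinite[of I h] by simp
next
  case empty
  interpret domain "tring S" by (rule domain_tring[OF S])
  show ?case by simp
qed

text \<open>Polynomials over \<open>tring S\<close> as elements of \<open>'a poly\<close>.\<close>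

lemma tring_up:
  assumes "p \<in> carrier (UP (tring S))"
  shows "\<And>n. p n \<in> S" "coeff (Abs_poly p) = p" "up_ring.coeff (UP (tring S)) p = p"
proof -
  have p: "p \<in> up (tring S)" using assms by (simp add: UP_def)
  show "\<And>n. p n \<in> S" using mem_upD[OF p] by simp
  obtain n where "bound 0 n p" using p by (auto simp: up_def)
  hence "\<forall>m>n. p m = 0" by (auto simp: bound_def)
  hence "\<forall>\<^sub>\<infinity>n. p n = 0" unfolding MOST_nat by blast
  thus "coeff (Abs_poly p) = p" by (simp add: Abs_poly_inverse)
  show "up_ring.coeff (UP (tring S)) p = p" using p by (simp add: UP_def)
qed

lemma coeff_up: assumes "\<And>n. coeff p n \<in> S" shows "coeff p \<in> carrier (UP (tring S))"
proof -
  have "bound 0 (degree p) (coeff p)" by (simp add: bound_def coeff_eq_0)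
  thus ?thesis using assms by (auto simp: UP_def up_def)
qed

lemma tring_UP_mult:
  assumes S: "subrng S" and p: "p \<in> carrier (UP (tring S))" and q: "q \<in> carrier (UP (tring S))"
  shows "Abs_poly (p \<otimes>\<^bsub>UP (tring S)\<^esub> q) = Abs_poly p * Abs_poly q"
proof -
  interpret domain "tring S" by (rule domain_tring[OF S])
  interpret U: UP_cring "tring S" "UP (tring S)" by (rule UP_cring_R)
  have pq: "p \<otimes>\<^bsub>UP (tring S)\<^esub> q \<in> carrier (UP (tring S))" using p q by simp
  have "(p \<otimes>\<^bsub>UP (tring S)\<^esub> q) n = (\<Sum>i\<le>n. p i * q (n - i))" for n
  proof -
    have "(p \<otimes>\<^bsub>UP (tring S)\<^esub> q) n = up_ring.coeff (UP (tring S)) (p \<otimes>\<^bsub>UP (tring S)\<^esub> q) n"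
      by (simp only: tring_up(3)[OF pq])
    also have "\<dots> = finsum (tring S) (\<lambda>i. p i * q (n - i)) {..n}"
      unfolding U.coeff_mult[OF p q] tring_up(3)[OF p] tring_up(3)[OF q] by simp
    also have "\<dots> = (\<Sum>i\<le>n. p i * q (n - i))"
      by (rule tring_finsum[OF S]) (intro subrng_mult[OF S] tring_up(1)[OF p] tring_up(1)[OF q])
    finally show ?thesis .
  qed
  thus ?thesis by (intro poly_eqI) (simp add: tring_up(2)[OF pq] tring_up(2)[OF p] tring_up(2)[OF q] coeff_mult)
qed

lemma tring_UP_one: assumes "subrng S" shows "Abs_poly \<one>\<^bsub>UP (tring S)\<^esub> = 1"
proof -
  interpret domain "tring S" by (rule domain_tring[OF assms])
  interpret U: UP_cring "tring S" "UP (tring S)" by (rule UP_cring_R)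
  have 1: "\<one>\<^bsub>UP (tring S)\<^esub> \<in> carrier (UP (tring S))" by simp
  have "\<one>\<^bsub>UP (tring S)\<^esub> = (\<lambda>i. if i = 0 then 1 else 0)" by (simp add: UP_def fun_eq_iff)
  thus ?thesis using tring_up(2)[OF 1] by (intro poly_eqI) (simp add: coeff_1)
qed

context setting
begin

text \<open>The ring \<open>A\<close> and its ideal \<open>P = (f,g)A\<close>.\<close>

abbreviation Ar :: "'k kyzx ring" where
  "Ar \<equiv> tring A"

abbreviation PI :: "'k kyzx set" where
  "PI \<equiv> Idl\<^bsub>Ar\<^esub> {f_el \<alpha>, g_el \<beta>}"

lemma A_ring_eq: "A_ring \<alpha> \<beta> = Ar"
  by (simp add: A_ring_def A_def K_def tring_def)

lemma domain_Ar: "domain Ar"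
  by (rule domain_tring[OF subrng_A])

lemma cring_Ar: "cring Ar"
  using domain_Ar by (rule domain.axioms)

lemma PI_eq: "PI = P 1"
proof -
  interpret cring Ar by (rule cring_Ar)
  have "PI = {a * f_el \<alpha> + b * g_el \<beta> | a b. a \<in> A \<and> b \<in> A}"
    using Idl2[of "f_el \<alpha>" "g_el \<beta>"] f_A g_A by simp
  also have "\<dots> = P 1" by (auto simp: mult.commute)
  finally show ?thesis .
qed

lemma PI_ideal: "ideal PI Ar"
proof -
  interpret cring Ar by (rule cring_Ar)
  show ?thesis by (rule genideal_ideal) (use f_A g_A in simp)
qed

lemma ideal_pow_PI: "ideal_pow Ar PI n = P n"
proof (induction n)
  case 0
  interpret cring Ar by (rule cring_Ar)
  show ?case by (simp add: ideal_pow_0)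
next
  case (Suc n)
  interpret cring Ar by (rule cring_Ar)
  have "P n \<cdot>\<^bsub>Ar\<^esub> PI = P (Suc n)"
  proof
    show "P n \<cdot>\<^bsub>Ar\<^esub> PI \<subseteq> P (Suc n)"
    proof
      fix c assume "c \<in> P n \<cdot>\<^bsub>Ar\<^esub> PI"
      thus "c \<in> P (Suc n)"
      proof (induction c rule: ideal_prod.induct)
        case (prod i j)
        thus ?case using pw_mult[OF subrng_A, of i "f_el \<alpha>" "g_el \<beta>" n j 1] unfolding PI_eq
          by (simp del: pw.simps)
      next
        case (sum s1 s2)
        thus ?case using pw_add[OF subrng_A] by (simp del: pw.simps)
      qed
    qed
    show "P (Suc n) \<subseteq> P n \<cdot>\<^bsub>Ar\<^esub> PI"
    proof
      fix c assume "c \<in> P (Suc n)"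
      then obtain a b where ab: "a \<in> P n" "b \<in> P n" "c = f_el \<alpha> * a + g_el \<beta> * b" by (rule pw_SucE)
      have "f_el \<alpha> \<in> PI" "g_el \<beta> \<in> PI" using genideal_self[of "{f_el \<alpha>, g_el \<beta>}"] f_A g_A by auto
      hence "a \<otimes>\<^bsub>Ar\<^esub> f_el \<alpha> \<in> P n \<cdot>\<^bsub>Ar\<^esub> PI" "b \<otimes>\<^bsub>Ar\<^esub> g_el \<beta> \<in> P n \<cdot>\<^bsub>Ar\<^esub> PI"
        using ab by (auto intro: ideal_prod.prod simp del: tring_simps)
      hence "a \<otimes>\<^bsub>Ar\<^esub> f_el \<alpha> \<oplus>\<^bsub>Ar\<^esub> b \<otimes>\<^bsub>Ar\<^esub> g_el \<beta> \<in> P n \<cdot>\<^bsub>Ar\<^esub> PI" by (rule ideal_prod.sum)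
      thus "c \<in> P n \<cdot>\<^bsub>Ar\<^esub> PI" by (simp add: ab mult.commute)
    qed
  qed
  thus ?case using Suc by (simp only: ideal_pow_Suc)
qed

lemma P_mono: "n \<le> m \<Longrightarrow> P m \<subseteq> P n"
  by (induction m rule: dec_induct) (use pw_mono_Suc[OF subrng_A f_A g_A] in blast)+

lemma f_nz: "f_el \<alpha> \<noteq> 0"
  unfolding emb_ff[symmetric] by (rule emb_nz) (simp add: ff_def uu_def)

section \<open>Normality of \<open>P\<close> and of its Rees algebra\<close>

text \<open>If \<open>r\<close> satisfies an equation of degree \<open>m\<close> of integral dependence over \<open>P\<^sup>n\<close>, then
  \<open>e r\<^sup>j \<in> P\<^sup>n\<^sup>j\<close> for \<open>e = f\<^sup>n\<^sup>m\<close> and all \<open>j\<close>.\<close>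

theorem normal_PI: "normal_ideal Ar PI"
  unfolding normal_ideal_def integrally_closed_ideal_def
proof (intro allI impI ballI)
  interpret cring Ar by (rule cring_Ar)
  fix n r assume r: "r \<in> carrier Ar" and int: "integral_over_ideal Ar (ideal_pow Ar PI n) r"
  then obtain m :: nat and a where a: "\<forall>i\<in>{1..m}. a i \<in> ideal_pow Ar (ideal_pow Ar PI n) i"
    and eq: "r [^]\<^bsub>Ar\<^esub> m \<oplus>\<^bsub>Ar\<^esub> (\<Oplus>\<^bsub>Ar\<^esub>i\<in>{1..m}. a i \<otimes>\<^bsub>Ar\<^esub> r [^]\<^bsub>Ar\<^esub> (m - i)) = \<zero>\<^bsub>Ar\<^esub>"
    unfolding integral_over_ideal_def by blast
  have rA: "r \<in> A" using r by simp
  have aP: "a i \<in> P (n * i)" if "i \<in> {1..m}" for i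
    using a that ideal_pow_pow[OF PI_ideal] ideal_pow_PI by blast
  have aA: "a i \<in> A" if "i \<in> {1..m}" for i using aP[OF that] P_A by blast
  have "(\<Oplus>\<^bsub>Ar\<^esub>i\<in>{1..m}. a i \<otimes>\<^bsub>Ar\<^esub> r [^]\<^bsub>Ar\<^esub> (m - i)) = (\<Sum>i=1..m. a i * r ^ (m - i))"
    using tring_finsum[OF subrng_A, of "{1..m}" "\<lambda>i. a i * r ^ (m - i)"] aA rA
    by (simp add: subrng_mult[OF subrng_A] subrng_power[OF subrng_A])
  hence rm: "r ^ m = - (\<Sum>i=1..m. a i * r ^ (m - i))" using eq by (simp add: eq_neg_iff_add_eq_0)
  define e where "e = f_el \<alpha> ^ (n * m)"
  have eP: "e \<in> P (n * m)" using f_power_P[OF subrng_1[OF subrng_A]] by (simp add: e_def)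
  have "e * r ^ j \<in> P (n * j)" for j
  proof (induction j rule: less_induct)
    case (less j)
    show ?case
    proof (cases "j < m")
      case True
      hence "e \<in> P (n * j)" using eP P_mono[of "n * j" "n * m"] by auto
      thus ?thesis using pw_smult[OF subrng_A subrng_power[OF subrng_A rA]] by (metis mult.commute)
    next
      case False
      have "r ^ j = r ^ (j - m) * r ^ m" using False by (simp flip: power_add)
      hence "e * r ^ j = - (\<Sum>i=1..m. e * r ^ (j - m) * (a i * r ^ (m - i)))"
        by (simp add: rm sum_distrib_left mult.assoc)
      also have "(\<Sum>i=1..m. e * r ^ (j - m) * (a i * r ^ (m - i))) = (\<Sum>i=1..m. a i * (e * r ^ (j - i)))"
      proof (rule sum.cong)
        fix i assume "i \<in> {1..m}"
        hence "r ^ (j - i) = r ^ (j - m) * r ^ (m - i)" using False by (simp flip: power_add)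
        thus "e * r ^ (j - m) * (a i * r ^ (m - i)) = a i * (e * r ^ (j - i))" by (simp add: mult_ac)
      qed simp
      also have "- (\<Sum>i=1..m. a i * (e * r ^ (j - i))) = 0 - (\<Sum>i=1..m. a i * (e * r ^ (j - i)))" by simp
      also have "\<dots> \<in> P (n * j)"
      proof (intro pw_diff[OF subrng_A] pw_0[OF subrng_A] pw_sum[OF subrng_A])
        fix i assume i: "i \<in> {1..m}"
        have "e * r ^ (j - i) \<in> P (n * (j - i))" by (rule less) (use i False in auto)
        from pw_mult[OF subrng_A aP[OF i] this] show "a i * (e * r ^ (j - i)) \<in> P (n * j)"
          using i False by (simp flip: add_mult_distrib2)
      qed
      finally show ?thesis .
    qed
  qed
  hence "e * r ^ j \<in> P (0 + j * n)" for j by (simp add: mult.commute)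
  hence "r \<in> P n" by (rule P_cic[rotated]) (simp add: e_def f_nz)
  thus "r \<in> ideal_pow Ar PI n" by (simp only: ideal_pow_PI)
qed

text \<open>The Rees algebra of \<open>P\<close> inside \<open>'k kyzx poly\<close>.\<close>

definition RP :: "'k kyzx poly set" where
  "RP = {p. \<forall>n. coeff p n \<in> P n}"

lemma subrng_RP: "subrng RP"
proof -
  have "1 \<in> RP" using pw_0[OF subrng_A] subrng_1[OF subrng_A] by (simp add: RP_def coeff_1)
  moreover have "p - q \<in> RP" "p * q \<in> RP" if "p \<in> RP" "q \<in> RP" for p q
  proof -
    show "p - q \<in> RP" using that pw_diff[OF subrng_A] by (simp add: RP_def)
    have "coeff p i * coeff q (n - i) \<in> P n" if "i \<le> n" for i n
      using pw_mult[OF subrng_A, of "coeff p i" _ _ i "coeff q (n - i)" "n - i"] \<open>p \<in> RP\<close> \<open>q \<in> RP\<close> that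
      by (simp add: RP_def)
    thus "p * q \<in> RP" by (auto simp: RP_def coeff_mult intro!: pw_sum[OF subrng_A])
  qed
  ultimately show ?thesis by (simp add: subrng_def)
qed

text \<open>The leading coefficient of an almost integral polynomial of degree \<open>n\<close> lies in \<open>P\<^sup>n\<close> and can be
  split off.\<close>

lemma RP_almost: "d \<noteq> 0 \<Longrightarrow> almost RP d q 1 \<Longrightarrow> q \<in> RP"
proof (induction "degree q" arbitrary: q rule: less_induct)
  case less
  have dq: "d * q ^ j \<in> RP" for j
  proof -
    obtain s where "s \<in> RP" "d * q ^ j = s * 1 ^ j" using less.prems(2) unfolding almost_def by blast
    thus ?thesis by simp
  qed
  show ?case
  proof (cases "q = 0")
    case True thus ?thesis using subrng_0[OF subrng_RP] by simp
  next
    case False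
    have "lead_coeff d * lead_coeff q ^ j \<in> P (degree d + j * degree q)" for j
    proof -
      have "lead_coeff (d * q ^ j) \<in> P (degree (d * q ^ j))" using dq[of j] unfolding RP_def by blast
      hence "lead_coeff d * lead_coeff q ^ j \<in> P (degree (d * q ^ j))"
        by (simp only: lead_coeff_mult lead_coeff_power)
      moreover have "degree (d * q ^ j) = degree d + j * degree q"
        using False less.prems(1) by (subst degree_mult_eq) (simp_all add: degree_power_eq)
      ultimately show ?thesis by (simp only:)
    qed
    hence l: "lead_coeff q \<in> P (degree q)" by (rule P_cic[rotated]) (use less.prems in simp)
    let ?m = "monom (lead_coeff q) (degree q)"
    let ?q = "1 * q + (- ?m) * 1"
    have mR: "?m \<in> RP" using l pw_0[OF subrng_A] by (simp add: RP_def)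
    have al: "almost RP d ?q 1"
      by (rule almost_lin[OF subrng_RP less.prems(2) subrng_1[OF subrng_RP] subrng_minus[OF subrng_RP mR]])
    have "degree ?q \<le> degree q" by (simp add: degree_diff_le degree_monom_le)
    moreover have "coeff ?q (degree q) = 0" by simp
    ultimately have "?q = 0 \<or> degree ?q < degree q" by (metis le_neq_implies_less leading_coeff_0_iff)
    hence "?q \<in> RP" using less.hyps[OF _ less.prems(1) al] subrng_0[OF subrng_RP] by auto
    from subrng_add[OF subrng_RP this mR] show ?thesis by simp
  qed
qed

text \<open>The quotient is a polynomial by the division algorithm over the ambient field.\<close>

lemma RP_cic:
  assumes b: "b \<noteq> 0" and d: "d \<noteq> 0" and al: "almost RP d a b"
  shows "\<exists>s\<in>RP. a = s * b"
proof -
  have U: "subrng (UNIV :: 'k kyzx poly set)" by (simp add: subrng_def)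
  have "almost UNIV d a b" using al unfolding almost_def by blast
  from almost_lin[OF U this, of 1 "- (a div b)"] have "almost UNIV d (a mod b) b"
    by (simp add: minus_div_mult_eq_mod)
  hence "a mod b = 0" by (rule almost_deg_less[OF _ d b]) (use b degree_mod_less in blast)
  hence a: "a = (a div b) * b" by (metis add.right_neutral div_mult_mod_eq)
  have "almost RP d (a div b) 1"
    unfolding almost_def
  proof
    fix j
    obtain s where s: "s \<in> RP" "d * a ^ j = s * b ^ j" using al unfolding almost_def by blast
    have "(d * (a div b) ^ j) * b ^ j = s * b ^ j" using s(2) a by (metis mult.assoc power_mult_distrib)
    hence "d * (a div b) ^ j = s * 1 ^ j" using b by simp
    thus "\<exists>s\<in>RP. d * (a div b) ^ j = s * 1 ^ j" using s(1) by blast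
  qed
  from RP_almost[OF d this] a show ?thesis by blast
qed

theorem rees_integrally_closed: "integrally_closed (adjoin_t Ar PI)"
proof -
  interpret R: domain Ar by (rule domain_Ar)
  interpret U: UP_domain Ar "UP Ar" by (simp add: UP_domain_def domain_Ar)
  let ?S = "adjoin_t Ar PI"
  have PA: "PI \<subseteq> carrier Ar" using ideal.Icarr[OF PI_ideal] by blast
  interpret S: domain ?S by (rule R.domain_adjoin[OF PA])
  have car: "carrier ?S = {p \<in> carrier (UP Ar). \<forall>n. up_ring.coeff (UP Ar) p n \<in> ideal_pow Ar PI n}"
    by (rule R.rees_carrier(2)) (use f_A g_A in auto)
  have up: "p \<in> carrier (UP Ar)" and RP: "Abs_poly p \<in> RP" if "p \<in> carrier ?S" for p
  proof -
    show 1: "p \<in> carrier (UP Ar)" using that unfolding car by blast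
    have "p n \<in> P n" for n using that tring_up(3)[OF 1] unfolding car ideal_pow_PI by simp
    thus "Abs_poly p \<in> RP" by (simp add: RP_def tring_up(2)[OF 1])
  qed
  have RP': "coeff s \<in> carrier ?S" if "s \<in> RP" for s
  proof -
    have s: "coeff s n \<in> P n" for n using that by (simp add: RP_def)
    hence "coeff s \<in> carrier (UP Ar)" using P_A by (intro coeff_up) blast
    thus ?thesis unfolding car ideal_pow_PI using s by (simp add: tring_up(3))
  qed
  have mult: "Abs_poly (p \<otimes>\<^bsub>?S\<^esub> q) = Abs_poly p * Abs_poly q" if "p \<in> carrier ?S" "q \<in> carrier ?S" for p q
    using tring_UP_mult[OF subrng_A up[OF that(1)] up[OF that(2)]] by (simp add: adjoin_t_def)
  have pow: "Abs_poly (p [^]\<^bsub>?S\<^esub> j) = Abs_poly p ^ j" if "p \<in> carrier ?S" for p and j :: nat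
  proof (induction j)
    case 0
    show ?case using tring_UP_one[OF subrng_A] by (simp add: adjoin_t_def)
  next
    case (Suc j)
    have "p [^]\<^bsub>?S\<^esub> j \<in> carrier ?S" using that by simp
    thus ?case using Suc mult that by (simp add: mult.commute)
  qed
  have inj: "p = q" if "p \<in> carrier ?S" "q \<in> carrier ?S" "Abs_poly p = Abs_poly q" for p q
    using that tring_up(2)[OF up[OF that(1)]] tring_up(2)[OF up[OF that(2)]] by metis
  have "Abs_poly \<zero>\<^bsub>?S\<^esub> = 0"
    using tring_up(2)[OF up[OF S.zero_closed]] by (intro poly_eqI) (simp add: adjoin_t_def UP_def)
  hence nz: "Abs_poly p \<noteq> 0" if "p \<in> carrier ?S - {\<zero>\<^bsub>?S\<^esub>}" for p
    using that inj[of p "\<zero>\<^bsub>?S\<^esub>"] by auto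
  show ?thesis
  proof (rule S.integrally_closedI)
    fix a b d assume a: "a \<in> carrier ?S" and b: "b \<in> S.nz" and d: "d \<in> S.nz"
      and al: "\<And>j::nat. \<exists>s\<in>carrier ?S. d \<otimes>\<^bsub>?S\<^esub> a [^]\<^bsub>?S\<^esub> j = s \<otimes>\<^bsub>?S\<^esub> b [^]\<^bsub>?S\<^esub> j"
    have bS: "b \<in> carrier ?S" and dS: "d \<in> carrier ?S" using b d by auto
    have "almost RP (Abs_poly d) (Abs_poly a) (Abs_poly b)"
      unfolding almost_def
    proof
      fix j :: nat
      obtain s where s: "s \<in> carrier ?S" "d \<otimes>\<^bsub>?S\<^esub> a [^]\<^bsub>?S\<^esub> j = s \<otimes>\<^bsub>?S\<^esub> b [^]\<^bsub>?S\<^esub> j"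
        using al by blast
      from arg_cong[OF s(2), of Abs_poly] have "Abs_poly d * Abs_poly a ^ j = Abs_poly s * Abs_poly b ^ j"
        using s(1) a bS dS by (simp add: mult pow)
      thus "\<exists>s\<in>RP. Abs_poly d * Abs_poly a ^ j = s * Abs_poly b ^ j" using RP[OF s(1)] by blast
    qed
    hence "\<exists>s\<in>RP. Abs_poly a = s * Abs_poly b" by (rule RP_cic[OF nz[OF b] nz[OF d]])
    then obtain s where s: "s \<in> RP" "Abs_poly a = s * Abs_poly b" by blast
    have "Abs_poly (coeff s) = s" by (simp add: coeff_inverse)
    hence "Abs_poly a = Abs_poly (coeff s \<otimes>\<^bsub>?S\<^esub> b)" using mult[OF RP'[OF s(1)] bS] s(2) by simp
    hence "a = coeff s \<otimes>\<^bsub>?S\<^esub> b" by (intro inj a S.m_closed RP'[OF s(1)] bS)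
    thus "\<exists>s\<in>carrier ?S. a = s \<otimes>\<^bsub>?S\<^esub> b" using RP'[OF s(1)] by blast
  qed
qed

end

section \<open>Completions and filtrations\<close>

text \<open>A multiplicative filtration \<open>Z 0 \<supseteq> Z 1 \<supseteq> \<dots>\<close> by ideals for which the ring is separated and
  complete.\<close>

definition filt :: "(nat \<Rightarrow> 'b::comm_ring_1 set) \<Rightarrow> bool" where
  "filt Z \<longleftrightarrow> Z 0 = UNIV \<and> (\<forall>n. 0 \<in> Z n \<and> (\<forall>x\<in>Z n. \<forall>y\<in>Z n. x - y \<in> Z n)) \<and> (\<forall>n. Z (Suc n) \<subseteq> Z n) \<and>
     (\<forall>n m. \<forall>x\<in>Z n. \<forall>y\<in>Z m. x * y \<in> Z (n + m)) \<and> (\<forall>x. (\<forall>n. x \<in> Z n) \<longrightarrow> x = 0) \<and>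
     (\<forall>s. (\<forall>n. s (Suc n) - s n \<in> Z n) \<longrightarrow> (\<exists>l. \<forall>n. l - s n \<in> Z n))"

lemma filtD:
  assumes "filt Z"
  shows filt_UNIV: "Z 0 = UNIV" and filt_0: "0 \<in> Z n"
    and filt_diff: "x \<in> Z n \<Longrightarrow> y \<in> Z n \<Longrightarrow> x - y \<in> Z n"
    and filt_mult: "x \<in> Z n \<Longrightarrow> y \<in> Z m \<Longrightarrow> x * y \<in> Z (n + m)"
    and filt_sep: "(\<And>n. x \<in> Z n) \<Longrightarrow> x = 0"
    and filt_complete: "(\<And>n. s (Suc n) - s n \<in> Z n) \<Longrightarrow> \<exists>l. \<forall>n. l - s n \<in> Z n"
    and filt_Suc: "Z (Suc n) \<subseteq> Z n"
  using assms unfolding filt_def by blast+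

lemma filt_mono: assumes "filt Z" shows "n \<le> m \<Longrightarrow> Z m \<subseteq> Z n"
  by (induction m rule: dec_induct) (use filt_Suc[OF assms] in blast)+

lemma filt_minus: "filt Z \<Longrightarrow> x \<in> Z n \<Longrightarrow> - x \<in> Z n"
  using filt_diff[of Z 0 n x] filt_0[of Z n] by simp

lemma filt_add: "filt Z \<Longrightarrow> x \<in> Z n \<Longrightarrow> y \<in> Z n \<Longrightarrow> x + y \<in> Z n"
  using filt_diff[of Z x n "- y"] filt_minus[of Z y n] by simp

lemma filt_sum: "filt Z \<Longrightarrow> (\<And>i. i \<in> I \<Longrightarrow> h i \<in> Z n) \<Longrightarrow> (\<Sum>i\<in>I. h i) \<in> Z n"
  by (induction I rule: infinite_finite_induct) (simp_all add: filt_0 filt_add)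

lemma filt_scale: "filt Z \<Longrightarrow> x \<in> Z n \<Longrightarrow> y * x \<in> Z n"
  using filt_mult[of Z y 0 x n] filt_UNIV[of Z] by simp

lemma filt_scale': "filt Z \<Longrightarrow> x \<in> Z n \<Longrightarrow> x * y \<in> Z n"
  using filt_scale[of Z x n y] by (simp add: mult.commute)

text \<open>The trivial filtration, in which all nonzero elements have order zero.\<close>

definition ftriv :: "nat \<Rightarrow> 'b::comm_ring_1 set" where
  "ftriv n = (if n = 0 then UNIV else {0})"

lemma filt_ftriv: "filt ftriv"
  unfolding filt_def
proof (intro conjI allI impI)
  fix s :: "nat \<Rightarrow> 'a" assume s: "\<forall>n. s (Suc n) - s n \<in> ftriv n"
  have eq: "s (Suc n) = s 1" for n
  proof (induction n)
    case (Suc n)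
    have "s (Suc (Suc n)) - s (Suc n) = 0" using s[rule_format, of "Suc n"] by (simp add: ftriv_def)
    thus ?case using Suc by simp
  qed simp
  have "s 1 - s n \<in> ftriv n" for n
  proof (cases n)
    case (Suc m)
    thus ?thesis using eq[of m] by (simp add: ftriv_def)
  qed (simp add: ftriv_def)
  thus "\<exists>l. \<forall>n. l - s n \<in> ftriv n" by blast
next
  fix x :: 'a assume "\<forall>n. x \<in> ftriv n"
  hence "x \<in> ftriv 1" by blast
  thus "x = 0" by (simp add: ftriv_def)
qed (auto simp: ftriv_def)

text \<open>The induced filtration of \<open>R[[X]]\<close>, in which \<open>X\<close> has order one.\<close>

definition flift :: "(nat \<Rightarrow> 'b::comm_ring_1 set) \<Rightarrow> nat \<Rightarrow> 'b fps set" where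
  "flift Z n = {F. \<forall>i. fps_nth F i \<in> Z (n - i)}"

lemma filt_flift: assumes Z: "filt Z" shows "filt (flift Z)"
  unfolding filt_def
proof (intro conjI allI impI ballI)
  show "flift Z 0 = UNIV" using filt_UNIV[OF Z] by (auto simp: flift_def)
  show "0 \<in> flift Z n" for n using filt_0[OF Z] by (simp add: flift_def)
  show "x - y \<in> flift Z n" if "x \<in> flift Z n" "y \<in> flift Z n" for x y n
    using that filt_diff[OF Z] by (simp add: flift_def)
  show "flift Z (Suc n) \<subseteq> flift Z n" for n
    using filt_mono[OF Z, of "n - i" "Suc n - i" for i] by (fastforce simp: flift_def)
  show "x * y \<in> flift Z (n + m)" if "x \<in> flift Z n" "y \<in> flift Z m" for x y n m
    unfolding flift_def
  proof (intro CollectI allI)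
    fix i
    have "fps_nth x a * fps_nth y (i - a) \<in> Z (n + m - i)" if "a \<le> i" for a
    proof -
      have "fps_nth x a * fps_nth y (i - a) \<in> Z ((n - a) + (m - (i - a)))"
        using \<open>x \<in> _\<close> \<open>y \<in> _\<close> by (intro filt_mult[OF Z]) (simp_all add: flift_def)
      moreover have "n + m - i \<le> (n - a) + (m - (i - a))" using that by linarith
      ultimately show ?thesis using filt_mono[OF Z] by blast
    qed
    thus "fps_nth (x * y) i \<in> Z (n + m - i)" unfolding fps_mult_nth by (intro filt_sum[OF Z]) auto
  qed
  show "x = 0" if x: "\<forall>n. x \<in> flift Z n" for x
  proof (rule fps_ext)
    fix i
    have "fps_nth x i \<in> Z n" for n using x[rule_format, of "n + i"] by (auto simp: flift_def dest: spec[of _ i])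
    thus "fps_nth x i = fps_nth 0 i" using filt_sep[OF Z] by simp
  qed
  show "\<exists>l. \<forall>n. l - s n \<in> flift Z n" if s: "\<forall>n. s (Suc n) - s n \<in> flift Z n" for s
  proof -
    have "\<exists>l. \<forall>n. l - fps_nth (s (n + i)) i \<in> Z n" for i
    proof (rule filt_complete[OF Z])
      fix n
      have "s (Suc (n + i)) - s (n + i) \<in> flift Z (n + i)" using s by blast
      hence "fps_nth (s (Suc (n + i)) - s (n + i)) i \<in> Z ((n + i) - i)" unfolding flift_def by blast
      thus "fps_nth (s (Suc n + i)) i - fps_nth (s (n + i)) i \<in> Z n" by simp
    qed
    then obtain l where l: "\<And>i n. l i - fps_nth (s (n + i)) i \<in> Z n" by metis
    have "l i - fps_nth (s n) i \<in> Z (n - i)" for n i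
      using l[of i "n - i"] filt_UNIV[OF Z] by (cases "i \<le> n") auto
    hence "Abs_fps l - s n \<in> flift Z n" for n by (simp add: flift_def)
    thus ?thesis by blast
  qed
qed

text \<open>The \<open>I\<close>-adic completion of a ring \<open>R\<close> with a homomorphism to a complete ring that induces the
  \<open>I\<close>-adic filtration is the closure of the image of \<open>R\<close>.\<close>

locale embedded_completion = cring R for R :: "('a, 'm) ring_scheme" (structure) +
  fixes I :: "'a set" and h :: "'a \<Rightarrow> 'b::idom" and Z :: "nat \<Rightarrow> 'b set"
  assumes I: "ideal I R" and Z: "filt Z"
    and h_add: "\<And>a b. a \<in> carrier R \<Longrightarrow> b \<in> carrier R \<Longrightarrow> h (a \<oplus> b) = h a + h b"
    and h_mult: "\<And>a b. a \<in> carrier R \<Longrightarrow> b \<in> carrier R \<Longrightarrow> h (a \<otimes> b) = h a * h b"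
    and h_one: "h \<one> = 1"
    and pow: "\<And>n. ideal_pow R I n = {a \<in> carrier R. h a \<in> Z n}"
begin

abbreviation C :: "(nat \<Rightarrow> 'a set) ring" where
  "C \<equiv> adic_completion R I"

text \<open>The closure of the image of \<open>R\<close>.\<close>

definition cl :: "'b set" where
  "cl = {F. \<forall>n. \<exists>a\<in>carrier R. h a - F \<in> Z n}"

text \<open>The element of the completion that corresponds to a point of the closure.\<close>

definition gam :: "'b \<Rightarrow> nat \<Rightarrow> 'a set" where
  "gam F n = {b \<in> carrier R. h b - F \<in> Z n}"

lemma h_zero: "h \<zero> = 0"
proof -
  have "h \<zero> = h \<zero> + h \<zero>" using h_add[OF zero_closed zero_closed] by (simp only: r_zero zero_closed)
  thus ?thesis by (simp only: add_cancel_right_right)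
qed

lemma h_neg: "a \<in> carrier R \<Longrightarrow> h (\<ominus> a) = - h a"
  using h_add[of "\<ominus> a" a] h_zero by (simp add: l_neg eq_neg_iff_add_eq_0)

lemma gam_cong: "F - G \<in> Z n \<Longrightarrow> gam F n = gam G n"
proof -
  have "h b - G \<in> Z n" if "h b - F \<in> Z n" "F - G \<in> Z n" for b F G
    using filt_add[OF Z that] by simp
  moreover assume "F - G \<in> Z n"
  moreover from this have "G - F \<in> Z n" using filt_minus[OF Z] by fastforce
  ultimately show ?thesis unfolding gam_def by blast
qed

lemma coset_eq: assumes a: "a \<in> carrier R" shows "ideal_pow R I n +> a = gam (h a) n"
proof
  show "ideal_pow R I n +> a \<subseteq> gam (h a) n"
    using a by (auto simp: a_r_coset_def r_coset_def gam_def pow h_add)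
  show "gam (h a) n \<subseteq> ideal_pow R I n +> a"
  proof
    fix b assume "b \<in> gam (h a) n"
    hence b: "b \<in> carrier R" "h b - h a \<in> Z n" by (auto simp: gam_def)
    have "b \<ominus> a \<in> ideal_pow R I n" using a b by (simp add: pow a_minus_def h_add h_neg)
    moreover have "b = (b \<ominus> a) \<oplus> a" using a b by (simp add: a_minus_def a_assoc l_neg)
    ultimately show "b \<in> ideal_pow R I n +> a" by (auto simp: a_r_coset_def r_coset_def)
  qed
qed

lemma gam_coset: "F \<in> cl \<Longrightarrow> \<exists>a\<in>carrier R. h a - F \<in> Z n \<and> gam F n = ideal_pow R I n +> a"
  using coset_eq gam_cong unfolding cl_def by blast

lemma C_carrier: "carrier C = gam ` cl"
proof
  show "gam ` cl \<subseteq> carrier C"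
  proof
    fix s assume "s \<in> gam ` cl"
    then obtain F where F: "F \<in> cl" "s = gam F" by blast
    have "gam F n \<in> carrier (R Quot ideal_pow R I n)" for n
      using gam_coset[OF F(1), of n] by (auto simp: FactRing_def A_RCOSETS_def' )
    moreover have "gam F (Suc n) \<subseteq> gam F n" for n using filt_Suc[OF Z] by (auto simp: gam_def)
    ultimately show "s \<in> carrier C" by (simp add: adic_completion_def F)
  qed
  show "carrier C \<subseteq> gam ` cl"
  proof
    fix s assume "s \<in> carrier C"
    hence s: "\<And>n. s n \<in> carrier (R Quot ideal_pow R I n)" "\<And>n. s (Suc n) \<subseteq> s n"
      by (auto simp: adic_completion_def)
    have "\<exists>a\<in>carrier R. s n = ideal_pow R I n +> a" for n
      using s(1)[of n] by (auto simp: FactRing_def A_RCOSETS_def')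
    then obtain a where a: "\<And>n. a n \<in> carrier R" "\<And>n. s n = gam (h (a n)) n" using coset_eq by metis
    have "h (a (Suc n)) - h (a n) \<in> Z n" for n
    proof -
      have "a (Suc n) \<in> s (Suc n)" using a filt_0[OF Z] by (simp add: gam_def)
      hence "a (Suc n) \<in> s n" using s(2) by blast
      thus ?thesis by (simp add: a gam_def)
    qed
    then obtain F where F: "\<And>n. F - h (a n) \<in> Z n" using filt_complete[OF Z, of "\<lambda>n. h (a n)"] by blast
    have "s n = gam F n" for n using gam_cong[OF F] a by metis
    moreover have "h (a n) - F \<in> Z n" for n using filt_minus[OF Z F] by simp
    hence "F \<in> cl" unfolding cl_def using a by blast
    ultimately show "s \<in> gam ` cl" by blast
  qed
qed

lemma h_cl: "a \<in> carrier R \<Longrightarrow> h a \<in> cl"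
  unfolding cl_def using filt_0[OF Z] by force

lemma to_completion_eq: "a \<in> carrier R \<Longrightarrow> to_completion R I a = gam (h a)"
  unfolding to_completion_def using coset_eq by blast

lemma cl_approx:
  assumes "F \<in> cl" "G \<in> cl"
  obtains a b where "a \<in> carrier R" "h a - F \<in> Z n" "gam F n = ideal_pow R I n +> a"
    "b \<in> carrier R" "h b - G \<in> Z n" "gam G n = ideal_pow R I n +> b"
  using gam_coset[OF assms(1), of n] gam_coset[OF assms(2), of n] by blast

lemma mult_approx: "h a - F \<in> Z n \<Longrightarrow> h b - G \<in> Z n \<Longrightarrow> h a * h b - F * G \<in> Z n"
proof -
  assume "h a - F \<in> Z n" "h b - G \<in> Z n"
  hence "(h a - F) * h b + F * (h b - G) \<in> Z n" by (intro filt_add[OF Z] filt_scale[OF Z] filt_scale'[OF Z])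
  thus ?thesis by (simp add: algebra_simps)
qed

lemma add_approx: "h a - F \<in> Z n \<Longrightarrow> h b - G \<in> Z n \<Longrightarrow> h a + h b - (F + G) \<in> Z n"
  using filt_add[OF Z, of "h a - F" n "h b - G"] by (simp add: algebra_simps)

lemma cl_mult: assumes "F \<in> cl" "G \<in> cl" shows "F * G \<in> cl"
  unfolding cl_def
proof (intro CollectI allI)
  fix n
  obtain a b where "a \<in> carrier R" "h a - F \<in> Z n" "gam F n = ideal_pow R I n +> a"
    "b \<in> carrier R" "h b - G \<in> Z n" "gam G n = ideal_pow R I n +> b" using assms by (rule cl_approx)
  thus "\<exists>c\<in>carrier R. h c - F * G \<in> Z n"
    using mult_approx by (intro bexI[of _ "a \<otimes> b"]) (simp_all add: h_mult)
qed

lemma cl_add: assumes "F \<in> cl" "G \<in> cl" shows "F + G \<in> cl"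
  unfolding cl_def
proof (intro CollectI allI)
  fix n
  obtain a b where "a \<in> carrier R" "h a - F \<in> Z n" "gam F n = ideal_pow R I n +> a"
    "b \<in> carrier R" "h b - G \<in> Z n" "gam G n = ideal_pow R I n +> b" using assms by (rule cl_approx)
  thus "\<exists>c\<in>carrier R. h c - (F + G) \<in> Z n"
    using add_approx by (intro bexI[of _ "a \<oplus> b"]) (simp_all add: h_add)
qed

lemma cl_minus: "F \<in> cl \<Longrightarrow> - F \<in> cl"
  unfolding cl_def
proof (intro CollectI allI)
  fix n assume "F \<in> {F. \<forall>n. \<exists>a\<in>carrier R. h a - F \<in> Z n}"
  then obtain a where a: "a \<in> carrier R" "h a - F \<in> Z n" by blast
  have "h (\<ominus> a) - - F \<in> Z n" using filt_minus[OF Z a(2)] a(1) by (simp add: h_neg)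
  thus "\<exists>a\<in>carrier R. h a - - F \<in> Z n" using a(1) by blast
qed

lemma cl_1: "1 \<in> cl" and cl_0: "0 \<in> cl"
  using h_cl[OF one_closed] h_cl[OF zero_closed] by (simp_all add: h_one h_zero)

lemma gam_mult: assumes "F \<in> cl" "G \<in> cl" shows "gam F \<otimes>\<^bsub>C\<^esub> gam G = gam (F * G)"
proof
  fix n
  obtain a b where *: "a \<in> carrier R" "h a - F \<in> Z n" "gam F n = ideal_pow R I n +> a"
    "b \<in> carrier R" "h b - G \<in> Z n" "gam G n = ideal_pow R I n +> b" using assms by (rule cl_approx)
  have "(gam F \<otimes>\<^bsub>C\<^esub> gam G) n = ideal_pow R I n +> (a \<otimes> b)"
    using ideal.rcoset_mult_add[OF ideal_pow_ideal[OF I] *(1,4)] by (simp add: adic_completion_def FactRing_def *)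
  also have "\<dots> = gam (h a * h b) n" using * by (simp add: coset_eq h_mult)
  also have "\<dots> = gam (F * G) n" by (rule gam_cong[OF mult_approx[OF *(2,5)]])
  finally show "(gam F \<otimes>\<^bsub>C\<^esub> gam G) n = gam (F * G) n" .
qed

lemma gam_add: assumes "F \<in> cl" "G \<in> cl" shows "gam F \<oplus>\<^bsub>C\<^esub> gam G = gam (F + G)"
proof
  fix n
  obtain a b where *: "a \<in> carrier R" "h a - F \<in> Z n" "gam F n = ideal_pow R I n +> a"
    "b \<in> carrier R" "h b - G \<in> Z n" "gam G n = ideal_pow R I n +> b" using assms by (rule cl_approx)
  interpret J: ideal "ideal_pow R I n" R by (rule ideal_pow_ideal[OF I])
  have "(gam F \<oplus>\<^bsub>C\<^esub> gam G) n = ideal_pow R I n +> (a \<oplus> b)"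
    using J.a_rcos_sum[OF *(1,4)] by (simp add: adic_completion_def FactRing_def *)
  also have "\<dots> = gam (h a + h b) n" using * by (simp add: coset_eq h_add)
  also have "\<dots> = gam (F + G) n" by (rule gam_cong[OF add_approx[OF *(2,5)]])
  finally show "(gam F \<oplus>\<^bsub>C\<^esub> gam G) n = gam (F + G) n" .
qed

lemma gam_one: "\<one>\<^bsub>C\<^esub> = gam 1"
  using coset_eq[OF one_closed] by (auto simp: adic_completion_def FactRing_def h_one)

lemma gam_zero: "\<zero>\<^bsub>C\<^esub> = gam 0"
  by (auto simp: adic_completion_def FactRing_def pow gam_def)

lemma gam_inj: assumes "F \<in> cl" "G \<in> cl" "gam F = gam G" shows "F = G"
proof -
  have "F - G \<in> Z n" for n
  proof -
    obtain a where a: "a \<in> carrier R" "h a - F \<in> Z n" using assms(1) unfolding cl_def by blast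
    hence "a \<in> gam G n" unfolding assms(3)[symmetric] by (simp add: gam_def)
    hence "h a - G \<in> Z n" by (simp add: gam_def)
    from filt_diff[OF Z this a(2)] show ?thesis by simp
  qed
  hence "F - G = 0" by (rule filt_sep[OF Z])
  thus ?thesis by simp
qed

theorem domain_completion: "domain C"
proof -
  have cr: "cring C"
  proof (rule cringI)
    show "abelian_group C"
    proof (rule abelian_groupI)
      fix x assume "x \<in> carrier C"
      then obtain F where F: "F \<in> cl" "x = gam F" unfolding C_carrier by blast
      have "gam (- F) \<oplus>\<^bsub>C\<^esub> x = \<zero>\<^bsub>C\<^esub>" using F cl_minus by (simp add: gam_add gam_zero)
      thus "\<exists>y\<in>carrier C. y \<oplus>\<^bsub>C\<^esub> x = \<zero>\<^bsub>C\<^esub>" using cl_minus[OF F(1)] unfolding C_carrier by blast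
    qed (auto simp: C_carrier gam_add gam_zero cl_add cl_0 add_ac)
    show "comm_monoid C"
      by (rule comm_monoidI) (auto simp: C_carrier gam_mult gam_one cl_mult cl_1 mult_ac)
  qed (auto simp: C_carrier gam_mult gam_add cl_mult cl_add distrib_right)
  show ?thesis
  proof (intro domain.intro domain_axioms.intro cr)
    show "\<one>\<^bsub>C\<^esub> \<noteq> \<zero>\<^bsub>C\<^esub>" unfolding gam_one gam_zero using gam_inj[OF cl_1 cl_0] by auto
    fix x y assume xy: "x \<otimes>\<^bsub>C\<^esub> y = \<zero>\<^bsub>C\<^esub>" "x \<in> carrier C" "y \<in> carrier C"
    then obtain F G where FG: "F \<in> cl" "x = gam F" "G \<in> cl" "y = gam G" unfolding C_carrier by blast
    hence "gam (F * G) = gam 0" using xy(1) by (simp add: gam_mult gam_zero)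
    hence "F * G = 0" by (intro gam_inj cl_mult cl_0 FG)
    thus "x = \<zero>\<^bsub>C\<^esub> \<or> y = \<zero>\<^bsub>C\<^esub>" using FG by (auto simp: gam_zero)
  qed
qed

end

section \<open>Taylor expansion and the completion of \<open>A\<close>\<close>

text \<open>The expansion of a polynomial in \<open>k[[y]][[z]]\<close>, with \<open>z\<close> as the outer variable.\<close>

definition pt :: "'k::field poly poly \<Rightarrow> 'k fps fps" where
  "pt p = fps_of_poly (map_poly fps_of_poly p)"

lemma rhom_pt: "rhom pt"
  unfolding pt_def[abs_def] by (rule rhom_comp[OF rhom_map_poly[OF rhom_fps_of_poly] rhom_fps_of_poly])

lemma pt_nth: "fps_nth (fps_nth (pt p) j) i = coeff (coeff p j) i"
  by (simp add: pt_def coeff_map_poly)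

lemma pt_unit: assumes "unitc q" shows "\<exists>s. pt q * s = 1"
proof -
  have "fps_nth (fps_nth (pt q) 0) 0 \<noteq> 0" using assms by (simp add: pt_nth unitc_def poly_0_coeff_0)
  hence "fps_nth (pt q) 0 * inverse (fps_nth (pt q) 0) = 1" by (rule inverse_mult_eq_1')
  from fps_right_inverse[OF this] show ?thesis by blast
qed

lemma pt_nz: "unitc q \<Longrightarrow> pt q \<noteq> 0"
  using pt_unit by fastforce

text \<open>The Taylor expansion \<open>k[y,z]\<^sub>(\<^sub>y\<^sub>,\<^sub>z\<^sub>) \<rightarrow> k[[y]][[z]]\<close>; it maps \<open>p/q\<close> to the quotient of
  the expansions, and its value outside \<open>k[y,z]\<^sub>(\<^sub>y\<^sub>,\<^sub>z\<^sub>)\<close> is irrelevant.\<close>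

definition tay :: "'k::field poly poly fract \<Rightarrow> 'k fps fps" where
  "tay r = (SOME s. \<exists>p q. unitc q \<and> r = Fract p q \<and> s * pt q = pt p)"

lemma tay_eq: assumes q: "unitc q" shows "tay (Fract p q) * pt q = pt p"
proof -
  obtain s where s: "pt q * s = 1" using pt_unit[OF q] by blast
  have "\<exists>p' q'. unitc q' \<and> Fract p q = Fract p' q' \<and> (pt p * s) * pt q' = pt p'"
    using q s by (intro exI[of _ p] exI[of _ q]) (simp add: mult_ac)
  hence "\<exists>p' q'. unitc q' \<and> Fract p q = Fract p' q' \<and> tay (Fract p q) * pt q' = pt p'"
    unfolding tay_def by (rule someI)
  then obtain p' q' where *: "unitc q'" "Fract p q = Fract p' q'" "tay (Fract p q) * pt q' = pt p'" by blast
  have "p * q' = p' * q" using * unitc_nz[OF q] unitc_nz[OF *(1)] by (simp add: eq_fract)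
  hence eq: "pt p * pt q' = pt p' * pt q" by (metis rhom_mult[OF rhom_pt])
  have "(tay (Fract p q) * pt q) * pt q' = (tay (Fract p q) * pt q') * pt q" by (simp only: mult_ac)
  also have "\<dots> = pt p * pt q'" using * eq by simp
  finally show ?thesis using pt_nz[OF *(1)] by simp
qed

lemma tay_eqI: assumes "unitc q" "r = Fract p q" "s * pt q = pt p" shows "tay r = s"
  using tay_eq[OF assms(1), of p] assms pt_nz[OF assms(1)] by (metis mult_right_cancel)

lemma tay_to_fract: "tay (to_fract p) = pt p"
  by (rule tay_eqI[of 1 _ p]) (simp_all add: unitc_1 to_fract_def rhom_1[OF rhom_pt])

lemma tay_add: assumes "r \<in> loc_yz" "s \<in> loc_yz" shows "tay (r + s) = tay r + tay s"
proof -
  obtain p q p' q' where *: "unitc q" "r = Fract p q" "q \<noteq> 0" "unitc q'" "s = Fract p' q'" "q' \<noteq> 0"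
    using assms by (metis loc_cases)
  show ?thesis
  proof (rule tay_eqI)
    show "unitc (q * q')" using * by (simp add: unitc_mult)
    show "r + s = Fract (p * q' + p' * q) (q * q')" using * by simp
    have "(tay r + tay s) * pt (q * q') = (tay r * pt q) * pt q' + (tay s * pt q') * pt q"
      by (simp add: rhom_mult[OF rhom_pt] algebra_simps)
    also have "\<dots> = pt (p * q' + p' * q)" unfolding *(2,5) tay_eq[OF *(1)] tay_eq[OF *(4)]
      by (simp add: rhom_simps[OF rhom_pt])
    finally show "(tay r + tay s) * pt (q * q') = pt (p * q' + p' * q)" .
  qed
qed

lemma tay_mult: assumes "r \<in> loc_yz" "s \<in> loc_yz" shows "tay (r * s) = tay r * tay s"
proof -
  obtain p q p' q' where *: "unitc q" "r = Fract p q" "q \<noteq> 0" "unitc q'" "s = Fract p' q'" "q' \<noteq> 0"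
    using assms by (metis loc_cases)
  show ?thesis
  proof (rule tay_eqI)
    show "unitc (q * q')" using * by (simp add: unitc_mult)
    show "r * s = Fract (p * p') (q * q')" using * by simp
    have "(tay r * tay s) * pt (q * q') = (tay r * pt q) * (tay s * pt q')"
      by (simp add: rhom_mult[OF rhom_pt] mult_ac)
    also have "\<dots> = pt (p * p')" unfolding *(2,5) tay_eq[OF *(1)] tay_eq[OF *(4)]
      by (simp add: rhom_mult[OF rhom_pt])
    finally show "(tay r * tay s) * pt (q * q') = pt (p * p')" .
  qed
qed

lemma tay_sum: "finite I \<Longrightarrow> (\<And>i. i \<in> I \<Longrightarrow> F i \<in> loc_yz) \<Longrightarrow> tay (\<Sum>i\<in>I. F i) = (\<Sum>i\<in>I. tay (F i))"
proof (induction I rule: finite_induct)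
  case empty
  show ?case using tay_to_fract[of 0] by (simp add: rhom_0[OF rhom_pt])
next
  case (insert x I)
  have "(\<Sum>i\<in>I. F i) \<in> loc_yz" using insert by (intro subrng_sum[OF subrng_loc]) auto
  thus ?case using insert by (simp add: tay_add)
qed

text \<open>The expansion \<open>R\<^sup>* \<rightarrow> k[[x,y,z]]\<close>, with \<open>x\<close> as the outermost variable.\<close>

definition Psi :: "'k::field kyzx \<Rightarrow> 'k fps fps fps" where
  "Psi a = Abs_fps (\<lambda>n. tay (fls_nth a (int n)))"

lemma Psi_nth: "fps_nth (Psi a) n = tay (fls_nth a (int n))"
  by (simp add: Psi_def)

lemma Psi_add: "a \<in> R_star \<Longrightarrow> b \<in> R_star \<Longrightarrow> Psi (a + b) = Psi a + Psi b"
  by (simp add: fps_eq_iff Psi_nth tay_add R_star_nth)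

lemma Psi_mult: assumes "a \<in> R_star" "b \<in> R_star" shows "Psi (a * b) = Psi a * Psi b"
proof -
  obtain F G where FG: "\<And>n. fps_nth F n \<in> loc_yz" "a = fps_to_fls F" "\<And>n. fps_nth G n \<in> loc_yz" "b = fps_to_fls G"
    using assms by (auto simp: R_star_iff)
  have ab: "a * b = fps_to_fls (F * G)" by (simp add: FG fls_times_fps_to_fls)
  have Psi_ab: "fps_nth (Psi a) n = tay (fps_nth F n)" "fps_nth (Psi b) n = tay (fps_nth G n)" for n
    by (simp_all add: Psi_nth FG)
  show ?thesis
  proof (rule fps_ext)
    fix n
    have "fps_nth (Psi (a * b)) n = tay (\<Sum>i=0..n. fps_nth F i * fps_nth G (n - i))"
      by (simp add: Psi_nth ab fps_mult_nth)
    also have "\<dots> = (\<Sum>i=0..n. tay (fps_nth F i) * tay (fps_nth G (n - i)))"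
      by (subst tay_sum) (simp_all add: FG tay_mult subrng_mult[OF subrng_loc])
    also have "\<dots> = fps_nth (Psi a * Psi b) n" by (simp only: fps_mult_nth Psi_ab)
    finally show "fps_nth (Psi (a * b)) n = fps_nth (Psi a * Psi b) n" .
  qed
qed

lemma tay_1: "tay (1 :: 'k::field poly poly fract) = 1" and tay_0: "tay (0 :: 'k poly poly fract) = 0"
  using tay_to_fract[of "1 :: 'k poly poly"] tay_to_fract[of "0 :: 'k poly poly"]
  by (simp_all add: rhom_1[OF rhom_pt] rhom_0[OF rhom_pt])

lemma Psi_const: "Psi (fls_const r) = fps_const (tay r)"
  by (auto simp: fps_eq_iff Psi_nth tay_0)

lemma Psi_1: "Psi (1 :: 'k::field kyzx) = 1"
  using Psi_const[of "1 :: 'k poly poly fract"] by (simp add: tay_1)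

lemma Psi_0: "Psi (0 :: 'k::field kyzx) = 0"
  using Psi_const[of "0 :: 'k poly poly fract"] by (simp add: tay_0)

text \<open>The filtrations of \<open>k[[y]][[z]]\<close> and \<open>k[[x,y,z]]\<close> by the order of power series.\<close>

abbreviation Z2 :: "nat \<Rightarrow> 'k::field fps fps set" where
  "Z2 \<equiv> flift (flift ftriv)"

abbreviation Z3 :: "nat \<Rightarrow> 'k::field fps fps fps set" where
  "Z3 \<equiv> flift Z2"

lemma filt_Z2: "filt Z2"
  by (intro filt_flift filt_ftriv)

lemma filt_Z3: "filt Z3"
  by (intro filt_flift filt_ftriv)

lemma Z2_iff: "F \<in> Z2 n \<longleftrightarrow> (\<forall>j i. i + j < n \<longrightarrow> fps_nth (fps_nth F j) i = 0)"
proof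
  assume F: "F \<in> Z2 n"
  show "\<forall>j i. i + j < n \<longrightarrow> fps_nth (fps_nth F j) i = 0"
  proof (intro allI impI)
    fix j i assume "i + j < n"
    moreover have "fps_nth (fps_nth F j) i \<in> ftriv (n - j - i)" using F by (simp add: flift_def)
    ultimately show "fps_nth (fps_nth F j) i = 0" by (simp add: ftriv_def split: if_splits)
  qed
next
  assume F: "\<forall>j i. i + j < n \<longrightarrow> fps_nth (fps_nth F j) i = 0"
  have "fps_nth (fps_nth F j) i \<in> ftriv (n - j - i)" for j i
    using F[rule_format, of i j] by (auto simp: ftriv_def)
  thus "F \<in> Z2 n" by (simp add: flift_def)
qed

lemma Z3_1: "F \<in> Z3 1 \<longleftrightarrow> fps_nth (fps_nth (fps_nth F 0) 0) 0 = 0"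
proof
  assume "F \<in> Z3 1"
  hence "fps_nth F 0 \<in> Z2 (1 - 0)" unfolding flift_def[of Z2] by blast
  hence "fps_nth F 0 \<in> Z2 1" by simp
  thus "fps_nth (fps_nth (fps_nth F 0) 0) 0 = 0" unfolding Z2_iff by simp
next
  assume *: "fps_nth (fps_nth (fps_nth F 0) 0) 0 = 0"
  have "fps_nth F i \<in> Z2 (1 - i)" for i
    using * filt_UNIV[OF filt_Z2] by (cases i) (simp_all add: Z2_iff)
  thus "F \<in> Z3 1" unfolding flift_def[of Z2] by blast
qed

lemma tay_Z2: assumes "unitc q" shows "tay (Fract p q) \<in> Z2 n \<longleftrightarrow> pt p \<in> Z2 n"
proof
  assume "tay (Fract p q) \<in> Z2 n"
  thus "pt p \<in> Z2 n" unfolding tay_eq[OF assms, of p, symmetric] by (rule filt_scale'[OF filt_Z2])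
next
  assume p: "pt p \<in> Z2 n"
  obtain s where s: "pt q * s = 1" using pt_unit[OF assms] by blast
  have "tay (Fract p q) = tay (Fract p q) * (pt q * s)" by (simp add: s)
  also have "\<dots> = pt p * s" using tay_eq[OF assms, of p] by (simp add: mult.assoc[symmetric])
  finally show "tay (Fract p q) \<in> Z2 n" using filt_scale'[OF filt_Z2 p] by simp
qed

lemma const_Z3: "fps_const F \<in> Z3 n \<longleftrightarrow> F \<in> Z2 n"
proof
  assume "fps_const F \<in> Z3 n"
  hence "fps_nth (fps_const F) 0 \<in> Z2 (n - 0)" unfolding flift_def[of Z2] by blast
  thus "F \<in> Z2 n" by simp
next
  assume "F \<in> Z2 n"
  hence "fps_nth (fps_const F) i \<in> Z2 (n - i)" for i using filt_0[OF filt_Z2] by (cases i) simp_all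
  thus "fps_const F \<in> Z3 n" unfolding flift_def[of Z2] by blast
qed

lemma Psi_x_Z3: "Psi x_el \<in> Z3 1"
  unfolding Z3_1 by (simp add: Psi_nth x_el_def tay_0)

lemma ideal_tring:
  assumes S: "subrng S" and J: "J \<subseteq> S" "0 \<in> J" "\<And>a b. a \<in> J \<Longrightarrow> b \<in> J \<Longrightarrow> a - b \<in> J"
    "\<And>s a. s \<in> S \<Longrightarrow> a \<in> J \<Longrightarrow> s * a \<in> J"
  shows "ideal J (tring S)"
proof -
  interpret domain "tring S" by (rule domain_tring[OF S])
  have neg: "\<ominus>\<^bsub>tring S\<^esub> a = - a" if "a \<in> S" for a
    by (rule minus_equality) (use that subrng_minus[OF S] in auto)
  show ?thesis
  proof (rule idealI[OF ring_axioms])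
    show "subgroup J (add_monoid (tring S))"
    proof
      fix a b assume "a \<in> J" "b \<in> J"
      hence "a - (0 - b) \<in> J" by (intro J(3) J(2))
      thus "a \<otimes>\<^bsub>add_monoid (tring S)\<^esub> b \<in> J" by simp
    next
      fix a assume a: "a \<in> J"
      hence "0 - a \<in> J" by (intro J(3) J(2))
      thus "inv\<^bsub>add_monoid (tring S)\<^esub> a \<in> J" using neg[of a] a J by (auto simp: a_inv_def)
    qed (use J in auto)
  next
    fix a s assume a: "a \<in> J" "s \<in> carrier (tring S)"
    thus "s \<otimes>\<^bsub>tring S\<^esub> a \<in> J" "a \<otimes>\<^bsub>tring S\<^esub> s \<in> J" using J(4)[of s a] by (simp_all add: mult.commute)
  qed
qed

context setting
begin

text \<open>The elements of \<open>A\<close> of order at least \<open>n\<close>; they form the \<open>n\<close>-th power of the maximal ideal.\<close>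

definition MX :: "nat \<Rightarrow> 'k kyzx set" where
  "MX n = {a \<in> A. Psi a \<in> Z3 n}"

lemma Psi_A_add: "a \<in> A \<Longrightarrow> b \<in> A \<Longrightarrow> Psi (a + b) = Psi a + Psi b"
  and Psi_A_mult: "a \<in> A \<Longrightarrow> b \<in> A \<Longrightarrow> Psi (a * b) = Psi a * Psi b"
  by (auto simp: A_def intro: Psi_add Psi_mult)

lemma Psi_A_minus: "a \<in> A \<Longrightarrow> Psi (- a) = - Psi a"
  using Psi_A_add[of "- a" a] subrng_minus[OF subrng_A] by (simp add: Psi_0 eq_neg_iff_add_eq_0)

lemma Psi_A_diff: "a \<in> A \<Longrightarrow> b \<in> A \<Longrightarrow> Psi (a - b) = Psi a - Psi b"
  using Psi_A_add[of a "- b"] subrng_minus[OF subrng_A] by (simp add: Psi_A_minus)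

lemma MX_ideal: "ideal (MX n) Ar"
  by (rule ideal_tring[OF subrng_A])
    (auto simp: MX_def Psi_0 filt_0[OF filt_Z3] Psi_A_diff Psi_A_mult filt_diff[OF filt_Z3] filt_scale[OF filt_Z3]
      subrng_0[OF subrng_A] subrng_diff[OF subrng_A] subrng_mult[OF subrng_A])

lemma MX_mult: "a \<in> MX n \<Longrightarrow> b \<in> MX m \<Longrightarrow> a * b \<in> MX (n + m)"
  by (auto simp: MX_def Psi_A_mult subrng_mult[OF subrng_A] intro: filt_mult[OF filt_Z3])

lemma x_MX: "x_el \<in> MX 1"
  using x_A Psi_x_Z3 by (simp add: MX_def)

lemma yz_MX: "fls_const (to_fract [:[:0, 1:]:]) \<in> MX 1" "fls_const (to_fract [:0, 1:]) \<in> MX 1"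
  unfolding MX_def using const_A[OF loc_to_fract]
  by (auto simp: Psi_const Z3_1 tay_to_fract pt_nth simp del: One_nat_def)

lemma const_MX:
  assumes "unitc q" "pt p \<in> Z2 n" shows "fls_const (Fract p q) \<in> MX n"
proof -
  have "Fract p q \<in> loc_yz" using assms loc_iff by blast
  thus ?thesis using assms by (simp add: MX_def const_A Psi_const const_Z3 tay_Z2)
qed

text \<open>An element of order \<open>n + 1\<close> is a combination of \<open>x\<close>, \<open>y\<close>, \<open>z\<close> with coefficients of order \<open>n\<close>.\<close>

lemma MX_Suc:
  assumes a: "a \<in> MX (Suc n)"
  obtains a1 a2 a3 where "a1 \<in> MX n" "a2 \<in> MX n" "a3 \<in> MX n"
    "a = a1 * x_el + a2 * fls_const (to_fract [:[:0, 1:]:]) + a3 * fls_const (to_fract [:0, 1:])"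
proof -
  have aA: "a \<in> A" and Pa: "\<And>i. tay (fls_nth a (int i)) \<in> Z2 (Suc n - i)"
    using a unfolding MX_def flift_def[of Z2] by (auto simp: Psi_nth)
  obtain a' where a': "a' \<in> A" "a = fls_const (fls_nth a 0) + x_el * a'" using A_tail[OF aA] by blast
  have "fls_nth a' (int i) = fls_nth a (int (Suc i))" for i
  proof -
    have "fls_nth a (int (Suc i)) = fls_nth (fls_const (fls_nth a 0) + x_el * a') (int (Suc i))"
      using a'(2) by simp
    also have "\<dots> = fls_nth a' (int i)" by (simp add: x_el_def fls_X_times_conv_shift)
    finally show ?thesis by simp
  qed
  hence "tay (fls_nth a' (int i)) \<in> Z2 (n - i)" for i using Pa[of "Suc i"] by simp
  hence a'M: "a' \<in> MX n" using a' unfolding MX_def flift_def[of Z2] by (simp add: Psi_nth)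
  obtain p q where pq: "unitc q" "fls_nth a 0 = Fract p q" "q \<noteq> 0" using A_nth_0[OF aA] by (rule loc_cases)
  have "tay (Fract p q) \<in> Z2 (Suc n)" using Pa[of 0] pq by simp
  hence "pt p \<in> Z2 (Suc n)" unfolding tay_Z2[OF pq(1)] .
  hence low: "coeff (coeff p j) i = 0" if "i + j < Suc n" for i j using that by (simp add: Z2_iff pt_nth)
  obtain p0 p1 where p: "p = pCons p0 p1" by (cases p)
  obtain c p2 where p0: "p0 = pCons c p2" by (cases p0)
  have c: "c = 0" using low[of 0 0] by (simp add: p p0)
  have "pt p1 \<in> Z2 n" unfolding Z2_iff pt_nth
  proof (intro allI impI)
    fix j i assume "i + j < n"
    thus "coeff (coeff p1 j) i = 0" using low[of i "Suc j"] by (simp add: p)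
  qed
  hence M3: "fls_const (Fract p1 q) \<in> MX n" by (rule const_MX[OF pq(1)])
  have "pt [:p2:] \<in> Z2 n" unfolding Z2_iff pt_nth
  proof (intro allI impI)
    fix j i assume "i + j < n"
    thus "coeff (coeff [:p2:] j) i = 0" using low[of "Suc i" 0] by (cases j) (simp_all add: p p0)
  qed
  hence M2: "fls_const (Fract [:p2:] q) \<in> MX n" by (rule const_MX[OF pq(1)])
  have "p = [:p2:] * [:[:0, 1:]:] + p1 * [:0, 1:]" by (simp add: p p0 c)
  hence "Fract p q = Fract [:p2:] q * to_fract [:[:0, 1:]:] + Fract p1 q * to_fract [:0, 1:]"
    using pq(3) by (simp add: to_fract_def eq_fract algebra_simps)
  hence "fls_const (fls_nth a 0) = fls_const (Fract [:p2:] q) * fls_const (to_fract [:[:0, 1:]:]) +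
      fls_const (Fract p1 q) * fls_const (to_fract [:0, 1:])"
    unfolding pq(2) by (simp only: fls_const_mult_const fls_plus_const)
  hence "a = a' * x_el + fls_const (Fract [:p2:] q) * fls_const (to_fract [:[:0, 1:]:]) +
      fls_const (Fract p1 q) * fls_const (to_fract [:0, 1:])"
    using a'(2) by (simp add: mult.commute)
  thus thesis using that a'M M2 M3 by blast
qed

lemma ideal_pow_MX: "ideal_pow Ar (MX 1) n = MX n"
proof (induction n)
  case 0
  interpret cring Ar by (rule cring_Ar)
  show ?case by (simp add: MX_def filt_UNIV[OF filt_Z3])
next
  case (Suc n)
  interpret cring Ar by (rule cring_Ar)
  have "MX n \<cdot>\<^bsub>Ar\<^esub> MX 1 = MX (Suc n)"
  proof
    show "MX n \<cdot>\<^bsub>Ar\<^esub> MX 1 \<subseteq> MX (Suc n)"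
    proof
      fix c assume "c \<in> MX n \<cdot>\<^bsub>Ar\<^esub> MX 1"
      thus "c \<in> MX (Suc n)"
      proof (induction c rule: ideal_prod.induct)
        case (prod i j)
        thus ?case using MX_mult[of i n j 1] by simp
      next
        case (sum s1 s2)
        thus ?case using additive_subgroup.a_closed[OF ideal.axioms(1)[OF MX_ideal]] by metis
      qed
    qed
    show "MX (Suc n) \<subseteq> MX n \<cdot>\<^bsub>Ar\<^esub> MX 1"
    proof
      fix a assume "a \<in> MX (Suc n)"
      then obtain a1 a2 a3 where *: "a1 \<in> MX n" "a2 \<in> MX n" "a3 \<in> MX n"
        "a = a1 * x_el + a2 * fls_const (to_fract [:[:0, 1:]:]) + a3 * fls_const (to_fract [:0, 1:])" by (rule MX_Suc)
      have "a1 \<otimes>\<^bsub>Ar\<^esub> x_el \<oplus>\<^bsub>Ar\<^esub> a2 \<otimes>\<^bsub>Ar\<^esub> fls_const (to_fract [:[:0, 1:]:]) \<oplus>\<^bsub>Ar\<^esub>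
          a3 \<otimes>\<^bsub>Ar\<^esub> fls_const (to_fract [:0, 1:]) \<in> MX n \<cdot>\<^bsub>Ar\<^esub> MX 1"
        by (intro ideal_prod.sum ideal_prod.prod * x_MX yz_MX)
      thus "a \<in> MX n \<cdot>\<^bsub>Ar\<^esub> MX 1" by (simp add: *(4))
    qed
  qed
  thus ?case using Suc by (simp only: ideal_pow_Suc)
qed

text \<open>The elements of \<open>A\<close> with nonzero constant term are units.\<close>

lemma max_ideal: "the_max_ideal Ar = MX 1"
proof -
  interpret domain Ar by (rule domain_Ar)
  have MA: "MX 1 \<subseteq> A" by (auto simp: MX_def)
  have unit: "J = A" if J: "ideal J Ar" and a: "a \<in> J" "a \<notin> MX 1" for J a
  proof -
    have aA: "a \<in> A" using ideal.Icarr[OF J a(1)] by simp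
    obtain p q where pq: "unitc q" "fls_nth a 0 = Fract p q" "q \<noteq> 0" using A_nth_0[OF aA] by (rule loc_cases)
    have "Psi a \<notin> Z3 1" using a aA by (simp add: MX_def)
    hence "fps_nth (fps_nth (tay (Fract p q)) 0) 0 \<noteq> 0" unfolding Z3_1 Psi_nth using pq by simp
    hence "tay (Fract p q) \<notin> Z2 1" by (simp add: Z2_iff)
    hence "pt p \<notin> Z2 1" by (simp add: tay_Z2[OF pq(1)])
    hence "unitc p" by (simp add: Z2_iff pt_nth unitc_def poly_0_coeff_0)
    hence "a \<noteq> 0" "inverse a \<in> A" using A_unit[OF aA pq(2) _ pq(1)] by blast+
    hence "inverse a \<otimes>\<^bsub>Ar\<^esub> a \<in> J" using ideal.I_l_closed[OF J a(1), of "inverse a"] by simp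
    hence "\<one>\<^bsub>Ar\<^esub> \<in> J" using \<open>a \<noteq> 0\<close> by simp
    thus ?thesis using ideal.one_imp_carrier[OF J] by simp
  qed
  have "1 \<notin> MX 1" by (simp add: MX_def Psi_1 Z3_1 del: One_nat_def)
  hence ne: "A \<noteq> MX 1" using subrng_1[OF subrng_A] by blast
  have "maximalideal (MX 1) Ar"
  proof (rule maximalidealI[OF MX_ideal])
    show "carrier Ar \<noteq> MX 1" using ne by simp
    fix J assume "ideal J Ar" "MX 1 \<subseteq> J" "J \<subseteq> carrier Ar"
    thus "J = MX 1 \<or> J = carrier Ar" using unit by (metis subsetI subset_antisym tring_simps(1))
  qed
  moreover have "m = MX 1" if m: "maximalideal m Ar" for m
  proof -
    have im: "ideal m Ar" using m by (rule maximalideal.axioms)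
    have "m \<noteq> A" using maximalideal.I_notcarr[OF m] by simp
    hence "m \<subseteq> MX 1" using unit[OF im] by blast
    hence "MX 1 = m \<or> MX 1 = carrier Ar" using maximalideal.I_maximal[OF m MX_ideal] MA by simp
    thus ?thesis using ne by simp
  qed
  ultimately show ?thesis unfolding the_max_ideal_def by (rule the_equality)
qed

text \<open>Hence the completion of \<open>A\<close> is a subring of \<open>k[[x,y,z]]\<close>.\<close>

lemma completion: "embedded_completion Ar (MX 1) Psi Z3"
proof (intro embedded_completion.intro embedded_completion_axioms.intro cring_Ar MX_ideal filt_Z3)
  show "ideal_pow Ar (MX 1) n = {a \<in> carrier Ar. Psi a \<in> Z3 n}" for n
    unfolding ideal_pow_MX by (simp add: MX_def)
qed (simp_all add: Psi_A_add Psi_A_mult Psi_1)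

text \<open>In the completion of \<open>A\<close>, the images of \<open>f\<close> and \<open>g\<close> are the squares of \<open>u = y - \<alpha>\<close> and \<open>v = z - \<beta>\<close>, and
  \<open>uv \<notin> (f,g)\<close> because the coefficient of \<open>yz\<close> vanishes on this ideal.\<close>

theorem completed_rees:
  fixes C f' g'
  defines "C \<equiv> adic_completion Ar (MX 1)"
    and "f' \<equiv> to_completion Ar (MX 1) (f_el \<alpha>)" and "g' \<equiv> to_completion Ar (MX 1) (g_el \<beta>)"
  shows "domain C" "f' \<in> carrier C" "g' \<in> carrier C" "\<not> integrally_closed (adjoin_t C {f', g'})"
proof -
  interpret E: embedded_completion Ar "MX 1" Psi Z3 by (rule completion)
  show C: "domain C" unfolding C_def by (rule E.domain_completion)
  interpret C: domain C by (rule C)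
  have cl: "Psi r \<in> E.cl" if r: "r \<in> R_star" for r
    unfolding E.cl_def
  proof (intro CollectI allI)
    fix n
    obtain a r' where a: "a \<in> A" "r' \<in> R_star" "r = a + x_el ^ n * r'" using R_star_approx[OF r] by blast
    have aR: "a \<in> R_star" using a by (simp add: A_def)
    have "Psi (x_el ^ n * s) \<in> Z3 n" if "s \<in> R_star" for s
      using that
    proof (induction n arbitrary: s)
      case (Suc n)
      have xR: "x_el ^ n * s \<in> R_star" using Suc.prems by (intro subrng_mult[OF subrng_R_star] subrng_power[OF subrng_R_star] x_R_star)
      have "Psi (x_el ^ Suc n * s) = Psi x_el * Psi (x_el ^ n * s)"
        using Psi_mult[OF x_R_star xR] by (simp add: mult.assoc)
      thus ?case using filt_mult[OF filt_Z3 Psi_x_Z3 Suc.IH[OF Suc.prems]] by simp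
    qed (simp add: filt_UNIV[OF filt_Z3])
    hence "Psi (x_el ^ n * r') \<in> Z3 n" using a(2) .
    moreover have "Psi r = Psi a + Psi (x_el ^ n * r')" unfolding a(3)
      by (intro Psi_add aR subrng_mult[OF subrng_R_star] subrng_power[OF subrng_R_star] x_R_star a(2))
    ultimately have "Psi a - Psi r \<in> Z3 n" using filt_minus[OF filt_Z3] by simp
    thus "\<exists>a\<in>carrier Ar. Psi a - Psi r \<in> Z3 n" using a(1) by auto
  qed
  define U V where "U = Psi (emb uu)" and "V = Psi (emb vv)"
  have Ucl: "U \<in> E.cl" and Vcl: "V \<in> E.cl" unfolding U_def V_def by (intro cl emb_R_star)+
  have f: "f' = E.gam (U * U)"
    unfolding f'_def U_def Psi_mult[OF emb_R_star emb_R_star, symmetric] emb_simps(3)[symmetric]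
    using E.to_completion_eq[of "f_el \<alpha>"] f_A by (simp add: emb_ff[symmetric] ff_def power2_eq_square)
  have g: "g' = E.gam (V * V)"
    unfolding g'_def V_def Psi_mult[OF emb_R_star emb_R_star, symmetric] emb_simps(3)[symmetric]
    using E.to_completion_eq[of "g_el \<beta>"] g_A by (simp add: emb_gg[symmetric] gg_def power2_eq_square)
  have uC: "E.gam U \<in> carrier C" and vC: "E.gam V \<in> carrier C"
    unfolding C_def E.C_carrier using Ucl Vcl by blast+
  have fu: "f' = E.gam U \<otimes>\<^bsub>C\<^esub> E.gam U" and gv: "g' = E.gam V \<otimes>\<^bsub>C\<^esub> E.gam V"
    unfolding C_def f g using E.gam_mult Ucl Vcl by simp_all
  show fC: "f' \<in> carrier C" and gC: "g' \<in> carrier C" using fu gv uC vC by simp_all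
  let ?y = "fps_const fps_X :: 'k fps fps" and ?z = "fps_X :: 'k fps fps"
  have pty: "pt [:[:0, 1:]:] = ?y" and ptz: "pt [:0, 1:] = ?z"
    by (auto simp: fps_eq_iff pt_nth coeff_pCons split: nat.splits)
  have "fls_nth (emb uu) 0 = to_fract [:[:0, 1:]:]" "fls_nth (emb vv) 0 = to_fract [:0, 1:]"
    unfolding emb_uu emb_vv
    by (simp_all add: series_el_nth_0 alpha0 beta0 rhom_0[OF rhom_const_yz] y_el_def z_el_def)
  hence U0: "fps_nth U 0 = ?y" and V0: "fps_nth V 0 = ?z"
    by (simp_all add: U_def V_def Psi_nth tay_to_fract pty ptz)
  have "f' \<noteq> \<zero>\<^bsub>C\<^esub>"
  proof
    assume "f' = \<zero>\<^bsub>C\<^esub>"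
    hence "U * U = 0" using E.gam_inj[OF E.cl_mult[OF Ucl Ucl] E.cl_0] f E.gam_zero by (simp add: C_def)
    hence "?y = 0" using U0 by auto
    thus False by simp
  qed
  moreover have "E.gam U \<otimes>\<^bsub>C\<^esub> E.gam V \<notin> Idl\<^bsub>C\<^esub> {f', g'}"
  proof
    assume "E.gam U \<otimes>\<^bsub>C\<^esub> E.gam V \<in> Idl\<^bsub>C\<^esub> {f', g'}"
    then obtain a b where ab: "a \<in> carrier C" "b \<in> carrier C"
      "E.gam U \<otimes>\<^bsub>C\<^esub> E.gam V = a \<otimes>\<^bsub>C\<^esub> f' \<oplus>\<^bsub>C\<^esub> b \<otimes>\<^bsub>C\<^esub> g'"
      unfolding C.Idl2[OF fC gC] by blast
    obtain F G where FG: "F \<in> E.cl" "a = E.gam F" "G \<in> E.cl" "b = E.gam G"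
      using ab(1,2) unfolding C_def E.C_carrier by blast
    have cls: "U * U \<in> E.cl" "V * V \<in> E.cl" "F * (U * U) \<in> E.cl" "G * (V * V) \<in> E.cl" "U * V \<in> E.cl"
      by (intro E.cl_mult Ucl Vcl FG)+
    have "E.gam (U * V) = E.gam (F * (U * U) + G * (V * V))"
      using ab(3) unfolding FG f g C_def E.gam_mult[OF Ucl Vcl] E.gam_mult[OF FG(1) cls(1)]
        E.gam_mult[OF FG(3) cls(2)] E.gam_add[OF cls(3,4)] .
    hence "U * V = F * (U * U) + G * (V * V)" by (rule E.gam_inj[OF cls(5) E.cl_add[OF cls(3,4)]])
    hence "fps_nth (U * V) 0 = fps_nth (F * (U * U) + G * (V * V)) 0" by (rule arg_cong)
    hence "?y * ?z = fps_nth F 0 * (?y * ?y) + fps_nth G 0 * (?z * ?z)" by (simp add: U0 V0)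
    hence "fps_nth (fps_nth (?y * ?z) 1) 1 = fps_nth (fps_nth (fps_nth F 0 * (?y * ?y) + fps_nth G 0 * (?z * ?z)) 1) 1"
      by (rule arg_cong)
    moreover have "fps_nth (fps_nth (?y * ?z) 1) 1 = 1" by simp
    moreover have "fps_nth (fps_nth (fps_nth F 0 * (?y * ?y)) 1) 1 = 0"
      by (simp add: fps_mult_nth_1 fps_const_mult mult.assoc[symmetric])
    moreover have "fps_nth (fps_nth G 0 * (?z * ?z)) 1 = 0" by (simp add: fps_mult_nth)
    ultimately show False by simp
  qed
  ultimately show "\<not> integrally_closed (adjoin_t C {f', g'})"
    by (rule C.rees_not_integrally_closed[OF uC vC fu gv])
qed

end

section \<open>The theorem\<close>

theorem mainTheorem2:
  fixes \<alpha> \<beta> :: "'k::field_char_0 fps"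
  assumes "fps_nth \<alpha> 0 = 0" and "fps_nth \<beta> 0 = 0"
    and "alg_independent2 field_kx (fps_to_fls \<alpha>) (fps_to_fls \<beta>)"
  shows "let A = A_ring \<alpha> \<beta>; f = f_el \<alpha>; g = g_el \<beta>; P = Idl\<^bsub>A\<^esub> {f, g};
             m = the_max_ideal A; A' = adic_completion A m;
             f' = to_completion A m f; g' = to_completion A m g
         in normal_ideal A P \<and>
            adjoin_t A P = adjoin_t A {f, g} \<and>
            domain (adjoin_t A P) \<and> integrally_closed (adjoin_t A P) \<and>
            adjoin_t A' (Idl\<^bsub>A'\<^esub> {f', g'}) = adjoin_t A' {f', g'} \<and>
            domain (adjoin_t A' {f', g'}) \<and> \<not> integrally_closed (adjoin_t A' {f', g'})"
proof -
  interpret S: setting \<alpha> \<beta> by (rule setting.intro) (rule assms)+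
  interpret A: domain S.Ar by (rule S.domain_Ar)
  interpret C: domain "adic_completion S.Ar (S.MX 1)" by (rule S.completed_rees(1))
  have "S.PI \<subseteq> carrier S.Ar" using ideal.Icarr[OF S.PI_ideal] by blast
  hence "domain (adjoin_t S.Ar S.PI)" by (rule A.domain_adjoin)
  moreover have "adjoin_t S.Ar S.PI = adjoin_t S.Ar {f_el \<alpha>, g_el \<beta>}"
    by (rule A.adjoin_Idl) (simp_all add: S.f_A S.g_A)
  moreover note C.adjoin_Idl[OF S.completed_rees(2,3)]
  moreover have "domain (adjoin_t (adic_completion S.Ar (S.MX 1))
      {to_completion S.Ar (S.MX 1) (f_el \<alpha>), to_completion S.Ar (S.MX 1) (g_el \<beta>)})"
    by (rule C.domain_adjoin) (simp add: S.completed_rees(2,3) del: One_nat_def)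
  ultimately show ?thesis
    unfolding Let_def S.A_ring_eq S.max_ideal
    by (intro conjI S.normal_PI S.rees_integrally_closed S.completed_rees(4))
qed

end
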